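(* Let a stochastic sequence $\{\xi(m),m\in\mathbb Z\}$ determine a stationary stochastic $n$th increment sequence $\xi^{(n)}(m,\mu)$, $\mu>0$, with absolutely continuous spectral function $F(\lambda)$ and spectral density $f(\lambda)$ which admits the canonical factorization $f(\lambda)=|\Phi(e^{-i\lambda})|^2$. Suppose that the coefficients $a(k)$, $k\ge0$, satisfy $$\sum_{k=0}^\infty|(D^\mu a)_k|<\infty,\qquad\sum_{k=0}^\infty(k+1)|(D^\mu a)_k|^2<\infty .$$ Then the optimal (minimal mean square error) linear estimate $\hat A\xi$ of the functional $A\xi=\sum_{k=0}^\infty a(k)\xi(k)$ from observations of $\xi(m)$ at the points $m=-1,-2,\ldots$ is $$\hat A\xi=-\sum_{k=-\mu n}^{-1}v_\mu(k)\xi(k)+\int_{-\pi}^{\pi}h_\mu^{(a)}(\lambda)(1-e^{-i\lambda\mu})^n\frac1{(i\lambda)^n}dZ(\lambda),$$ where the spectral characteristic is $$h^{(a)}_\mu(\lambda)=A(e^{i\lambda})-r_\mu^{(a)}(e^{i\lambda})\Phi_\mu^{-1}(e^{-i\lambda}),$$ $$A(e^{i\lambda})=\sum_{k=0}^\infty(D^\mu a)_ke^{i\lambda k},\qquad r^{(a)}_\mu(e^{i\lambda})=\sum_{j=0}^\infty(D^\mu A\varphi_\mu)_je^{i\lambda j},$$ and the mean square error is $$\Delta(f,\hat A\xi):=\mathrm E|A\xi-\hat A\xi|^2=\frac1{2\pi}\int_{-\pi}^\pi|r_\mu^{(a)}(e^{i\lambda})|^2d\lambda=\|D^\mu A\varphi_\mu\|^2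 .$$
   Context: Let $n\ge 1$ and $\mu>0$ be integers. For a stochastic sequence $\{\xi(m),m\in\mathbb Z\}$ put $\xi^{(n)}(m,\mu)=\sum_{l=0}^n(-1)^l\binom nl\xi(m-l\mu)$. The increment sequence is (wide sense) stationary if $\mathrm E\xi^{(n)}(m_0,\mu)$ and $\mathrm E\xi^{(n)}(m_0+m,\mu_1)\overline{\xi^{(n)}(m_0,\mu_2)}$ exist for all integers $m_0,m,\mu,\mu_1,\mu_2$ and do not depend on $m_0$; the mean of the increments is assumed to be $0$. Then there are a left-continuous nondecreasing bounded function $F$ on $[-\pi,\pi]$ with $F(-\pi)=0$ (the spectral function) and an orthogonal stochastic measure $Z$ on $[-\pi,\pi)$ with $\mathrm EZ(A_1)\overline{Z(A_2)}=F(A_1\cap A_2)$ such that $\xi^{(n)}(m,\mu)=\int_{-\pi}^{\pi}e^{i\lambda m}(1-e^{-i\mu\lambda})^n(i\lambda)^{-n}dZ(\lambda)$. The spectral density $f$ is normalized by $dF(\lambda)=\frac1{2\pi}f(\lambda)d\lambda$. Canonical factorization of $f$: $f(\lambda)=|\Phi(e^{-i\lambda})|^2$, $\Phi(z)=\sum_{k\ge0}\varphi(k)z^k$, where the power series has convergence radius $>1$ and $\Phi$ has no zeros in $\{|z|\le1\}$. In this case $\xi^{(n)}(m,\mu)=\sum_{k=0}^\infty\varphi_\mu(k)\varepsilon_{m-k}$, where $\varepsilon$ is the innovation sequence (uncorrelated, mean $0$, variance $1$, with the closed span of $\{\varepsilon_m:m\le t\}$ equal to that of $\{\xi^{(n)}(m,\nu):m\le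 t,\nu>0\}$ for every $t$). Put $\Phi_\mu(z)=\sum_{k\ge0}\varphi_\mu(k)z^k$, $\varphi_\mu=(\varphi_\mu(0),\varphi_\mu(1),\ldots)\in\ell_2$. One has $|\Phi_\mu(e^{-i\lambda})|^2=|1-e^{-i\lambda\mu}|^{2n}\lambda^{-2n}f(\lambda)$ and $\Phi_\mu=w_\mu\Phi$ with $w_\mu(z)=\exp\{\frac1{4\pi}\int_{-\pi}^{\pi}\frac{e^{i\lambda}+z}{e^{i\lambda}-z}\ln\frac{|1-e^{-i\lambda\mu}|^{2n}}{\lambda^{2n}}d\lambda\}$. The numbers $d_\mu(k)$ are defined by $\sum_{k\ge0}d_\mu(k)x^k=(\sum_{j\ge0}x^{\mu j})^n$. $D^\mu$ is the linear operator in $\ell_2$ with elements $D^\mu_{k,j}=d_\mu(j-k)$ for $0\le k\le j$ and $0$ for $j<k$; $a=(a(0),a(1),\ldots)^T$; $b_\mu(k)=(D^\mu a)_k=\sum_{m\ge k}a(m)d_\mu(m-k)$. The operator $A$ has elements $(A)_{k,j}=a(k+j)$, $k,j\ge0$. Further $v_\mu(k)=\sum_{l=[-k/\mu]'}^{n}(-1)^l\binom nl b_\mu(l\mu+k)$, $k=-1,\ldots,-\mu n$, where $[x]'$ is the least integer $\ge x$. Norms of sequences are $\ell_2$ norms. The functional $A\xi$ is understood through the representation $A\xi=B\xi-V\xi$, $B\xi=\sum_{k\ge0}b_\mu(k)\xi^{(n)}(k,\mu)$, $V\xi=\sum_{k=-\mu n}^{-1}v_\mu(k)\xi(k)$; $V\xi$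 is observed. $L_2^{0-}(f)$ is the closed subspace of $L_2(f)$ generated by $e^{i\lambda k}(1-e^{-i\lambda\mu})^n(i\lambda)^{-n}$, $k\le-1$. A linear estimate of $A\xi$ is $-V\xi+\int_{-\pi}^\pi h(\lambda)(1-e^{-i\lambda\mu})^n(i\lambda)^{-n}dZ(\lambda)$ with $h(\lambda)(1-e^{-i\lambda\mu})^n(i\lambda)^{-n}\in L_2^{0-}(f)$; $h$ is its spectral characteristic. *)

theory Defs
  imports "HOL-Probability.Probability" "HOL-Complex_Analysis.Complex_Analysis"
begin

section \<open>Square-integrable functions and mean-square limits\<close>

definition sq_integrable :: "'b measure \<Rightarrow> ('b \<Rightarrow> complex) \<Rightarrow> bool" where
  "sq_integrable N g \<longleftrightarrow>
     g \<in> borel_measurable N \<and> integrable N (\<lambda>x. (cmod (g x))\<^sup>2)"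

definition L2_tendsto ::
    "'b measure \<Rightarrow> (nat \<Rightarrow> 'b \<Rightarrow> complex) \<Rightarrow> ('b \<Rightarrow> complex) \<Rightarrow> bool" where
  "L2_tendsto N s g \<longleftrightarrow>
     (\<forall>k. sq_integrable N (s k)) \<and> sq_integrable N g \<and>
     (\<lambda>k. LINT x|N. (cmod (s k x - g x))\<^sup>2) \<longlonglongrightarrow> 0"

definition L2_lim :: "'b measure \<Rightarrow> (nat \<Rightarrow> 'b \<Rightarrow> complex) \<Rightarrow> 'b \<Rightarrow> complex" where
  "L2_lim N s = (SOME g. L2_tendsto N s g)"

definition lin_combs :: "('b \<Rightarrow> complex) set \<Rightarrow> ('b \<Rightarrow> complex) set" where
  "lin_combs G = {\<lambda>x. \<Sum>g\<in>S. c g * g x | S c. finite S \<and> S \<subseteq> G}"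

definition L2_closed_span :: "'b measure \<Rightarrow> ('b \<Rightarrow> complex) set \<Rightarrow> ('b \<Rightarrow> complex) set" where
  "L2_closed_span N G = {g. \<exists>s. (\<forall>k. s k \<in> lin_combs G) \<and> L2_tendsto N s g}"


section \<open>Stationary increments\<close>

definition increment :: "nat \<Rightarrow> (int \<Rightarrow> 'w \<Rightarrow> complex) \<Rightarrow> int \<Rightarrow> int \<Rightarrow> 'w \<Rightarrow> complex" where
  "increment n \<xi> m \<mu> \<omega> = (\<Sum>l\<le>n. (-1) ^ l * of_nat (n choose l) * \<xi> (m - int l * \<mu>) \<omega>)"

definition stationary_increments :: "'w measure \<Rightarrow> nat \<Rightarrow> (int \<Rightarrow> 'w \<Rightarrow> complex) \<Rightarrow> bool" where
  "stationary_increments M n \<xi> \<longleftrightarrow>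
     (\<forall>m. \<xi> m \<in> borel_measurable M) \<and>
     (\<forall>m \<mu>. integrable M (increment n \<xi> m \<mu>)) \<and>
     (\<forall>m\<^sub>0 m \<mu>\<^sub>1 \<mu>\<^sub>2. integrable M
        (\<lambda>\<omega>. increment n \<xi> (m\<^sub>0 + m) \<mu>\<^sub>1 \<omega> * cnj (increment n \<xi> m\<^sub>0 \<mu>\<^sub>2 \<omega>))) \<and>
     (\<forall>m\<^sub>0 m\<^sub>0' \<mu>. (LINT \<omega>|M. increment n \<xi> m\<^sub>0 \<mu> \<omega>) = (LINT \<omega>|M. increment n \<xi> m\<^sub>0' \<mu> \<omega>)) \<and>
     (\<forall>m\<^sub>0 m\<^sub>0' m \<mu>\<^sub>1 \<mu>\<^sub>2.
        (LINT \<omega>|M. increment n \<xi> (m\<^sub>0 + m) \<mu>\<^sub>1 \<omega> * cnj (increment n \<xi> m\<^sub>0 \<mu>\<^sub>2 \<omega>)) =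
        (LINT \<omega>|M. increment n \<xi> (m\<^sub>0' + m) \<mu>\<^sub>1 \<omega> * cnj (increment n \<xi> m\<^sub>0' \<mu>\<^sub>2 \<omega>)))"


section \<open>Spectral representation\<close>

definition spectral_function :: "(real \<Rightarrow> real) \<Rightarrow> bool" where
  "spectral_function F \<longleftrightarrow>
     mono_on {-pi..pi} F \<and> (\<forall>x\<in>{-pi<..pi}. continuous (at_left x) F) \<and> F (-pi) = 0"

text \<open>
  The Borel measure on the line that is concentrated on \<open>[-pi, pi)\<close> and satisfies
  \<open>F([a, b)) = F b - F a\<close> there. Since \<^const>\<open>interval_measure\<close> expects a right-continuous
  function and measures intervals \<open>(a, b]\<close>, it is applied to the reflected function, and the
  result is reflected back; \<open>F\<close> is extended by constants outside \<open>[-pi, pi]\<close>.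
\<close>
definition spectral_measure :: "(real \<Rightarrow> real) \<Rightarrow> real measure" where
  "spectral_measure F =
     distr (interval_measure (\<lambda>x. - F (max (-pi) (min pi (-x))))) borel uminus"

definition orthogonal_stochastic_measure ::
    "'w measure \<Rightarrow> (real \<Rightarrow> real) \<Rightarrow> (real set \<Rightarrow> 'w \<Rightarrow> complex) \<Rightarrow> bool" where
  "orthogonal_stochastic_measure M F Z \<longleftrightarrow>
     (\<forall>A\<in>sets borel. A \<subseteq> {-pi..<pi} \<longrightarrow> sq_integrable M (Z A)) \<and>
     (\<forall>A\<in>sets borel. \<forall>B\<in>sets borel. A \<subseteq> {-pi..<pi} \<longrightarrow> B \<subseteq> {-pi..<pi} \<longrightarrow> A \<inter> B = {} \<longrightarrow>
        (AE \<omega> in M. Z (A \<union> B) \<omega> = Z A \<omega> + Z B \<omega>)) \<and>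
     (\<forall>A\<in>sets borel. \<forall>B\<in>sets borel. A \<subseteq> {-pi..<pi} \<longrightarrow> B \<subseteq> {-pi..<pi} \<longrightarrow>
        (LINT \<omega>|M. Z A \<omega> * cnj (Z B \<omega>)) = of_real (measure (spectral_measure F) (A \<inter> B)))"

definition simple_stoch_integral ::
    "(real set \<Rightarrow> 'w \<Rightarrow> complex) \<Rightarrow> (real \<Rightarrow> complex) \<Rightarrow> 'w \<Rightarrow> complex" where
  "simple_stoch_integral Z s \<omega> = (\<Sum>y\<in>range s. y * Z (s -` {y} \<inter> {-pi..<pi}) \<omega>)"

text \<open>
  \<open>X\<close> is a version of the integral of \<open>g\<close> with respect to \<open>Z\<close> over \<open>[-pi, pi)\<close>, that is, the
  mean-square limit of the integrals of simple functions converging to \<open>g\<close> in \<open>L\<^sub>2(F)\<close>; it is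
  determined up to almost sure equality.
\<close>
definition has_stoch_integral ::
    "'w measure \<Rightarrow> (real \<Rightarrow> real) \<Rightarrow> (real set \<Rightarrow> 'w \<Rightarrow> complex) \<Rightarrow>
     (real \<Rightarrow> complex) \<Rightarrow> ('w \<Rightarrow> complex) \<Rightarrow> bool" where
  "has_stoch_integral M F Z g X \<longleftrightarrow>
     (\<exists>s. (\<forall>k. simple_function borel (s k)) \<and>
          L2_tendsto (spectral_measure F) s g \<and>
          L2_tendsto M (\<lambda>k. simple_stoch_integral Z (s k)) X)"

definition stoch_integral ::
    "'w measure \<Rightarrow> (real \<Rightarrow> real) \<Rightarrow> (real set \<Rightarrow> 'w \<Rightarrow> complex) \<Rightarrow>
     (real \<Rightarrow> complex) \<Rightarrow> 'w \<Rightarrow> complex" where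
  "stoch_integral M F Z g = (SOME X. has_stoch_integral M F Z g X)"

text \<open>
  The function \<open>(1 - e\<^sup>-\<^sup>i\<^sup>\<mu>\<^sup>x)\<^sup>n (ix)\<^sup>-\<^sup>n\<close>, extended continuously to \<open>x = 0\<close>.
\<close>
definition increment_kernel :: "nat \<Rightarrow> nat \<Rightarrow> real \<Rightarrow> complex" where
  "increment_kernel n \<mu> x =
     (if x = 0 then of_nat \<mu> ^ n
      else (1 - cis (- (real \<mu> * x))) ^ n / (\<i> * of_real x) ^ n)"

definition spectral_representation ::
    "'w measure \<Rightarrow> nat \<Rightarrow> (int \<Rightarrow> 'w \<Rightarrow> complex) \<Rightarrow> (real \<Rightarrow> real) \<Rightarrow>
     (real set \<Rightarrow> 'w \<Rightarrow> complex) \<Rightarrow> bool" where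
  "spectral_representation M n \<xi> F Z \<longleftrightarrow>
     spectral_function F \<and> orthogonal_stochastic_measure M F Z \<and>
     (\<forall>m. \<forall>\<mu>>0. has_stoch_integral M F Z
        (\<lambda>x. cis (x * of_int m) * increment_kernel n \<mu> x) (increment n \<xi> m (int \<mu>)))"

text \<open>\<open>F\<close> is absolutely continuous with \<open>dF(x) = f(x) dx / (2 pi)\<close>.\<close>
definition spectral_density :: "(real \<Rightarrow> real) \<Rightarrow> (real \<Rightarrow> real) \<Rightarrow> bool" where
  "spectral_density F f \<longleftrightarrow>
     set_integrable lborel {-pi..pi} f \<and>
     (\<forall>t\<in>{-pi..pi}. F t = 1 / (2 * pi) * (LINT x:{-pi..t}|lborel. f x))"

definition L2_density_space :: "(real \<Rightarrow> real) \<Rightarrow> real measure" where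
  "L2_density_space f = density lborel (\<lambda>x. ennreal (indicator {-pi..pi} x * f x))"

definition L2_past :: "nat \<Rightarrow> nat \<Rightarrow> (real \<Rightarrow> real) \<Rightarrow> (real \<Rightarrow> complex) set" where
  "L2_past n \<mu> f = L2_closed_span (L2_density_space f)
     {\<lambda>x. cis (x * of_int k) * increment_kernel n \<mu> x | k::int. k \<le> -1}"


section \<open>Canonical factorization\<close>

definition power_series :: "(nat \<Rightarrow> complex) \<Rightarrow> complex \<Rightarrow> complex" where
  "power_series c z = (\<Sum>k. c k * z ^ k)"

definition canonical_factorization :: "(real \<Rightarrow> real) \<Rightarrow> (nat \<Rightarrow> complex) \<Rightarrow> bool" where
  "canonical_factorization f \<phi> \<longleftrightarrow>
     conv_radius \<phi> > 1 \<and>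
     (\<forall>z. cmod z \<le> 1 \<longrightarrow> power_series \<phi> z \<noteq> 0) \<and>
     (AE x in lborel. x \<in> {-pi..pi} \<longrightarrow> f x = (cmod (power_series \<phi> (cis (-x))))\<^sup>2)"

text \<open>The integrand is undefined only at finitely many points, so their junk values are harmless.\<close>
definition w_factor :: "nat \<Rightarrow> nat \<Rightarrow> complex \<Rightarrow> complex" where
  "w_factor n \<mu> z = exp (1 / (4 * of_real pi) *
     (LINT x:{-pi..pi}|lborel. (cis x + z) / (cis x - z) *
        of_real (ln (cmod (1 - cis (- (x * real \<mu>))) ^ (2 * n) / x ^ (2 * n)))))"

text \<open>
  The coefficients \<open>\<phi>\<^sub>\<mu>\<close> of \<open>\<Phi>\<^sub>\<mu> = w\<^sub>\<mu> \<Phi>\<close>. The integral formula for \<open>w\<^sub>\<mu>\<close> makes sense in the open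
  unit disc; boundary values of \<open>\<Phi>\<^sub>\<mu>\<close> are those of its power series.
\<close>
definition phi_mu :: "nat \<Rightarrow> nat \<Rightarrow> (nat \<Rightarrow> complex) \<Rightarrow> nat \<Rightarrow> complex" where
  "phi_mu n \<mu> \<phi> k = fps_nth (fps_expansion (\<lambda>z. w_factor n \<mu> z * power_series \<phi> z) 0) k"


section \<open>The functional and its estimates\<close>

definition d_coeff :: "nat \<Rightarrow> nat \<Rightarrow> nat \<Rightarrow> complex" where
  "d_coeff n \<mu> k = fps_nth (Abs_fps (\<lambda>i. if \<mu> dvd i then 1 else 0) ^ n) k"

definition D_mat :: "nat \<Rightarrow> nat \<Rightarrow> nat \<Rightarrow> nat \<Rightarrow> complex" where
  "D_mat n \<mu> k j = (if k \<le> j then d_coeff n \<mu> (j - k) else 0)"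

definition D_op :: "nat \<Rightarrow> nat \<Rightarrow> (nat \<Rightarrow> complex) \<Rightarrow> nat \<Rightarrow> complex" where
  "D_op n \<mu> x k = (\<Sum>j. D_mat n \<mu> k j * x j)"

definition A_op :: "(nat \<Rightarrow> complex) \<Rightarrow> (nat \<Rightarrow> complex) \<Rightarrow> nat \<Rightarrow> complex" where
  "A_op a x k = (\<Sum>j. a (k + j) * x j)"

definition v_coeff :: "nat \<Rightarrow> nat \<Rightarrow> (nat \<Rightarrow> complex) \<Rightarrow> int \<Rightarrow> complex" where
  "v_coeff n \<mu> a k =
     (\<Sum>l = nat \<lceil>- real_of_int k / real \<mu>\<rceil>..n.
        (-1) ^ l * of_nat (n choose l) * D_op n \<mu> a (nat (int l * int \<mu> + k)))"

definition B_partial ::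
    "nat \<Rightarrow> nat \<Rightarrow> (nat \<Rightarrow> complex) \<Rightarrow> (int \<Rightarrow> 'w \<Rightarrow> complex) \<Rightarrow> nat \<Rightarrow> 'w \<Rightarrow> complex" where
  "B_partial n \<mu> a \<xi> N \<omega> = (\<Sum>k<N. D_op n \<mu> a k * increment n \<xi> (int k) (int \<mu>) \<omega>)"

definition B_functional ::
    "'w measure \<Rightarrow> nat \<Rightarrow> nat \<Rightarrow> (nat \<Rightarrow> complex) \<Rightarrow> (int \<Rightarrow> 'w \<Rightarrow> complex) \<Rightarrow> 'w \<Rightarrow> complex" where
  "B_functional M n \<mu> a \<xi> = L2_lim M (B_partial n \<mu> a \<xi>)"

definition V_functional ::
    "nat \<Rightarrow> nat \<Rightarrow> (nat \<Rightarrow> complex) \<Rightarrow> (int \<Rightarrow> 'w \<Rightarrow> complex) \<Rightarrow> 'w \<Rightarrow> complex" where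
  "V_functional n \<mu> a \<xi> \<omega> = (\<Sum>k = - (int \<mu> * int n)..-1. v_coeff n \<mu> a k * \<xi> k \<omega>)"

definition A_functional ::
    "'w measure \<Rightarrow> nat \<Rightarrow> nat \<Rightarrow> (nat \<Rightarrow> complex) \<Rightarrow> (int \<Rightarrow> 'w \<Rightarrow> complex) \<Rightarrow> 'w \<Rightarrow> complex" where
  "A_functional M n \<mu> a \<xi> \<omega> = B_functional M n \<mu> a \<xi> \<omega> - V_functional n \<mu> a \<xi> \<omega>"

text \<open>\<open>Y\<close> is (a version of) the linear estimate with spectral characteristic \<open>h\<close>.\<close>
definition linear_estimate ::
    "'w measure \<Rightarrow> nat \<Rightarrow> nat \<Rightarrow> (nat \<Rightarrow> complex) \<Rightarrow> (int \<Rightarrow> 'w \<Rightarrow> complex) \<Rightarrow> (real \<Rightarrow> real) \<Rightarrow>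
     (real set \<Rightarrow> 'w \<Rightarrow> complex) \<Rightarrow> (real \<Rightarrow> real) \<Rightarrow> (real \<Rightarrow> complex) \<Rightarrow> ('w \<Rightarrow> complex) \<Rightarrow> bool" where
  "linear_estimate M n \<mu> a \<xi> F Z f h Y \<longleftrightarrow>
     (\<lambda>x. h x * increment_kernel n \<mu> x) \<in> L2_past n \<mu> f \<and>
     (\<exists>I. has_stoch_integral M F Z (\<lambda>x. h x * increment_kernel n \<mu> x) I \<and>
          Y = (\<lambda>\<omega>. - V_functional n \<mu> a \<xi> \<omega> + I \<omega>))"

definition mean_square_error ::
    "'w measure \<Rightarrow> nat \<Rightarrow> nat \<Rightarrow> (nat \<Rightarrow> complex) \<Rightarrow> (int \<Rightarrow> 'w \<Rightarrow> complex) \<Rightarrow> ('w \<Rightarrow> complex) \<Rightarrow> real" where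
  "mean_square_error M n \<mu> a \<xi> Y = (LINT \<omega>|M. (cmod (A_functional M n \<mu> a \<xi> \<omega> - Y \<omega>))\<^sup>2)"

definition optimal_linear_estimate ::
    "'w measure \<Rightarrow> nat \<Rightarrow> nat \<Rightarrow> (nat \<Rightarrow> complex) \<Rightarrow> (int \<Rightarrow> 'w \<Rightarrow> complex) \<Rightarrow> (real \<Rightarrow> real) \<Rightarrow>
     (real set \<Rightarrow> 'w \<Rightarrow> complex) \<Rightarrow> (real \<Rightarrow> real) \<Rightarrow> (real \<Rightarrow> complex) \<Rightarrow> ('w \<Rightarrow> complex) \<Rightarrow> bool" where
  "optimal_linear_estimate M n \<mu> a \<xi> F Z f h Y \<longleftrightarrow>
     linear_estimate M n \<mu> a \<xi> F Z f h Y \<and>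
     (\<forall>h' Y'. linear_estimate M n \<mu> a \<xi> F Z f h' Y' \<longrightarrow>
        mean_square_error M n \<mu> a \<xi> Y \<le> mean_square_error M n \<mu> a \<xi> Y')"

text \<open>
  The functions \<open>A(e\<^sup>i\<^sup>x)\<close>, \<open>r\<^sub>\<mu>(e\<^sup>i\<^sup>x)\<close> and the spectral characteristic \<open>h\<^sub>\<mu>\<close>. The boundary
  zeros of \<open>\<Phi>\<^sub>\<mu>\<close> form a null set.
\<close>
definition A_fun :: "nat \<Rightarrow> nat \<Rightarrow> (nat \<Rightarrow> complex) \<Rightarrow> complex \<Rightarrow> complex" where
  "A_fun n \<mu> a = power_series (D_op n \<mu> a)"

definition r_fun ::
    "nat \<Rightarrow> nat \<Rightarrow> (nat \<Rightarrow> complex) \<Rightarrow> (nat \<Rightarrow> complex) \<Rightarrow> complex \<Rightarrow> complex" where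
  "r_fun n \<mu> a \<phi> = power_series (D_op n \<mu> (A_op a (phi_mu n \<mu> \<phi>)))"

definition h_opt ::
    "nat \<Rightarrow> nat \<Rightarrow> (nat \<Rightarrow> complex) \<Rightarrow> (nat \<Rightarrow> complex) \<Rightarrow> real \<Rightarrow> complex" where
  "h_opt n \<mu> a \<phi> x =
     A_fun n \<mu> a (cis x) - r_fun n \<mu> a \<phi> (cis x) * inverse (power_series (phi_mu n \<mu> \<phi>) (cis (-x)))"

end

theory Submission
  imports Defs "HOL-Real_Asymp.Real_Asymp"
begin

text \<open>
  Write \<open>\<kappa>(x) = (1 - e\<^sup>-\<^sup>i\<^sup>\<mu>\<^sup>x)\<^sup>n (ix)\<^sup>-\<^sup>n\<close> for the increment kernel and \<open>b = D a\<close>. The finite part \<open>V\<close> is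
  common to the functional and to all its estimates, and the stochastic integral is an isometry
  from \<open>L\<^sub>2\<close> of the spectral measure into \<open>L\<^sub>2(M)\<close>. The mean square error of the estimate with
  spectral characteristic \<open>h'\<close> is therefore \<open>1/(2 pi)\<close> times the squared distance in \<open>L\<^sub>2(f)\<close> of
  \<open>A(e\<^sup>i\<^sup>x) \<kappa>\<close> and \<open>h' \<kappa>\<close>, and the task is to project \<open>A \<kappa>\<close> orthogonally onto the past, the closed
  span of the functions \<open>e\<^sup>i\<^sup>k\<^sup>x \<kappa>\<close> with \<open>k \<le> -1\<close>.

  Let \<open>\<Psi>(x) = \<Phi>\<^sub>\<mu>(e\<^sup>-\<^sup>i\<^sup>x)\<close>. Since \<open>|\<kappa>|\<^sup>2 f = |\<Psi>|\<^sup>2\<close> almost everywhere, the map \<open>u \<kappa> \<mapsto> u \<Psi>\<close> is,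
  up to the constant \<open>2 pi\<close>, an isometry into \<open>L\<^sub>2\<close> of the circle, and there the projection splits frequencies.
  The coefficient of \<open>A \<Psi>\<close> at \<open>e\<^sup>i\<^sup>k\<^sup>x\<close>, for \<open>k \<ge> 0\<close>, is \<open>\<Sum>j. \<phi>\<^sub>\<mu>(j) b(k + j)\<close>, and this is the
  \<open>k\<close>-th entry of \<open>D A \<phi>\<^sub>\<mu>\<close>. So \<open>A \<Psi> = r + g\<close>, where \<open>r\<close> has frequencies \<open>\<ge> 0\<close> and \<open>g = h \<Psi>\<close> has
  frequencies \<open>< 0\<close>. The part \<open>r\<close> is orthogonal to \<open>e\<^sup>i\<^sup>k\<^sup>x \<Psi>\<close> for \<open>k \<le> -1\<close>, because the product of \<open>r\<close>
  with the conjugate of \<open>e\<^sup>i\<^sup>k\<^sup>x \<Psi>\<close> has only positive frequencies (\<open>orthogonal_past\<close>). The part \<open>g\<close> lies in the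
  closed span because \<open>\<Phi>\<^sub>\<mu>\<close> is outer (\<open>analytic_past\<close>). Pythagoras' theorem (\<open>residual_pythagoras\<close>)
  gives the optimality of \<open>h\<close>, the uniqueness of the optimal estimate and the value \<open>\<parallel>r\<parallel>\<^sup>2\<close> of the error, and Parseval's
  identity rewrites it as the sum of the squared coefficients.

  The analytic work is to make sense of boundary values. The logarithm of \<open>|\<kappa>|\<close> is \<open>n\<close> times
  \<open>ln |1 - e\<^sup>-\<^sup>i\<^sup>\<mu>\<^sup>x| - ln |1 - e\<^sup>-\<^sup>i\<^sup>x| + ln (sin(x/2) / (x/2))\<close>. The Herglotz integrals of the first two terms
  exponentiate to \<open>1 - z\<^sup>\<mu>\<close> and \<open>1 - z\<close> (\<open>exp_herglotz_log_modulus\<close>). The third function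
  extends to a Lipschitz function on the circle whose derivative is square-integrable, so its Fourier
  coefficients are absolutely summable. Hence
  \<open>\<Phi>\<^sub>\<mu> = (1 + z + \<dots> + z\<^sup>\<mu>\<^sup>-\<^sup>1)\<^sup>n e\<^sup>n\<^sup>S \<Phi>\<close> with an absolutely convergent series \<open>S\<close>
  (\<open>phi_mu_power_series\<close>), all series involved converge absolutely on the closed disc, and the only
  boundary zeros of \<open>\<Phi>\<^sub>\<mu>\<close> are roots of unity. The series defining \<open>D\<close> need not
  converge absolutely; that \<open>D A \<phi>\<^sub>\<mu>\<close> may be computed termwise (\<open>D_op_A_op\<close>) rests on a bound for its
  partial sums by Abel summation.
\<close>

section \<open>Geometry of square-integrable functions\<close>

text \<open>
  The norm of \<open>L\<^sub>2(N)\<close>, a seminorm on functions; it is \<open>0\<close> by default when the integral does not exist.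
\<close>
definition l2n :: "'b measure \<Rightarrow> ('b \<Rightarrow> complex) \<Rightarrow> real" where
  "l2n N g = sqrt (LINT x|N. (cmod (g x))\<^sup>2)"

lemma l2n_nonneg [simp]: "l2n N g \<ge> 0"
  by (simp add: l2n_def)

lemma l2n_sq: "(l2n N g)\<^sup>2 = (LINT x|N. (cmod (g x))\<^sup>2)"
  by (simp add: l2n_def)

lemma sq_integrable_bound:
  assumes "g \<in> borel_measurable N" "integrable N h" "AE x in N. (cmod (g x))\<^sup>2 \<le> h x"
  shows "sq_integrable N g"
  unfolding sq_integrable_def
proof
  show "integrable N (\<lambda>x. (cmod (g x))\<^sup>2)"
    by (rule Bochner_Integration.integrable_bound[OF assms(2)])
      (use assms in \<open>auto elim!: eventually_mono\<close>)
qed fact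

lemma sq_integrable_measurable: "sq_integrable N g \<Longrightarrow> g \<in> borel_measurable N"
  by (simp add: sq_integrable_def)

lemma sq_integrable_integrable: "sq_integrable N g \<Longrightarrow> integrable N (\<lambda>x. (cmod (g x))\<^sup>2)"
  by (simp add: sq_integrable_def)

lemma cmod_add_sq_le: "(cmod (a + b))\<^sup>2 \<le> 2 * (cmod a)\<^sup>2 + 2 * (cmod b)\<^sup>2"
proof -
  have "(cmod (a + b))\<^sup>2 \<le> (cmod a + cmod b)\<^sup>2"
    by (intro power_mono norm_triangle_ineq) auto
  also have "\<dots> \<le> 2 * (cmod a)\<^sup>2 + 2 * (cmod b)\<^sup>2"
    using sum_squares_bound[of "cmod a" "cmod b"] by (simp add: power2_sum)
  finally show ?thesis .
qed

lemma sq_integrable_add: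
  assumes "sq_integrable N g" "sq_integrable N h"
  shows "sq_integrable N (\<lambda>x. g x + h x)"
  by (rule sq_integrable_bound[where h = "\<lambda>x. 2 * (cmod (g x))\<^sup>2 + 2 * (cmod (h x))\<^sup>2"])
    (use assms in \<open>auto simp: sq_integrable_def cmod_add_sq_le\<close>)

lemma sq_integrable_cmult:
  assumes "sq_integrable N g"
  shows "sq_integrable N (\<lambda>x. c * g x)"
  using assms by (auto simp: sq_integrable_def norm_mult power_mult_distrib)

lemma sq_integrable_uminus: "sq_integrable N g \<Longrightarrow> sq_integrable N (\<lambda>x. - g x)"
  using sq_integrable_cmult[of N g "-1"] by simp

lemma sq_integrable_diff:
  "sq_integrable N g \<Longrightarrow> sq_integrable N h \<Longrightarrow> sq_integrable N (\<lambda>x. g x - h x)"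
  using sq_integrable_add[OF _ sq_integrable_uminus, of N g h] by simp

lemma sq_integrable_zero [simp]: "sq_integrable N (\<lambda>x. 0)"
  by (simp add: sq_integrable_def)

lemma sq_integrable_sum:
  assumes "\<And>i. i \<in> I \<Longrightarrow> sq_integrable N (g i)"
  shows "sq_integrable N (\<lambda>x. \<Sum>i\<in>I. g i x)"
  using assms by (induction I rule: infinite_finite_induct) (auto intro: sq_integrable_add)

lemma sq_integrable_bounded:
  assumes "finite_measure N" "g \<in> borel_measurable N" "\<And>x. cmod (g x) \<le> C"
  shows "sq_integrable N g"
proof (rule sq_integrable_bound[where h = "\<lambda>x. C\<^sup>2"])
  show "integrable N (\<lambda>x. C\<^sup>2)" using assms(1) by (simp add: finite_measure.integrable_const)
qed (use assms in \<open>auto intro!: power_mono\<close>)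

lemma sq_integrable_mult_norm:
  assumes "sq_integrable N g" "sq_integrable N h"
  shows "integrable N (\<lambda>x. cmod (g x) * cmod (h x))"
proof (rule Bochner_Integration.integrable_bound[where f = "\<lambda>x. (cmod (g x))\<^sup>2 + (cmod (h x))\<^sup>2"])
  show "AE x in N. norm (cmod (g x) * cmod (h x)) \<le> norm ((cmod (g x))\<^sup>2 + (cmod (h x))\<^sup>2)"
  proof (rule AE_I2)
    fix x
    have "2 * (cmod (g x) * cmod (h x)) \<le> (cmod (g x))\<^sup>2 + (cmod (h x))\<^sup>2"
      using sum_squares_bound[of "cmod (g x)" "cmod (h x)"] by simp
    moreover have "0 \<le> cmod (g x) * cmod (h x)" by simp
    ultimately have "cmod (g x) * cmod (h x) \<le> (cmod (g x))\<^sup>2 + (cmod (h x))\<^sup>2" by linarith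
    then show "norm (cmod (g x) * cmod (h x)) \<le> norm ((cmod (g x))\<^sup>2 + (cmod (h x))\<^sup>2)"
      by simp
  qed
qed (use assms in \<open>auto simp: sq_integrable_def\<close>)

lemma sq_integrable_prod:
  assumes "sq_integrable N g" "sq_integrable N h"
  shows "integrable N (\<lambda>x. g x * cnj (h x))"
proof (rule Bochner_Integration.integrable_bound[OF sq_integrable_mult_norm[OF assms]])
  show "(\<lambda>x. g x * cnj (h x)) \<in> borel_measurable N"
    using assms[THEN sq_integrable_measurable]
    by (auto intro!: borel_measurable_times measurable_compose[OF _ borel_measurable_continuous_onI[OF continuous_on_cnj[OF continuous_on_id]]])
qed (auto simp: norm_mult)

text \<open>
  The quadratic polynomial \<open>t\<^sup>2 G - 2 t P + H\<close>, the integral of \<open>(t |g| - |h|)\<^sup>2\<close>, is nonnegative;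
  its value at \<open>t = P / G\<close> gives the inequality.
\<close>
lemma Cauchy_Schwarz_norm:
  assumes g: "sq_integrable N g" and h: "sq_integrable N h"
  shows "(LINT x|N. cmod (g x) * cmod (h x)) \<le> l2n N g * l2n N h"
proof -
  define G H P where "G = (LINT x|N. (cmod (g x))\<^sup>2)" and "H = (LINT x|N. (cmod (h x))\<^sup>2)"
    and "P = (LINT x|N. cmod (g x) * cmod (h x))"
  note ints = g[THEN sq_integrable_integrable] h[THEN sq_integrable_integrable]
    sq_integrable_mult_norm[OF g h]
  have P0: "P \<ge> 0" unfolding P_def by (intro integral_nonneg_AE) auto
  have G0: "G \<ge> 0" unfolding G_def by (intro integral_nonneg_AE) auto
  have quad: "0 \<le> t\<^sup>2 * G - 2 * t * P + H" for t :: real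
  proof -
    have "0 \<le> (LINT x|N. (t * cmod (g x) - cmod (h x))\<^sup>2)" by (intro integral_nonneg_AE) auto
    also have "\<dots> = (LINT x|N. t\<^sup>2 * (cmod (g x))\<^sup>2 - (2 * t) * (cmod (g x) * cmod (h x)) + (cmod (h x))\<^sup>2)"
      by (intro Bochner_Integration.integral_cong) (auto simp: power2_diff power_mult_distrib)
    also have "\<dots> = t\<^sup>2 * G - 2 * t * P + H"
      using ints by (simp add: G_def H_def P_def)
    finally show ?thesis .
  qed
  have "P\<^sup>2 \<le> G * H"
  proof (cases "G = 0")
    case True
    have "P = 0"
    proof (rule ccontr)
      assume "P \<noteq> 0"
      then show False using quad[of "(H + 1) / (2 * P)"] True by simp
    qed
    then show ?thesis using True by simp
  next
    case False
    have "0 \<le> (P / G)\<^sup>2 * G - 2 * (P / G) * P + H" by (rule quad)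
    also have "\<dots> = H - P\<^sup>2 / G" using False by (simp add: field_simps power2_eq_square)
    finally have "P\<^sup>2 / G \<le> H" by simp
    then show ?thesis using False G0 by (simp add: field_simps)
  qed
  then have "sqrt (P\<^sup>2) \<le> sqrt (G * H)" by (rule real_sqrt_le_mono)
  then show ?thesis using P0 by (simp add: l2n_def P_def G_def H_def real_sqrt_mult)
qed

lemma Cauchy_Schwarz_inner:
  assumes "sq_integrable N g" "sq_integrable N h"
  shows "cmod (LINT x|N. g x * cnj (h x)) \<le> l2n N g * l2n N h"
proof -
  have "cmod (LINT x|N. g x * cnj (h x)) \<le> (LINT x|N. cmod (g x * cnj (h x)))"
    by (rule integral_norm_bound)
  then show ?thesis using Cauchy_Schwarz_norm[OF assms] by (simp add: norm_mult)
qed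

lemma l2n_triangle:
  assumes g: "sq_integrable N g" and h: "sq_integrable N h"
  shows "l2n N (\<lambda>x. g x + h x) \<le> l2n N g + l2n N h"
proof (rule power2_le_imp_le)
  note ints = g[THEN sq_integrable_integrable] h[THEN sq_integrable_integrable]
    sq_integrable_mult_norm[OF g h] sq_integrable_add[OF g h, THEN sq_integrable_integrable]
  have "(l2n N (\<lambda>x. g x + h x))\<^sup>2 = (LINT x|N. (cmod (g x + h x))\<^sup>2)" by (rule l2n_sq)
  also have "\<dots> \<le> (LINT x|N. (cmod (g x))\<^sup>2 + 2 * (cmod (g x) * cmod (h x)) + (cmod (h x))\<^sup>2)"
  proof (rule integral_mono)
    fix x
    have "(cmod (g x + h x))\<^sup>2 \<le> (cmod (g x) + cmod (h x))\<^sup>2"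
      by (intro power_mono norm_triangle_ineq) auto
    then show "(cmod (g x + h x))\<^sup>2 \<le> (cmod (g x))\<^sup>2 + 2 * (cmod (g x) * cmod (h x)) + (cmod (h x))\<^sup>2"
      by (simp add: power2_sum)
  qed (use ints in auto)
  also have "\<dots> = (l2n N g)\<^sup>2 + 2 * (LINT x|N. cmod (g x) * cmod (h x)) + (l2n N h)\<^sup>2"
    using ints by (simp add: l2n_sq)
  also have "\<dots> \<le> (l2n N g + l2n N h)\<^sup>2"
    using Cauchy_Schwarz_norm[OF g h] by (simp add: power2_sum)
  finally show "(l2n N (\<lambda>x. g x + h x))\<^sup>2 \<le> (l2n N g + l2n N h)\<^sup>2" .
qed simp

lemma l2n_minus_commute: "l2n N (\<lambda>x. g x - h x) = l2n N (\<lambda>x. h x - g x)"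
  by (simp add: l2n_def norm_minus_commute)

lemma l2n_reverse_triangle:
  assumes g: "sq_integrable N g" and h: "sq_integrable N h"
  shows "\<bar>l2n N g - l2n N h\<bar> \<le> l2n N (\<lambda>x. g x - h x)"
  using l2n_triangle[OF sq_integrable_diff[OF g h] h] l2n_triangle[OF sq_integrable_diff[OF h g] g]
  by (simp add: l2n_minus_commute[of N h g])

lemma l2n_triangle_diff:
  assumes "sq_integrable N f" "sq_integrable N g" "sq_integrable N h"
  shows "l2n N (\<lambda>x. f x - h x) \<le> l2n N (\<lambda>x. f x - g x) + l2n N (\<lambda>x. g x - h x)"
  using l2n_triangle[OF sq_integrable_diff[OF assms(1,2)] sq_integrable_diff[OF assms(2,3)]] by simp

lemma l2n_cong_AE:
  assumes "AE x in N. g x = h x" "g \<in> borel_measurable N" "h \<in> borel_measurable N"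
  shows "l2n N g = l2n N h"
  unfolding l2n_def by (intro arg_cong[where f = sqrt] integral_cong_AE) (use assms in auto)

lemma sq_integrable_cong_AE:
  assumes "AE x in N. g x = h x" "g \<in> borel_measurable N" "h \<in> borel_measurable N"
  shows "sq_integrable N g = sq_integrable N h"
  unfolding sq_integrable_def
  by (intro conj_cong integrable_cong_AE) (use assms in auto)

lemma l2n_eq_0_iff:
  assumes "sq_integrable N g"
  shows "l2n N g = 0 \<longleftrightarrow> (AE x in N. g x = 0)"
  using integral_nonneg_eq_0_iff_AE[OF sq_integrable_integrable[OF assms]] by (simp add: l2n_def)

lemma L2_tendsto_iff_l2n:
  "L2_tendsto N s g \<longleftrightarrow>
     (\<forall>k. sq_integrable N (s k)) \<and> sq_integrable N g \<and> (\<lambda>k. l2n N (\<lambda>x. s k x - g x)) \<longlonglongrightarrow> 0"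
proof -
  have "((\<lambda>k. LINT x|N. (cmod (s k x - g x))\<^sup>2) \<longlonglongrightarrow> 0) \<longleftrightarrow> (\<lambda>k. l2n N (\<lambda>x. s k x - g x)) \<longlonglongrightarrow> 0"
  proof
    assume "(\<lambda>k. LINT x|N. (cmod (s k x - g x))\<^sup>2) \<longlonglongrightarrow> 0"
    from tendsto_real_sqrt[OF this] show "(\<lambda>k. l2n N (\<lambda>x. s k x - g x)) \<longlonglongrightarrow> 0"
      by (simp add: l2n_def)
  next
    assume "(\<lambda>k. l2n N (\<lambda>x. s k x - g x)) \<longlonglongrightarrow> 0"
    from tendsto_power[OF this, of 2] show "(\<lambda>k. LINT x|N. (cmod (s k x - g x))\<^sup>2) \<longlonglongrightarrow> 0"
      by (simp add: l2n_sq)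
  qed
  then show ?thesis by (simp add: L2_tendsto_def)
qed

lemma L2_tendsto_l2n_le:
  assumes "\<And>k. sq_integrable N (s k)" "sq_integrable N g"
    "\<And>k. l2n N (\<lambda>x. s k x - g x) \<le> e k" "e \<longlonglongrightarrow> 0"
  shows "L2_tendsto N s g"
  unfolding L2_tendsto_iff_l2n
  using assms tendsto_sandwich[OF _ _ tendsto_const assms(4), of "\<lambda>k. l2n N (\<lambda>x. s k x - g x)"]
  by auto

lemma L2_tendsto_cong_AE:
  assumes "L2_tendsto N s g" "\<And>k. AE x in N. s k x = t k x" "\<And>k. t k \<in> borel_measurable N"
  shows "L2_tendsto N t g"
  unfolding L2_tendsto_iff_l2n
proof (intro conjI allI)
  have sm: "s k \<in> borel_measurable N" and gm: "g \<in> borel_measurable N" for k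
    using assms(1) by (auto simp: L2_tendsto_def sq_integrable_measurable)
  show "sq_integrable N (t k)" for k
    using sq_integrable_cong_AE[OF assms(2) sm assms(3)] assms(1) by (auto simp: L2_tendsto_def)
  show "sq_integrable N g" using assms(1) by (auto simp: L2_tendsto_def)
  have "l2n N (\<lambda>x. t k x - g x) = l2n N (\<lambda>x. s k x - g x)" for k
    by (rule l2n_cong_AE) (use assms(2)[of k] assms(3) sm gm in \<open>auto elim: eventually_mono\<close>)
  then show "(\<lambda>k. l2n N (\<lambda>x. t k x - g x)) \<longlonglongrightarrow> 0"
    using assms(1) by (simp add: L2_tendsto_iff_l2n)
qed

lemma L2_tendsto_add_cmult:
  assumes s: "L2_tendsto N s g" and t: "L2_tendsto N t h"
  shows "L2_tendsto N (\<lambda>k x. s k x + c * t k x) (\<lambda>x. g x + c * h x)"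
proof (rule L2_tendsto_l2n_le[where e = "\<lambda>k. l2n N (\<lambda>x. s k x - g x) + cmod c * l2n N (\<lambda>x. t k x - h x)"])
  note sq = s[unfolded L2_tendsto_iff_l2n] t[unfolded L2_tendsto_iff_l2n]
  show "sq_integrable N (\<lambda>x. s k x + c * t k x)" for k
    using sq by (auto intro!: sq_integrable_add sq_integrable_cmult)
  show "sq_integrable N (\<lambda>x. g x + c * h x)"
    using sq by (auto intro!: sq_integrable_add sq_integrable_cmult)
  show "l2n N (\<lambda>x. s k x + c * t k x - (g x + c * h x))
      \<le> l2n N (\<lambda>x. s k x - g x) + cmod c * l2n N (\<lambda>x. t k x - h x)" for k
  proof -
    have "l2n N (\<lambda>x. s k x + c * t k x - (g x + c * h x)) = l2n N (\<lambda>x. (s k x - g x) + c * (t k x - h x))"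
      by (simp add: algebra_simps)
    also have "\<dots> \<le> l2n N (\<lambda>x. s k x - g x) + l2n N (\<lambda>x. c * (t k x - h x))"
      using sq by (intro l2n_triangle sq_integrable_cmult sq_integrable_diff) auto
    also have "l2n N (\<lambda>x. c * (t k x - h x)) = cmod c * l2n N (\<lambda>x. t k x - h x)"
      by (simp add: l2n_def norm_mult power_mult_distrib real_sqrt_mult)
    finally show ?thesis .
  qed
  have "(\<lambda>k. l2n N (\<lambda>x. s k x - g x) + cmod c * l2n N (\<lambda>x. t k x - h x)) \<longlonglongrightarrow> 0 + cmod c * 0"
    using sq by (intro tendsto_intros) auto
  then show "(\<lambda>k. l2n N (\<lambda>x. s k x - g x) + cmod c * l2n N (\<lambda>x. t k x - h x)) \<longlonglongrightarrow> 0" by simp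
qed

lemma L2_tendsto_const: "sq_integrable N g \<Longrightarrow> L2_tendsto N (\<lambda>k. g) g"
  by (simp add: L2_tendsto_def)

lemma L2_tendsto_diff:
  "L2_tendsto N s g \<Longrightarrow> L2_tendsto N t h \<Longrightarrow> L2_tendsto N (\<lambda>k x. s k x - t k x) (\<lambda>x. g x - h x)"
  using L2_tendsto_add_cmult[of N s g t h "-1"] by simp

lemma L2_tendsto_norm:
  assumes "L2_tendsto N s g"
  shows "(\<lambda>k. l2n N (s k)) \<longlonglongrightarrow> l2n N g"
proof (rule LIM_zero_cancel, rule tendsto_rabs_zero_cancel, rule tendsto_sandwich[OF _ _ tendsto_const])
  show "(\<lambda>k. l2n N (\<lambda>x. s k x - g x)) \<longlonglongrightarrow> 0" using assms by (simp add: L2_tendsto_iff_l2n)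
qed (use assms in \<open>auto intro!: always_eventually l2n_reverse_triangle simp: L2_tendsto_iff_l2n\<close>)

text \<open>
  Orthogonality passes to mean-square limits by the Cauchy-Schwarz inequality.
\<close>
lemma L2_tendsto_inner_zero:
  assumes s: "L2_tendsto N s g" and h: "sq_integrable N h"
    and zero: "\<And>k. (LINT x|N. h x * cnj (s k x)) = 0"
  shows "(LINT x|N. h x * cnj (g x)) = 0"
proof -
  have sq: "sq_integrable N (s k)" "sq_integrable N g" for k using s by (auto simp: L2_tendsto_def)
  have "cmod (LINT x|N. h x * cnj (g x)) \<le> l2n N h * l2n N (\<lambda>x. s k x - g x)" for k
  proof -
    have "(LINT x|N. h x * cnj (s k x - g x)) = - (LINT x|N. h x * cnj (g x))"
      using sq_integrable_prod[OF h sq(1)[of k]] sq_integrable_prod[OF h sq(2)] zero[of k]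
      by (simp add: right_diff_distrib)
    then show ?thesis
      using Cauchy_Schwarz_inner[OF h sq_integrable_diff[OF sq(1)[of k] sq(2)]] by simp
  qed
  moreover have "(\<lambda>k. l2n N h * l2n N (\<lambda>x. s k x - g x)) \<longlonglongrightarrow> l2n N h * 0"
    using s by (intro tendsto_intros) (auto simp: L2_tendsto_iff_l2n)
  ultimately have "cmod (LINT x|N. h x * cnj (g x)) \<le> l2n N h * 0"
    by (intro LIMSEQ_le_const) auto
  then show ?thesis by simp
qed

lemma l2n_pythagoras:
  assumes g: "sq_integrable N g" and h: "sq_integrable N h" and orth: "(LINT x|N. g x * cnj (h x)) = 0"
  shows "(l2n N (\<lambda>x. g x + h x))\<^sup>2 = (l2n N g)\<^sup>2 + (l2n N h)\<^sup>2"
proof -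
  have int: "integrable N (\<lambda>x. g x * cnj (h x))" by (rule sq_integrable_prod[OF g h])
  define q where "q x = Re (g x * cnj (h x))" for x
  have "(LINT x|N. q x) = 0" and qint: "integrable N q"
    unfolding q_def using integral_Re[OF int] orth integrable_Re[OF int] by simp_all
  moreover have "(cmod (g x + h x))\<^sup>2 = (cmod (g x))\<^sup>2 + (cmod (h x))\<^sup>2 + 2 * q x" for x
    unfolding q_def by (simp add: cmod_power2 power2_sum algebra_simps)
  ultimately show ?thesis
    using g[THEN sq_integrable_integrable] h[THEN sq_integrable_integrable]
    by (simp add: l2n_sq)
qed

lemma l2n_mono_AE:
  assumes "sq_integrable N h" "g \<in> borel_measurable N" "AE x in N. cmod (g x) \<le> cmod (h x)"
  shows "l2n N g \<le> l2n N h"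
proof -
  have "AE x in N. (cmod (g x))\<^sup>2 \<le> (cmod (h x))\<^sup>2"
    using assms(3) by eventually_elim (simp add: power_mono)
  moreover from this have "sq_integrable N g"
    using assms by (intro sq_integrable_bound[where h="\<lambda>x. (cmod (h x))\<^sup>2"]) (auto simp: sq_integrable_def)
  ultimately show ?thesis
    using assms(1) by (auto simp: l2n_def sq_integrable_def intro!: integral_mono_AE)
qed

text \<open>
  The Riesz-Fischer theorem. Along a subsequence with geometrically decreasing steps the sum of the absolute
  steps has finite integral, since the total mass is finite; the subsequence then converges almost
  everywhere, and Fatou's lemma turns the pointwise limit into a mean-square limit of the whole sequence.
\<close>
lemma L2_complete:
  assumes fin: "finite_measure N" and sq: "\<And>k. sq_integrable N (s k)"
    and cauchy: "\<And>e. e > 0 \<Longrightarrow> \<exists>K. \<forall>i\<ge>K. \<forall>j\<ge>K. l2n N (\<lambda>x. s i x - s j x) < e"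
  shows "\<exists>g. L2_tendsto N s g"
proof -
  interpret finite_measure N by (rule fin)
  have m [measurable]: "s k \<in> borel_measurable N" for k using sq by (simp add: sq_integrable_measurable)
  have sqd: "sq_integrable N (\<lambda>x. s i x - s j x)" for i j using sq by (intro sq_integrable_diff)
  have "\<exists>K. \<forall>i\<ge>K. \<forall>j\<ge>K. l2n N (\<lambda>x. s i x - s j x) < (1/2) ^ k" for k :: nat
    by (rule cauchy) simp
  then obtain K where K: "\<And>k i j. i \<ge> K k \<Longrightarrow> j \<ge> K k \<Longrightarrow> l2n N (\<lambda>x. s i x - s j x) < (1/2) ^ k"
    by metis
  \<comment> \<open>Adding up makes the indices increasing while keeping them beyond \<open>K k\<close>.\<close>
  define r where "r k = (\<Sum>i\<le>k. K i) + k" for k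
  have r1: "K k \<le> r k" for k
    using member_le_sum[of k "{..k}" K] by (simp add: r_def)
  have r2: "r k \<le> r (Suc k)" for k by (simp add: r_def)
  have r3: "k \<le> r k" for k by (simp add: r_def)
  define D where "D k x = cmod (s (r (Suc k)) x - s (r k) x)" for k x
  have Dm [measurable]: "D k \<in> borel_measurable N" for k unfolding D_def by measurable
  define C where "C = l2n N (\<lambda>x. 1)"
  have one: "sq_integrable N (\<lambda>x. 1)" by (simp add: sq_integrable_def)
  have Dint: "integrable N (D k)" and Dle: "(LINT x|N. D k x) \<le> (1/2)^k * C" for k
  proof -
    show "integrable N (D k)"
      unfolding D_def[abs_def] using sq_integrable_mult_norm[OF sqd one] by simp
    have "(LINT x|N. D k x) \<le> l2n N (\<lambda>x. s (r (Suc k)) x - s (r k) x) * C"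
      using Cauchy_Schwarz_norm[OF sqd[of "r (Suc k)" "r k"] one] by (simp add: D_def[abs_def] C_def)
    also have "\<dots> \<le> (1/2)^k * C"
      using K[of k "r (Suc k)" "r k"] r1[of k] r2[of k]
      by (intro mult_right_mono) (auto simp: C_def)
    finally show "(LINT x|N. D k x) \<le> (1/2)^k * C" .
  qed
  have C0: "C \<ge> 0" by (simp add: C_def)
  have "(\<integral>\<^sup>+x. (\<Sum>k. ennreal (D k x)) \<partial>N) = (\<Sum>k. \<integral>\<^sup>+x. ennreal (D k x) \<partial>N)"
    by (rule nn_integral_suminf) measurable
  also have "\<dots> = (\<Sum>k. ennreal (LINT x|N. D k x))"
    by (intro suminf_cong nn_integral_eq_integral Dint) (simp add: D_def)
  also have "\<dots> \<le> (\<Sum>k. ennreal ((1/2)^k * C))"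
    using Dle by (intro suminf_le ennreal_leI) auto
  also have "\<dots> = ennreal (\<Sum>k. (1/2)^k * C)"
    using C0 by (intro suminf_ennreal2 summable_mult2 summable_geometric) auto
  also have "\<dots> < \<infinity>" by simp
  finally have "(\<integral>\<^sup>+x. (\<Sum>k. ennreal (D k x)) \<partial>N) \<noteq> \<infinity>" by simp
  then have "AE x in N. (\<Sum>k. ennreal (D k x)) \<noteq> \<infinity>"
    by (intro nn_integral_PInf_AE) auto
  then have conv: "AE x in N. convergent (\<lambda>k. s (r k) x)"
  proof eventually_elim
    fix x assume "(\<Sum>k. ennreal (D k x)) \<noteq> \<infinity>"
    then have "summable (\<lambda>k. D k x)" by (intro summable_suminf_not_top) (auto simp: D_def)
    then have "summable (\<lambda>k. s (r (Suc k)) x - s (r k) x)"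
      unfolding D_def by (rule summable_norm_cancel)
    then have "convergent (\<lambda>n. \<Sum>k<n. s (r (Suc k)) x - s (r k) x)"
      by (simp add: summable_iff_convergent)
    then have "convergent (\<lambda>n. s (r n) x - s (r 0) x)" using sum_lessThan_telescope[of "\<lambda>k. s (r k) x"] by simp
    from convergent_add[OF this convergent_const[of "s (r 0) x"]] show "convergent (\<lambda>k. s (r k) x)" by simp
  qed
  define g where "g x = lim (\<lambda>k. s (r k) x)" for x
  have gm [measurable]: "g \<in> borel_measurable N" unfolding g_def by measurable
  have lim: "AE x in N. (\<lambda>k. s (r k) x) \<longlonglongrightarrow> g x"
    using conv by eventually_elim (simp add: g_def convergent_LIMSEQ_iff)
  have close: "sq_integrable N (\<lambda>x. s i x - g x) \<and> l2n N (\<lambda>x. s i x - g x) \<le> e"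
    if i: "\<And>j. j \<ge> i0 \<Longrightarrow> l2n N (\<lambda>x. s i x - s j x) \<le> e" and e: "e > 0" for i i0 e
  proof -
    have "(\<integral>\<^sup>+x. ennreal ((cmod (s i x - g x))\<^sup>2) \<partial>N)
        = (\<integral>\<^sup>+x. liminf (\<lambda>k. ennreal ((cmod (s i x - s (r k) x))\<^sup>2)) \<partial>N)"
    proof (rule nn_integral_cong_AE)
      show "AE x in N. ennreal ((cmod (s i x - g x))\<^sup>2) = liminf (\<lambda>k. ennreal ((cmod (s i x - s (r k) x))\<^sup>2))"
        using lim
      proof eventually_elim
        fix x assume "(\<lambda>k. s (r k) x) \<longlonglongrightarrow> g x"
        then have "(\<lambda>k. ennreal ((cmod (s i x - s (r k) x))\<^sup>2)) \<longlonglongrightarrow> ennreal ((cmod (s i x - g x))\<^sup>2)"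
          by (intro tendsto_ennrealI tendsto_intros)
        then show "ennreal ((cmod (s i x - g x))\<^sup>2) = liminf (\<lambda>k. ennreal ((cmod (s i x - s (r k) x))\<^sup>2))"
          by (rule lim_imp_Liminf[OF trivial_limit_sequentially, symmetric])
      qed
    qed
    also have "\<dots> \<le> liminf (\<lambda>k. \<integral>\<^sup>+x. ennreal ((cmod (s i x - s (r k) x))\<^sup>2) \<partial>N)"
      by (rule nn_integral_liminf) measurable
    also have "\<dots> \<le> ennreal (e\<^sup>2)"
    proof (rule Liminf_le)
      show "\<forall>\<^sub>F k in sequentially. (\<integral>\<^sup>+x. ennreal ((cmod (s i x - s (r k) x))\<^sup>2) \<partial>N) \<le> ennreal (e\<^sup>2)"
        using eventually_ge_at_top[of i0]
      proof eventually_elim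
        fix k assume "i0 \<le> k"
        then have "l2n N (\<lambda>x. s i x - s (r k) x) \<le> e" using r3[of k] by (intro i) linarith
        then have "(l2n N (\<lambda>x. s i x - s (r k) x))\<^sup>2 \<le> e\<^sup>2" by (intro power_mono) auto
        then have "(LINT x|N. (cmod (s i x - s (r k) x))\<^sup>2) \<le> e\<^sup>2" by (simp add: l2n_sq)
        then show "(\<integral>\<^sup>+x. ennreal ((cmod (s i x - s (r k) x))\<^sup>2) \<partial>N) \<le> ennreal (e\<^sup>2)"
          using sqd[of i "r k", THEN sq_integrable_integrable]
          by (subst nn_integral_eq_integral) (auto simp: ennreal_leI)
      qed
    qed simp
    finally have le: "(\<integral>\<^sup>+x. ennreal ((cmod (s i x - g x))\<^sup>2) \<partial>N) \<le> ennreal (e\<^sup>2)" .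
    have int: "integrable N (\<lambda>x. (cmod (s i x - g x))\<^sup>2)"
      using le by (intro integrableI_bounded) (auto intro: le_less_trans)
    have "ennreal (LINT x|N. (cmod (s i x - g x))\<^sup>2) \<le> ennreal (e\<^sup>2)"
      using le nn_integral_eq_integral[OF int] by simp
    then have "(l2n N (\<lambda>x. s i x - g x))\<^sup>2 \<le> e\<^sup>2" by (simp add: l2n_sq)
    then have "l2n N (\<lambda>x. s i x - g x) \<le> e" using e by (auto dest: power2_le_imp_le)
    moreover have "sq_integrable N (\<lambda>x. s i x - g x)" using int by (simp add: sq_integrable_def)
    ultimately show ?thesis by simp
  qed
  obtain K1 where K1: "\<And>i j. i \<ge> K1 \<Longrightarrow> j \<ge> K1 \<Longrightarrow> l2n N (\<lambda>x. s i x - s j x) < 1"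
    using cauchy[of 1] by auto
  have "sq_integrable N (\<lambda>x. s K1 x - g x)" using close[of K1 K1 1] K1[of K1] by (auto intro: less_imp_le)
  from sq_integrable_diff[OF sq[of K1] this] have sqg: "sq_integrable N g" by simp
  have "(\<lambda>k. l2n N (\<lambda>x. s k x - g x)) \<longlonglongrightarrow> 0"
  proof (rule LIMSEQ_I)
    fix e :: real assume e: "e > 0"
    obtain K2 where K2: "\<And>i j. i \<ge> K2 \<Longrightarrow> j \<ge> K2 \<Longrightarrow> l2n N (\<lambda>x. s i x - s j x) < e / 2"
      using cauchy[of "e / 2"] e by auto
    have "norm (l2n N (\<lambda>x. s i x - g x) - 0) < e" if "i \<ge> K2" for i
    proof -
      have "l2n N (\<lambda>x. s i x - g x) \<le> e / 2"
        using close[of K2 i "e/2"] K2[OF that] e by (auto intro: less_imp_le)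
      then show ?thesis using e by simp
    qed
    then show "\<exists>no. \<forall>n\<ge>no. norm (l2n N (\<lambda>x. s n x - g x) - 0) < e" by blast
  qed
  then show ?thesis using sq sqg by (auto simp: L2_tendsto_iff_l2n)
qed

lemma L2_tendsto_uniform:
  assumes fin: "finite_measure N" and s: "\<And>k. sq_integrable N (s k)" and g: "sq_integrable N g"
    and bound: "\<And>k x. cmod (s k x - g x) \<le> e k" and e: "e \<longlonglongrightarrow> 0"
  shows "L2_tendsto N s g"
proof (rule L2_tendsto_l2n_le[OF s g])
  have one: "sq_integrable N (\<lambda>x. 1)" by (rule sq_integrable_bounded[OF fin, where C = 1]) auto
  have e0: "0 \<le> e k" for k using order_trans[OF norm_ge_zero bound[of k]] by blast
  show "l2n N (\<lambda>x. s k x - g x) \<le> e k * l2n N (\<lambda>x. 1)" for k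
  proof -
    have "l2n N (\<lambda>x. s k x - g x) \<le> l2n N (\<lambda>x. of_real (e k) * 1)"
      by (rule l2n_mono_AE[OF sq_integrable_cmult[OF one]])
        (use bound e0 in \<open>auto intro: sq_integrable_measurable[OF sq_integrable_diff[OF s g]]\<close>)
    also have "\<dots> = e k * l2n N (\<lambda>x. 1)"
      using e0 by (simp add: l2n_def real_sqrt_mult)
    finally show ?thesis .
  qed
  show "(\<lambda>k. e k * l2n N (\<lambda>x. 1)) \<longlonglongrightarrow> 0" using tendsto_mult_right[OF e, of "l2n N (\<lambda>x. 1)"] by simp
qed

text \<open>
  Coefficients of coinciding members of the family are added up, so that the family may be indexed with repetitions.
\<close>
lemma lin_combs_sum:
  assumes "finite I" "\<And>i. i \<in> I \<Longrightarrow> G i \<in> S"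
  shows "(\<lambda>x. \<Sum>i\<in>I. c i * G i x) \<in> lin_combs S"
proof -
  have "(\<lambda>x. \<Sum>i\<in>I. c i * G i x) = (\<lambda>x. \<Sum>g\<in>G ` I. (\<Sum>i\<in>{i \<in> I. G i = g}. c i) * g x)"
  proof
    fix x
    have "(\<Sum>i\<in>I. c i * G i x) = (\<Sum>g\<in>G ` I. \<Sum>i\<in>{i \<in> I. G i = g}. c i * G i x)"
      by (rule sum.image_gen[OF assms(1)])
    also have "\<dots> = (\<Sum>g\<in>G ` I. (\<Sum>i\<in>{i \<in> I. G i = g}. c i) * g x)"
      by (intro sum.cong refl) (simp add: sum_distrib_right)
    finally show "(\<Sum>i\<in>I. c i * G i x) = (\<Sum>g\<in>G ` I. (\<Sum>i\<in>{i \<in> I. G i = g}. c i) * g x)" .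
  qed
  then show ?thesis
    unfolding lin_combs_def using assms
    by (intro CollectI exI[of _ "G ` I"] exI[of _ "\<lambda>g. \<Sum>i\<in>{i \<in> I. G i = g}. c i"]) auto
qed

section \<open>The stochastic integral as an isometry\<close>

text \<open>
  Finiteness and concentration on \<open>[-pi, pi)\<close> of the spectral measure enter as assumptions here;
  they are established below when \<open>F\<close> has a density.
\<close>
locale orthogonal_measure = prob_space M for M :: "'w measure" +
  fixes F :: "real \<Rightarrow> real" and Z :: "real set \<Rightarrow> 'w \<Rightarrow> complex"
  assumes orthogonal: "orthogonal_stochastic_measure M F Z"
    and finite_spectral: "finite_measure (spectral_measure F)"
    and spectral_concentrated: "AE x in spectral_measure F. x \<in> {-pi..<pi}"
begin

abbreviation "N \<equiv> spectral_measure F"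

lemma sets_N [simp, measurable_cong]: "sets N = sets borel"
  by (simp add: spectral_measure_def)

lemma space_N [simp]: "space N = UNIV"
  by (simp add: spectral_measure_def)

sublocale N: finite_measure N by (rule finite_spectral)

lemma Z_sq: "A \<in> sets borel \<Longrightarrow> A \<subseteq> {-pi..<pi} \<Longrightarrow> sq_integrable M (Z A)"
  using orthogonal by (simp add: orthogonal_stochastic_measure_def)

lemma Z_Un: "A \<in> sets borel \<Longrightarrow> A \<subseteq> {-pi..<pi} \<Longrightarrow> B \<in> sets borel \<Longrightarrow> B \<subseteq> {-pi..<pi} \<Longrightarrow> A \<inter> B = {} \<Longrightarrow>
   AE \<omega> in M. Z (A \<union> B) \<omega> = Z A \<omega> + Z B \<omega>"
  using orthogonal by (simp add: orthogonal_stochastic_measure_def)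

lemma Z_inner: "A \<in> sets borel \<Longrightarrow> A \<subseteq> {-pi..<pi} \<Longrightarrow> B \<in> sets borel \<Longrightarrow> B \<subseteq> {-pi..<pi} \<Longrightarrow>
   (LINT \<omega>|M. Z A \<omega> * cnj (Z B \<omega>)) = of_real (measure N (A \<inter> B))"
  using orthogonal by (simp add: orthogonal_stochastic_measure_def)

lemma Z_empty: "AE \<omega> in M. Z {} \<omega> = 0"
  using Z_Un[of "{}" "{}"] by (auto elim: eventually_mono)

lemma Z_finite_Union:
  assumes "finite I" "disjoint_family_on E I" "\<And>i. i \<in> I \<Longrightarrow> E i \<in> sets borel \<and> E i \<subseteq> {-pi..<pi}"
  shows "AE \<omega> in M. Z (\<Union>i\<in>I. E i) \<omega> = (\<Sum>i\<in>I. Z (E i) \<omega>)"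
  using assms
proof (induction I rule: finite_induct)
  case empty
  then show ?case using Z_empty by simp
next
  case (insert i I)
  have "AE \<omega> in M. Z (E i \<union> (\<Union>i\<in>I. E i)) \<omega> = Z (E i) \<omega> + Z (\<Union>i\<in>I. E i) \<omega>"
  proof (rule Z_Un)
    show "E i \<inter> \<Union> (E ` I) = {}"
      using insert.prems(1) insert.hyps by (auto simp: disjoint_family_on_def)
  qed (use insert in auto)
  moreover have "AE \<omega> in M. Z (\<Union>i\<in>I. E i) \<omega> = (\<Sum>i\<in>I. Z (E i) \<omega>)"
    by (rule insert.IH) (use insert.prems in \<open>auto simp: disjoint_family_on_def\<close>)
  ultimately show ?case by eventually_elim (use insert.hyps in simp)
qed

lemma level_set:
  assumes "simple_function borel v"
  shows "v -` {p} \<inter> {-pi..<pi} \<in> sets borel" "v -` {p} \<in> sets borel"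
proof -
  show *: "v -` {p} \<in> sets borel"
    using simple_functionD(2)[OF assms, of "{p}"] by simp
  then show "v -` {p} \<inter> {-pi..<pi} \<in> sets borel" by simp
qed

text \<open>
  The integral of a simple function may be computed on any finite measurable partition on whose cells the
  function is constant: each level set is a union of cells, and \<open>Z\<close> is finitely additive almost surely.
  Applied to \<open>v = (s, t)\<close> this gives linearity, since \<open>s\<close>, \<open>t\<close> and \<open>s + c t\<close> are constant on common cells.
\<close>
lemma simple_stoch_integral_refine:
  fixes v :: "real \<Rightarrow> 'c"
  assumes v: "simple_function borel v"
  shows "AE \<omega> in M. simple_stoch_integral Z (\<lambda>x. \<phi> (v x)) \<omega>
     = (\<Sum>p\<in>range v. \<phi> p * Z (v -` {p} \<inter> {-pi..<pi}) \<omega>)"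
proof -
  have fin: "finite (range v)" using simple_functionD(1)[OF v] by simp
  define E where "E p = v -` {p} \<inter> {-pi..<pi}" for p
  have rng: "range (\<lambda>x. \<phi> (v x)) = \<phi> ` range v" by auto
  have "AE \<omega> in M. \<forall>y\<in>\<phi> ` range v.
      Z ((\<lambda>x. \<phi> (v x)) -` {y} \<inter> {-pi..<pi}) \<omega> = (\<Sum>p\<in>{p \<in> range v. \<phi> p = y}. Z (E p) \<omega>)"
  proof (subst AE_ball_countable; (intro ballI)?)
    show "countable (\<phi> ` range v)" using fin by (simp add: countable_finite)
    fix y
    have eq: "(\<lambda>x. \<phi> (v x)) -` {y} \<inter> {-pi..<pi} = (\<Union>p\<in>{p \<in> range v. \<phi> p = y}. E p)"
      by (auto simp: E_def)
    show "AE \<omega> in M. Z ((\<lambda>x. \<phi> (v x)) -` {y} \<inter> {-pi..<pi}) \<omega> = (\<Sum>p\<in>{p \<in> range v. \<phi> p = y}. Z (E p) \<omega>)"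
      unfolding eq
      by (rule Z_finite_Union)
        (use fin level_set[OF v] in \<open>auto simp: E_def disjoint_family_on_def\<close>)
  qed
  then show ?thesis
  proof eventually_elim
    fix \<omega> assume *: "\<forall>y\<in>\<phi> ` range v.
      Z ((\<lambda>x. \<phi> (v x)) -` {y} \<inter> {-pi..<pi}) \<omega> = (\<Sum>p\<in>{p \<in> range v. \<phi> p = y}. Z (E p) \<omega>)"
    have "simple_stoch_integral Z (\<lambda>x. \<phi> (v x)) \<omega>
        = (\<Sum>y\<in>\<phi> ` range v. \<Sum>p\<in>{p \<in> range v. \<phi> p = y}. \<phi> p * Z (E p) \<omega>)"
      unfolding simple_stoch_integral_def rng
    proof (rule sum.cong[OF refl])
      fix y assume "y \<in> \<phi> ` range v"
      then have "y * Z ((\<lambda>x. \<phi> (v x)) -` {y} \<inter> {-pi..<pi}) \<omega> = (\<Sum>p\<in>{p \<in> range v. \<phi> p = y}. y * Z (E p) \<omega>)"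
        using * by (simp only: sum_distrib_left[symmetric])
      also have "\<dots> = (\<Sum>p\<in>{p \<in> range v. \<phi> p = y}. \<phi> p * Z (E p) \<omega>)"
        by (rule sum.cong) auto
      finally show "y * Z ((\<lambda>x. \<phi> (v x)) -` {y} \<inter> {-pi..<pi}) \<omega> = (\<Sum>p\<in>{p \<in> range v. \<phi> p = y}. \<phi> p * Z (E p) \<omega>)" .
    qed
    also have "\<dots> = (\<Sum>p\<in>range v. \<phi> p * Z (E p) \<omega>)"
      by (rule sum.image_gen[OF fin, symmetric])
    finally show "simple_stoch_integral Z (\<lambda>x. \<phi> (v x)) \<omega>
      = (\<Sum>p\<in>range v. \<phi> p * Z (v -` {p} \<inter> {-pi..<pi}) \<omega>)" by (simp add: E_def)
  qed
qed

lemma simple_stoch_integral_sq: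
  assumes "simple_function borel s"
  shows "sq_integrable M (simple_stoch_integral Z s)"
  unfolding simple_stoch_integral_def[abs_def]
  by (intro sq_integrable_sum sq_integrable_cmult Z_sq level_set assms) auto

lemma simple_stoch_integral_linear:
  assumes "simple_function borel s" "simple_function borel t"
  shows "AE \<omega> in M. simple_stoch_integral Z (\<lambda>x. s x + c * t x) \<omega>
     = simple_stoch_integral Z s \<omega> + c * simple_stoch_integral Z t \<omega>"
proof -
  let ?v = "\<lambda>x. (s x, t x)"
  have v: "simple_function borel ?v" using assms by (rule simple_function_Pair)
  note R = simple_stoch_integral_refine[OF v]
  show ?thesis
    using R[of "\<lambda>p. fst p + c * snd p"] R[of fst] R[of snd]
    by eventually_elim (simp add: sum.distrib sum_distrib_left algebra_simps)
qed

lemma simple_function_sq_integrable: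
  assumes "simple_function borel s"
  shows "sq_integrable N (s :: real \<Rightarrow> complex)"
proof -
  have fin: "finite (range s)" using simple_functionD(1)[OF assms] by simp
  define C where "C = Max (cmod ` range s)"
  have "cmod (s x) \<le> C" for x unfolding C_def by (rule Max_ge) (use fin in auto)
  moreover have "s \<in> borel_measurable N"
    using borel_measurable_simple_function[OF assms] by simp
  ultimately show ?thesis by (intro sq_integrable_bounded finite_spectral)
qed

text \<open>
  Orthogonality of \<open>Z\<close> on disjoint sets leaves the diagonal terms \<open>|y|\<^sup>2 F(s = y)\<close> only.
\<close>
lemma simple_stoch_integral_isometry:
  assumes s: "simple_function borel s"
  shows "l2n M (simple_stoch_integral Z s) = l2n N s"
proof -
  have fin: "finite (range s)" using simple_functionD(1)[OF s] by simp
  define E where "E y = s -` {y} \<inter> {-pi..<pi}" for y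
  have E: "E y \<in> sets borel" "E y \<subseteq> {-pi..<pi}" for y using level_set[OF s] by (auto simp: E_def)
  have int: "integrable M (\<lambda>\<omega>. Z (E y) \<omega> * cnj (Z (E y') \<omega>))" for y y'
    by (intro sq_integrable_prod Z_sq E)
  have inner: "(LINT \<omega>|M. Z (E y) \<omega> * cnj (Z (E y') \<omega>)) = (if y = y' then of_real (measure N (E y)) else 0)" for y y'
  proof -
    have "y \<noteq> y' \<Longrightarrow> E y \<inter> E y' = {}" by (auto simp: E_def)
    then show ?thesis using Z_inner[OF E E, of y y'] by auto
  qed
  have meas: "measure N (E y) = measure N (s -` {y})" for y
    using spectral_concentrated level_set[OF s]
    by (intro N.finite_measure_eq_AE) (auto simp: E_def elim: eventually_mono)
  have "complex_of_real (LINT \<omega>|M. (cmod (simple_stoch_integral Z s \<omega>))\<^sup>2)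
     = (LINT \<omega>|M. simple_stoch_integral Z s \<omega> * cnj (simple_stoch_integral Z s \<omega>))"
    by (simp only: complex_norm_square[symmetric] integral_complex_of_real)
  also have "\<dots> = (LINT \<omega>|M. (\<Sum>y\<in>range s. \<Sum>y'\<in>range s. (y * cnj y') * (Z (E y) \<omega> * cnj (Z (E y') \<omega>))))"
    unfolding simple_stoch_integral_def E_def[symmetric]
    by (simp add: sum_product algebra_simps)
  also have "\<dots> = (\<Sum>y\<in>range s. \<Sum>y'\<in>range s. (y * cnj y') * (LINT \<omega>|M. Z (E y) \<omega> * cnj (Z (E y') \<omega>)))"
    using int by simp
  also have "\<dots> = (\<Sum>y\<in>range s. (y * cnj y) * of_real (measure N (E y)))"
    unfolding inner using fin by (simp add: if_distrib[where f = "\<lambda>x. _ * x"] cong: if_cong)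
  also have "\<dots> = complex_of_real (\<Sum>y\<in>range s. (cmod y)\<^sup>2 * measure N (s -` {y}))"
    by (simp add: complex_norm_square[symmetric] meas)
  also have "(\<Sum>y\<in>range s. (cmod y)\<^sup>2 * measure N (s -` {y}))
     = (LINT x|N. (\<Sum>y\<in>range s. (cmod y)\<^sup>2 * indicator (s -` {y}) x))"
    using level_set[OF s] by (subst Bochner_Integration.integral_sum) (auto simp: N.emeasure_eq_measure)
  also have "\<dots> = (LINT x|N. (cmod (s x))\<^sup>2)"
  proof (rule Bochner_Integration.integral_cong[OF refl])
    fix x
    have "(\<Sum>y\<in>range s. (cmod y)\<^sup>2 * indicator (s -` {y}) x) = (\<Sum>y\<in>range s. if y = s x then (cmod y)\<^sup>2 else 0)"
      by (rule sum.cong) auto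
    then show "(\<Sum>y\<in>range s. (cmod y)\<^sup>2 * indicator (s -` {y}) x) = (cmod (s x))\<^sup>2"
      using fin by simp
  qed
  finally show ?thesis by (simp add: l2n_def)
qed

lemma has_stoch_integral_sq:
  assumes "has_stoch_integral M F Z g X"
  shows "sq_integrable N g" "sq_integrable M X"
  using assms by (auto simp: has_stoch_integral_def L2_tendsto_def)

lemma has_stoch_integral_linear:
  assumes "has_stoch_integral M F Z g X" "has_stoch_integral M F Z h Y"
  shows "has_stoch_integral M F Z (\<lambda>x. g x + c * h x) (\<lambda>\<omega>. X \<omega> + c * Y \<omega>)"
proof -
  from assms obtain s t where
    s: "\<And>k. simple_function borel (s k)" "L2_tendsto N s g" "L2_tendsto M (\<lambda>k. simple_stoch_integral Z (s k)) X" and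
    t: "\<And>k. simple_function borel (t k)" "L2_tendsto N t h" "L2_tendsto M (\<lambda>k. simple_stoch_integral Z (t k)) Y"
    unfolding has_stoch_integral_def by blast
  have st: "simple_function borel (\<lambda>x. s k x + c * t k x)" for k
    using simple_function_compose2[OF s(1)[of k] t(1)[of k], of "\<lambda>a b. a + c * b"] .
  have "L2_tendsto M (\<lambda>k. simple_stoch_integral Z (\<lambda>x. s k x + c * t k x)) (\<lambda>\<omega>. X \<omega> + c * Y \<omega>)"
  proof (rule L2_tendsto_cong_AE[OF L2_tendsto_add_cmult[OF s(3) t(3), of c]])
    show "AE \<omega> in M. simple_stoch_integral Z (s k) \<omega> + c * simple_stoch_integral Z (t k) \<omega>
        = simple_stoch_integral Z (\<lambda>x. s k x + c * t k x) \<omega>" for k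
      using simple_stoch_integral_linear[OF s(1)[of k] t(1)[of k], of c] by eventually_elim simp
  qed (intro sq_integrable_measurable simple_stoch_integral_sq st)
  then show ?thesis
    unfolding has_stoch_integral_def
    by (intro exI[of _ "\<lambda>k x. s k x + c * t k x"] conjI allI st L2_tendsto_add_cmult[OF s(2) t(2)])
qed

lemma has_stoch_integral_diff:
  assumes "has_stoch_integral M F Z g X" "has_stoch_integral M F Z h Y"
  shows "has_stoch_integral M F Z (\<lambda>x. g x - h x) (\<lambda>\<omega>. X \<omega> - Y \<omega>)"
  using has_stoch_integral_linear[OF assms, of "-1"] by simp

text \<open>
  With linearity this also shows that the integral is unique up to almost sure equality.
\<close>
lemma has_stoch_integral_isometry:
  assumes "has_stoch_integral M F Z g X"
  shows "l2n M X = l2n N g"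
proof -
  from assms obtain s where
    s: "\<And>k. simple_function borel (s k)" "L2_tendsto N s g" "L2_tendsto M (\<lambda>k. simple_stoch_integral Z (s k)) X"
    unfolding has_stoch_integral_def by blast
  from L2_tendsto_norm[OF s(2)] L2_tendsto_norm[OF s(3)] show ?thesis
    by (simp add: simple_stoch_integral_isometry[OF s(1)] LIMSEQ_unique)
qed

lemma has_stoch_integral_zero: "has_stoch_integral M F Z (\<lambda>x. 0) (\<lambda>\<omega>. 0)"
proof -
  have "simple_stoch_integral Z (\<lambda>x. 0) = (\<lambda>\<omega>. 0)"
    by (simp add: simple_stoch_integral_def[abs_def])
  then show ?thesis
    unfolding has_stoch_integral_def by (intro exI[of _ "\<lambda>k x. 0"]) (simp add: L2_tendsto_const)
qed

lemma has_stoch_integral_sum: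
  assumes "\<And>i. i < (m::nat) \<Longrightarrow> has_stoch_integral M F Z (g i) (X i)"
  shows "has_stoch_integral M F Z (\<lambda>x. \<Sum>i<m. c i * g i x) (\<lambda>\<omega>. \<Sum>i<m. c i * X i \<omega>)"
  using assms
proof (induction m)
  case 0
  then show ?case using has_stoch_integral_zero by simp
next
  case (Suc m)
  then show ?case using has_stoch_integral_linear[OF Suc.IH Suc.prems[of m], of "c m"] by simp
qed

lemma simple_approx_L2:
  assumes g: "sq_integrable N g"
  shows "\<exists>s. (\<forall>k. simple_function borel (s k)) \<and> L2_tendsto N s g"
proof -
  have gm: "g \<in> borel_measurable borel" using sq_integrable_measurable[OF g] by simp
  from borel_measurable_implies_sequence_metric[OF gm, of 0]
  obtain s where s: "\<And>k. simple_function borel (s k)" "\<And>x. (\<lambda>k. s k x) \<longlonglongrightarrow> g x"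
    "\<And>k x. dist (s k x) 0 \<le> 2 * dist (g x) 0" by auto
  have sm: "s k \<in> borel_measurable N" for k
    using borel_measurable_simple_function[OF s(1)] by simp
  have "(\<lambda>k. LINT x|N. (cmod (s k x - g x))\<^sup>2) \<longlonglongrightarrow> (LINT x|N. 0)"
  proof (rule integral_dominated_convergence[where w = "\<lambda>x. 9 * (cmod (g x))\<^sup>2"])
    show "(\<lambda>x. (cmod (s k x - g x))\<^sup>2) \<in> borel_measurable N" for k
      using sm gm by measurable
    show "integrable N (\<lambda>x. 9 * (cmod (g x))\<^sup>2)"
      using g by (simp add: sq_integrable_def)
    show "AE x in N. (\<lambda>k. (cmod (s k x - g x))\<^sup>2) \<longlonglongrightarrow> 0"
    proof (rule AE_I2)
      fix x
      have "(\<lambda>k. (cmod (s k x - g x))\<^sup>2) \<longlonglongrightarrow> (cmod (g x - g x))\<^sup>2" by (intro tendsto_intros s)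
      then show "(\<lambda>k. (cmod (s k x - g x))\<^sup>2) \<longlonglongrightarrow> 0" by simp
    qed
    show "AE x in N. norm ((cmod (s k x - g x))\<^sup>2) \<le> 9 * (cmod (g x))\<^sup>2" for k
    proof (rule AE_I2)
      fix x
      have "cmod (s k x - g x) \<le> cmod (s k x) + cmod (g x)" by (rule norm_triangle_ineq4)
      also have "\<dots> \<le> 3 * cmod (g x)" using s(3)[of k x] by simp
      finally have "(cmod (s k x - g x))\<^sup>2 \<le> (3 * cmod (g x))\<^sup>2" by (intro power_mono) auto
      then show "norm ((cmod (s k x - g x))\<^sup>2) \<le> 9 * (cmod (g x))\<^sup>2" by (simp add: power_mult_distrib)
    qed
  qed simp
  then show ?thesis
    using s(1) g simple_function_sq_integrable[OF s(1)] by (auto simp: L2_tendsto_def)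
qed

lemma L2_tendsto_Cauchy:
  assumes "L2_tendsto K s g" "e > 0"
  shows "\<exists>k0. \<forall>i\<ge>k0. \<forall>j\<ge>k0. l2n K (\<lambda>x. s i x - s j x) < e"
proof -
  note t = assms(1)[unfolded L2_tendsto_iff_l2n]
  then have "(\<lambda>k. l2n K (\<lambda>x. s k x - g x)) \<longlonglongrightarrow> 0" by blast
  from LIMSEQ_D[OF this, of "e/2"] assms(2) obtain k0 where k0: "\<And>k. k \<ge> k0 \<Longrightarrow> l2n K (\<lambda>x. s k x - g x) < e / 2"
    by auto
  have "l2n K (\<lambda>x. s i x - s j x) < e" if "i \<ge> k0" "j \<ge> k0" for i j
    using l2n_triangle_diff[of K "s i" g "s j"] t k0[OF that(1)] k0[OF that(2)]
    by (simp add: l2n_minus_commute[of K g])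
  then show ?thesis by blast
qed

lemma has_stoch_integral_exists:
  assumes "sq_integrable N g"
  shows "\<exists>X. has_stoch_integral M F Z g X"
proof -
  obtain s where s: "\<And>k. simple_function borel (s k)" "L2_tendsto N s g"
    using simple_approx_L2[OF assms] by blast
  have diff: "simple_function borel (\<lambda>x. s i x + (-1) * s j x)" for i j
    using simple_function_compose2[OF s(1)[of i] s(1)[of j], of "\<lambda>a b. a + (-1) * b"] .
  have "\<exists>X. L2_tendsto M (\<lambda>k. simple_stoch_integral Z (s k)) X"
  proof (rule L2_complete)
    show "finite_measure M" by (rule finite_measure_axioms)
    show "sq_integrable M (simple_stoch_integral Z (s k))" for k
      by (rule simple_stoch_integral_sq[OF s(1)])
    fix e :: real assume "e > 0"
    have "l2n M (\<lambda>\<omega>. simple_stoch_integral Z (s i) \<omega> - simple_stoch_integral Z (s j) \<omega>) = l2n N (\<lambda>x. s i x - s j x)" for i j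
    proof -
      have "l2n M (\<lambda>\<omega>. simple_stoch_integral Z (s i) \<omega> - simple_stoch_integral Z (s j) \<omega>)
          = l2n M (simple_stoch_integral Z (\<lambda>x. s i x + (-1) * s j x))"
      proof (rule l2n_cong_AE)
        show "AE \<omega> in M. simple_stoch_integral Z (s i) \<omega> - simple_stoch_integral Z (s j) \<omega>
            = simple_stoch_integral Z (\<lambda>x. s i x + (-1) * s j x) \<omega>"
          using simple_stoch_integral_linear[OF s(1)[of i] s(1)[of j], of "-1"] by eventually_elim simp
      qed (intro sq_integrable_measurable sq_integrable_diff simple_stoch_integral_sq s diff)+
      also have "\<dots> = l2n N (\<lambda>x. s i x - s j x)"
        using simple_stoch_integral_isometry[OF diff] by simp
      finally show ?thesis .
    qed
    then show "\<exists>K. \<forall>i\<ge>K. \<forall>j\<ge>K. l2n M (\<lambda>\<omega>. simple_stoch_integral Z (s i) \<omega> - simple_stoch_integral Z (s j) \<omega>) < e"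
      using L2_tendsto_Cauchy[OF s(2) \<open>e > 0\<close>] by simp
  qed
  then show ?thesis using s unfolding has_stoch_integral_def by blast
qed

lemma has_stoch_integral_stoch_integral:
  "sq_integrable N g \<Longrightarrow> has_stoch_integral M F Z g (stoch_integral M F Z g)"
  unfolding stoch_integral_def using someI_ex[OF has_stoch_integral_exists] .

text \<open>
  For a sum defined as a mean-square limit: the limit exists by completeness, and its distance from any stochastic
  integral is computed in \<open>L\<^sub>2(F)\<close>, because norms are continuous on both sides of the isometry.
\<close>
lemma L2_limit_stoch_integrals:
  assumes X: "\<And>k. has_stoch_integral M F Z (g k) (X k)" and g: "L2_tendsto N g G"
  shows "\<exists>B. L2_tendsto M X B"
    and "L2_tendsto M X B \<Longrightarrow> has_stoch_integral M F Z h Y \<Longrightarrow> l2n M (\<lambda>\<omega>. B \<omega> - Y \<omega>) = l2n N (\<lambda>x. G x - h x)"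
proof -
  show "\<exists>B. L2_tendsto M X B"
  proof (rule L2_complete)
    show "finite_measure M" by (rule finite_measure_axioms)
    show "sq_integrable M (X k)" for k using has_stoch_integral_sq[OF X] by simp
    fix e :: real assume "e > 0"
    from L2_tendsto_Cauchy[OF g this]
    show "\<exists>K. \<forall>i\<ge>K. \<forall>j\<ge>K. l2n M (\<lambda>\<omega>. X i \<omega> - X j \<omega>) < e"
      using has_stoch_integral_isometry[OF has_stoch_integral_diff[OF X X]] by simp
  qed
  assume B: "L2_tendsto M X B" and Y: "has_stoch_integral M F Z h Y"
  have "(\<lambda>k. l2n M (\<lambda>\<omega>. X k \<omega> - Y \<omega>)) \<longlonglongrightarrow> l2n M (\<lambda>\<omega>. B \<omega> - Y \<omega>)"
    by (intro L2_tendsto_norm L2_tendsto_diff B L2_tendsto_const has_stoch_integral_sq[OF Y])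
  moreover have "(\<lambda>k. l2n N (\<lambda>x. g k x - h x)) \<longlonglongrightarrow> l2n N (\<lambda>x. G x - h x)"
    by (intro L2_tendsto_norm L2_tendsto_diff g L2_tendsto_const has_stoch_integral_sq[OF Y])
  ultimately show "l2n M (\<lambda>\<omega>. B \<omega> - Y \<omega>) = l2n N (\<lambda>x. G x - h x)"
    by (simp add: has_stoch_integral_isometry[OF has_stoch_integral_diff[OF X Y]] LIMSEQ_unique)
qed

end

section \<open>The spectral measure of an absolutely continuous spectral function\<close>

lemma truncated_density:
  fixes f :: "real \<Rightarrow> real"
  assumes "set_integrable lborel {-pi..pi} f" "AE x in lborel. x \<in> {-pi..pi} \<longrightarrow> 0 \<le> f x"
  shows "(\<lambda>x. indicator {-pi..pi} x * f x) \<in> borel_measurable borel"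
    "integrable lborel (\<lambda>x. indicator {-pi..pi} x * f x)"
    "AE x in lborel. 0 \<le> indicator {-pi..pi} x * f x"
proof -
  show "integrable lborel (\<lambda>x. indicator {-pi..pi} x * f x)"
    using assms(1) by (simp add: set_integrable_def)
  from borel_measurable_integrable[OF this]
  show "(\<lambda>x. indicator {-pi..pi} x * f x) \<in> borel_measurable borel" by simp
  show "AE x in lborel. 0 \<le> indicator {-pi..pi} x * f x"
    using assms(2) by eventually_elim (auto simp: indicator_def)
qed

text \<open>
  Both sides are the integral of \<open>f / (2 pi)\<close> over the part of \<open>[u, v)\<close> inside \<open>[-pi, pi]\<close>; the indicators
  agree outside four points.
\<close>
lemma spectral_increment:
  assumes F: "spectral_density F f" and nonneg: "AE x in lborel. x \<in> {-pi..pi} \<longrightarrow> 0 \<le> f x" and uv: "u \<le> v"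
  defines "trunc \<equiv> \<lambda>x. max (-pi) (min pi (x::real))"
  shows "emeasure (density lborel (\<lambda>x. ennreal (indicator {-pi..pi} x * f x / (2 * pi)))) {u..<v}
    = ennreal (F (trunc v) - F (trunc u))"
proof -
  have si: "set_integrable lborel {-pi..pi} f" using F by (simp add: spectral_density_def)
  note d = truncated_density[OF si nonneg]
  have [measurable]: "(\<lambda>x. indicator {-pi..pi} x * f x) \<in> borel_measurable borel" by (rule d)
  have cl: "trunc x \<in> {-pi..pi}" for x by (auto simp: trunc_def)
  have int: "integrable lborel (\<lambda>x. indicator {-pi..trunc t} x * f x)" for t
    using set_integrable_subset[OF si, of "{-pi..trunc t}"] cl[of t] by (simp add: set_integrable_def)
  have Feq: "F (trunc t) = 1 / (2 * pi) * (LINT x|lborel. indicator {-pi..trunc t} x * f x)" for t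
    using F cl[of t] by (simp add: spectral_density_def set_lebesgue_integral_def)
  have "F (trunc v) - F (trunc u)
      = 1 / (2 * pi) * (LINT x|lborel. indicator {-pi..trunc v} x * f x - indicator {-pi..trunc u} x * f x)"
    unfolding Feq using int by (simp add: diff_divide_distrib)
  also have "(LINT x|lborel. indicator {-pi..trunc v} x * f x - indicator {-pi..trunc u} x * f x)
      = (LINT x|lborel. indicator {-pi..pi} x * f x * indicator {u..<v} x)"
  proof (rule integral_cong_AE)
    have "AE x in lborel. x \<noteq> u \<and> x \<noteq> v \<and> x \<noteq> pi \<and> x \<noteq> -pi"
      by (intro AE_conjI AE_lborel_singleton)
    then show "AE x in lborel. indicator {-pi..trunc v} x * f x - indicator {-pi..trunc u} x * f x
        = indicator {-pi..pi} x * f x * indicator {u..<v} x"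
      by eventually_elim (use uv in \<open>auto simp: indicator_def trunc_def max_def min_def\<close>)
    show "(\<lambda>x. indicator {-pi..trunc v} x * f x - indicator {-pi..trunc u} x * f x) \<in> borel_measurable lborel"
      using borel_measurable_diff[OF borel_measurable_integrable[OF int] borel_measurable_integrable[OF int]] by simp
  qed measurable
  finally have eq: "F (trunc v) - F (trunc u)
      = (LINT x|lborel. (indicator {-pi..pi} x * f x / (2 * pi)) * indicator {u..<v} x)" by simp
  have "emeasure (density lborel (\<lambda>x. ennreal (indicator {-pi..pi} x * f x / (2 * pi)))) {u..<v}
     = (\<integral>\<^sup>+x. ennreal (indicator {-pi..pi} x * f x / (2 * pi)) * indicator {u..<v} x \<partial>lborel)"
    by (rule emeasure_density) measurable
  also have "\<dots> = (\<integral>\<^sup>+x. ennreal (indicator {-pi..pi} x * f x / (2 * pi) * indicator {u..<v} x) \<partial>lborel)"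
    by (intro nn_integral_cong) (simp split: split_indicator)
  also have "\<dots> = ennreal (LINT x|lborel. indicator {-pi..pi} x * f x / (2 * pi) * indicator {u..<v} x)"
  proof (rule nn_integral_eq_integral)
    show "integrable lborel (\<lambda>x. indicator {-pi..pi} x * f x / (2 * pi) * indicator {u..<v} x)"
      using d(2) by (intro integrable_real_mult_indicator) auto
    show "AE x in lborel. 0 \<le> indicator {-pi..pi} x * f x / (2 * pi) * indicator {u..<v} x"
      using d(3) by eventually_elim simp
  qed
  finally show ?thesis using eq by simp
qed

lemma truncated_right_continuous:
  fixes F :: "real \<Rightarrow> real"
  assumes F: "spectral_function F"
  shows "continuous (at_right a) (\<lambda>x. - F (max (-pi) (min pi (-x))))"
proof -
  let ?G = "\<lambda>x. - F (max (-pi) (min pi (-x)))"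
  consider "-a \<le> -pi" | "-a > pi" | "-pi < -a" "-a \<le> pi" by linarith
  then show ?thesis
  proof cases
    case 1
    have "\<forall>\<^sub>F x in at_right a. ?G x = ?G a"
      using eventually_at_right_less[of a]
    proof eventually_elim
      case (elim x)
      then have "min pi (-x) \<le> -pi" "min pi (-a) \<le> -pi" using 1 by auto
      then show ?case by (simp add: max_absorb1)
    qed
    then show ?thesis by (simp add: continuous_within tendsto_eventually)
  next
    case 2
    then have "\<forall>\<^sub>F x in at_right a. x < -pi"
      by (intro eventually_at_right_less[THEN eventually_mono] order_tendstoD(2)[OF tendsto_ident_at]) auto
    then have "\<forall>\<^sub>F x in at_right a. ?G x = ?G a"
      by eventually_elim (use 2 in \<open>auto simp: max_def min_def\<close>)
    then show ?thesis by (simp add: continuous_within tendsto_eventually)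
  next
    case 3
    have "continuous (at_left (-a)) F" using F 3 by (auto simp: spectral_function_def)
    then have "(F \<longlongrightarrow> F (-a)) (at_left (-a))" by (simp add: continuous_within)
    moreover have "filterlim (\<lambda>x. -x) (at_left (-a)) (at_right a)"
      by (simp add: filterlim_def at_right_minus filtermap_filtermap)
    ultimately have "((\<lambda>x. F (-x)) \<longlongrightarrow> F (-a)) (at_right a)" by (rule filterlim_compose)
    moreover have "\<forall>\<^sub>F x in at_right a. F (-x) = F (max (-pi) (min pi (-x)))"
    proof -
      have "\<forall>\<^sub>F x in at_right a. x < pi" using 3 by (intro order_tendstoD(2)[OF tendsto_ident_at]) auto
      moreover have "\<forall>\<^sub>F x in at_right a. a < x" by (rule eventually_at_right_less)
      ultimately show ?thesis by eventually_elim (use 3 in \<open>auto simp: max_def min_def\<close>)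
    qed
    ultimately have "((\<lambda>x. F (max (-pi) (min pi (-x)))) \<longlongrightarrow> F (-a)) (at_right a)"
      by (rule Lim_transform_eventually)
    then show ?thesis
      using 3 by (auto simp: continuous_within max_def min_def intro!: tendsto_minus)
  qed
qed

text \<open>
  The two measures agree on half-open intervals, after the reflection that is built into the definition of the
  spectral measure.
\<close>
lemma spectral_measure_density:
  assumes F: "spectral_function F" and d: "spectral_density F f"
    and nonneg: "AE x in lborel. x \<in> {-pi..pi} \<longrightarrow> 0 \<le> f x"
  shows "spectral_measure F = density lborel (\<lambda>x. ennreal (indicator {-pi..pi} x * f x / (2 * pi)))"
proof -
  define m where "m = density lborel (\<lambda>x. ennreal (indicator {-pi..pi} x * f x / (2 * pi)))"
  define G where "G x = - F (max (-pi) (min pi (-x)))" for x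
  have [measurable_cong, simp]: "sets m = sets borel" "space m = UNIV" by (simp_all add: m_def)
  have mono: "G x \<le> G y" if "x \<le> y" for x y
    using F that by (auto simp: spectral_function_def G_def intro!: mono_onD[of "{-pi..pi}" F])
  have rc: "continuous (at_right a) G" for a
    unfolding G_def by (rule truncated_right_continuous[OF F])
  have "interval_measure G = distr m borel uminus"
  proof (rule measure_eqI_generator_eq)
    let ?E = "range (\<lambda>(a, b). {a<..b::real})"
    show "Int_stable ?E"
      by (auto simp: Int_stable_def image_iff)
    show "?E \<subseteq> Pow UNIV" by simp
    show "sets (interval_measure G) = sigma_sets UNIV ?E" "sets (distr m borel uminus) = sigma_sets UNIV ?E"
      by (simp_all add: borel_sigma_sets_Ioc)
    show "range (\<lambda>i. {- real i<..real i}) \<subseteq> ?E" by auto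
    show "(\<Union>i. {- real i<..real i}) = UNIV"
    proof -
      have "\<exists>i. x \<in> {- real i<..real i}" for x :: real
      proof -
        obtain i where "\<bar>x\<bar> < real i" using reals_Archimedean2 by blast
        then show ?thesis by (intro exI[of _ i]) auto
      qed
      then show ?thesis by blast
    qed
    show "emeasure (interval_measure G) {- real i<..real i} \<noteq> \<infinity>" for i
      using emeasure_interval_measure_Ioc[of "- real i" "real i" G, OF _ mono rc] by simp
    fix X assume "X \<in> ?E"
    then obtain a b where X: "X = {a<..b}" by auto
    show "emeasure (interval_measure G) X = emeasure (distr m borel uminus) X"
    proof (cases "a \<le> b")
      case True
      have "uminus -` {a<..b} = {-b..<-a}" by auto
      then have "emeasure (distr m borel uminus) X = emeasure m {-b..<-a}"
        by (simp add: X emeasure_distr)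
      also have "\<dots> = ennreal (G b - G a)"
        using spectral_increment[OF d nonneg, of "-b" "-a"] True by (simp add: m_def G_def)
      finally show ?thesis
        using emeasure_interval_measure_Ioc[of a b G, OF True mono rc] by (simp add: X)
    qed (simp add: X)
  qed
  then have "spectral_measure F = distr (distr m borel uminus) borel uminus"
    by (simp add: spectral_measure_def G_def[abs_def])
  also have "\<dots> = distr m borel (\<lambda>x. x)"
    by (subst distr_distr) (auto simp: comp_def)
  also have "\<dots> = m" by (rule distr_id2) simp
  finally show ?thesis by (simp add: m_def)
qed

lemma spectral_measure_basic:
  assumes F: "spectral_function F" and d: "spectral_density F f"
    and nonneg: "AE x in lborel. x \<in> {-pi..pi} \<longrightarrow> 0 \<le> f x"
  shows "finite_measure (spectral_measure F)" "AE x in spectral_measure F. x \<in> {-pi..<pi}"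
proof -
  have si: "set_integrable lborel {-pi..pi} f" using d by (simp add: spectral_density_def)
  note dd = truncated_density[OF si nonneg]
  have [measurable]: "(\<lambda>x. indicator {-pi..pi} x * f x) \<in> borel_measurable borel" by (rule dd)
  note eq = spectral_measure_density[OF assms]
  have "emeasure (spectral_measure F) UNIV = (\<integral>\<^sup>+x. ennreal (indicator {-pi..pi} x * f x / (2 * pi)) \<partial>lborel)"
    unfolding eq by (subst emeasure_density) auto
  also have "\<dots> = ennreal (LINT x|lborel. indicator {-pi..pi} x * f x / (2 * pi))"
    by (rule nn_integral_eq_integral) (use dd in auto)
  finally show "finite_measure (spectral_measure F)"
    by (intro finite_measureI) (simp add: eq)
  show "AE x in spectral_measure F. x \<in> {-pi..<pi}"
    unfolding eq
  proof (subst AE_density)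
    show "AE x in lborel. 0 < ennreal (indicator {-pi..pi} x * f x / (2 * pi)) \<longrightarrow> x \<in> {-pi..<pi}"
      using AE_lborel_singleton[of pi] by eventually_elim (auto simp: indicator_def split: if_splits)
  qed measurable
qed

lemma L2_density_space_integral:
  fixes g :: "real \<Rightarrow> 'b::{banach, second_countable_topology}"
  assumes si: "set_integrable lborel {-pi..pi} f" and nonneg: "AE x in lborel. x \<in> {-pi..pi} \<longrightarrow> 0 \<le> f x"
    and g: "g \<in> borel_measurable borel"
  shows "(LINT x|L2_density_space f. g x) = (LINT x|lborel. (indicator {-pi..pi} x * f x) *\<^sub>R g x)"
    and "integrable (L2_density_space f) g \<longleftrightarrow> integrable lborel (\<lambda>x. (indicator {-pi..pi} x * f x) *\<^sub>R g x)"
proof -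
  note dd = truncated_density[OF si nonneg]
  show "(LINT x|L2_density_space f. g x) = (LINT x|lborel. (indicator {-pi..pi} x * f x) *\<^sub>R g x)"
    unfolding L2_density_space_def by (rule integral_density) (use dd g in auto)
  show "integrable (L2_density_space f) g \<longleftrightarrow> integrable lborel (\<lambda>x. (indicator {-pi..pi} x * f x) *\<^sub>R g x)"
    unfolding L2_density_space_def by (rule integrable_density) (use dd g in auto)
qed

lemma sets_L2_density_space [simp, measurable_cong]: "sets (L2_density_space f) = sets borel"
  by (simp add: L2_density_space_def)

text \<open>
  The space \<open>L\<^sub>2(f)\<close> carries the weight \<open>f\<close> and the spectral measure the weight \<open>f / (2 pi)\<close>, hence the
  factor.
\<close>
lemma L2_density_space_spectral:
  assumes F: "spectral_function F" and d: "spectral_density F f"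
    and nonneg: "AE x in lborel. x \<in> {-pi..pi} \<longrightarrow> 0 \<le> f x" and g: "sq_integrable (L2_density_space f) g"
  shows "sq_integrable (spectral_measure F) g"
    and "(l2n (spectral_measure F) g)\<^sup>2 = (l2n (L2_density_space f) g)\<^sup>2 / (2 * pi)"
proof -
  have si: "set_integrable lborel {-pi..pi} f" using d by (simp add: spectral_density_def)
  note dd = truncated_density[OF si nonneg]
  have gm [measurable]: "g \<in> borel_measurable borel" using sq_integrable_measurable[OF g] by simp
  have g2: "(\<lambda>x. (cmod (g x))\<^sup>2) \<in> borel_measurable borel" by measurable
  note K = L2_density_space_integral[OF si nonneg g2]
  have dm: "(\<lambda>x. indicator {-pi..pi} x * f x / (2 * pi)) \<in> borel_measurable lborel"
    using dd(1) by simp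
  have dp: "AE x in lborel. 0 \<le> indicator {-pi..pi} x * f x / (2 * pi)"
    using dd(3) by eventually_elim simp
  have N: "(LINT x|spectral_measure F. (cmod (g x))\<^sup>2) = (LINT x|lborel. (indicator {-pi..pi} x * f x / (2 * pi)) *\<^sub>R (cmod (g x))\<^sup>2)"
    "integrable (spectral_measure F) (\<lambda>x. (cmod (g x))\<^sup>2) = integrable lborel (\<lambda>x. (indicator {-pi..pi} x * f x / (2 * pi)) *\<^sub>R (cmod (g x))\<^sup>2)"
    unfolding spectral_measure_density[OF F d nonneg]
    by (rule integral_density[OF _ dm dp], simp, rule integrable_density[OF _ dm dp], simp)
  have ig: "integrable lborel (\<lambda>x. (indicator {-pi..pi} x * f x) *\<^sub>R (cmod (g x))\<^sup>2)"
    using g K(2) by (simp add: sq_integrable_def)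
  have "integrable lborel (\<lambda>x. (1 / (2 * pi)) * ((indicator {-pi..pi} x * f x) *\<^sub>R (cmod (g x))\<^sup>2))"
    using ig by simp
  then show "sq_integrable (spectral_measure F) g"
    unfolding sq_integrable_def N(2) by (simp add: spectral_measure_def)
  show "(l2n (spectral_measure F) g)\<^sup>2 = (l2n (L2_density_space f) g)\<^sup>2 / (2 * pi)"
    by (simp add: l2n_sq N(1) K(1))
qed

section \<open>Absolutely convergent power series on the closed disc\<close>

lemma abs_summable_nat_iff: "(\<lambda>k. norm ((f :: nat \<Rightarrow> 'a::banach) k)) summable_on UNIV \<longleftrightarrow> summable (\<lambda>k. norm (f k))"
  by (rule summable_on_UNIV_nonneg_real_iff) simp

lemma infsum_nat_eq_suminf:
  fixes f :: "nat \<Rightarrow> 'a::banach"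
  assumes "summable (\<lambda>k. norm (f k))"
  shows "infsum f UNIV = suminf f"
  using norm_summable_imp_has_sum[OF assms summable_sums[OF summable_norm_cancel[OF assms]]]
  by (rule infsumI)

text \<open>
  Fubini's theorem for double series, in the form used throughout: a summable bound \<open>S\<close> for the
  absolute row sums.
\<close>
lemma double_series_swap:
  fixes p :: "nat \<Rightarrow> nat \<Rightarrow> complex"
  assumes row: "\<And>m. summable (\<lambda>k. cmod (p m k))"
    and bound: "\<And>m. (\<Sum>k. cmod (p m k)) \<le> S m" and S: "summable S"
  shows "\<And>k. summable (\<lambda>m. cmod (p m k))"
    and "summable (\<lambda>k. \<Sum>m. cmod (p m k))"
    and "summable (\<lambda>k. cmod (\<Sum>m. p m k))"
    and "(\<Sum>k. \<Sum>m. p m k) = (\<Sum>m. \<Sum>k. p m k)"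
proof -
  have row_inf: "infsum (\<lambda>k. cmod (p m k)) UNIV = (\<Sum>k. cmod (p m k))" for m
    using infsum_nat_eq_suminf[of "\<lambda>k. cmod (p m k)"] row by simp
  have ge0: "0 \<le> (\<Sum>k. cmod (p m k))" for m by (rule suminf_nonneg[OF row]) simp
  have sumrow: "summable (\<lambda>m. \<Sum>k. cmod (p m k))"
  proof (rule summable_comparison_test'[OF S])
    show "norm (\<Sum>k. cmod (p m k)) \<le> S m" for m using bound[of m] ge0[of m] by (simp only: real_norm_def abs_of_nonneg)
  qed
  note Sigma_iff = Infinite_Sum.abs_summable_on_Sigma_iff
  have row_abs: "(\<lambda>x. norm (case_prod p x)) summable_on (SIGMA m:UNIV. UNIV)"
  proof (rule Sigma_iff[THEN iffD2], intro conjI ballI)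
    show "(\<lambda>y. norm (case_prod p (m, y))) summable_on UNIV" for m
      using row by (simp add: abs_summable_nat_iff)
    show "(\<lambda>m. norm (infsum (\<lambda>y. norm (case_prod p (m, y))) UNIV)) summable_on UNIV"
      using sumrow ge0 by (simp add: row_inf summable_on_UNIV_nonneg_real_iff)
  qed
  have col_abs: "(\<lambda>x. norm (case_prod (\<lambda>k m. p m k) x)) summable_on (SIGMA k:UNIV. UNIV)"
    using summable_on_swap[of "\<lambda>x. norm (case_prod p x)" UNIV UNIV] row_abs by (simp add: case_prod_unfold)
  show col: "summable (\<lambda>m. cmod (p m k))" for k
    using Sigma_iff[THEN iffD1, OF col_abs, THEN conjunct1] by (simp add: abs_summable_nat_iff)
  have col_inf: "infsum (\<lambda>m. cmod (p m k)) UNIV = (\<Sum>m. cmod (p m k))" for k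
    using infsum_nat_eq_suminf[of "\<lambda>m. cmod (p m k)"] col by simp
  have ge0': "0 \<le> (\<Sum>m. cmod (p m k))" for k by (rule suminf_nonneg[OF col]) simp
  show sumcol: "summable (\<lambda>k. \<Sum>m. cmod (p m k))"
  proof -
    have "(\<lambda>k. norm (infsum (\<lambda>m. cmod (p m k)) UNIV)) summable_on UNIV"
      using Sigma_iff[THEN iffD1, OF col_abs, THEN conjunct2] by simp
    then show ?thesis using ge0' by (simp add: summable_on_UNIV_nonneg_real_iff col_inf)
  qed
  have le: "cmod (\<Sum>m. p m k) \<le> (\<Sum>m. cmod (p m k))" for k by (rule summable_norm[OF col])
  show 3: "summable (\<lambda>k. cmod (\<Sum>m. p m k))"
    by (rule summable_comparison_test'[OF sumcol]) (simp add: le)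
  have 4: "summable (\<lambda>m. cmod (\<Sum>k. p m k))"
    by (rule summable_comparison_test'[OF sumrow]) (simp add: summable_norm[OF row])
  have "(\<Sum>k. \<Sum>m. p m k) = infsum (\<lambda>k. infsum (\<lambda>m. p m k) UNIV) UNIV"
    using infsum_nat_eq_suminf[OF 3] infsum_nat_eq_suminf[OF col] by simp
  also have "\<dots> = infsum (\<lambda>m. infsum (\<lambda>k. p m k) UNIV) UNIV"
    by (rule infsum_swap_banach) (use abs_summable_summable[OF col_abs] in simp)
  also have "\<dots> = (\<Sum>m. \<Sum>k. p m k)"
    using infsum_nat_eq_suminf[OF 4] infsum_nat_eq_suminf[OF row] by simp
  finally show "(\<Sum>k. \<Sum>m. p m k) = (\<Sum>m. \<Sum>k. p m k)" .
qed

lemma norm_power_series_term: "cmod z \<le> 1 \<Longrightarrow> cmod (c * z ^ k) \<le> cmod c"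
  by (simp add: norm_mult norm_power mult_left_le power_le_one)

lemma abs_power_series:
  assumes "summable (\<lambda>k. cmod (c k))" "cmod z \<le> 1"
  shows "summable (\<lambda>k. cmod (c k * z ^ k))" "(\<lambda>k. c k * z ^ k) sums power_series c z"
proof -
  show *: "summable (\<lambda>k. cmod (c k * z ^ k))"
    by (rule summable_comparison_test'[OF assms(1)]) (simp only: real_norm_def abs_norm_cancel norm_power_series_term[OF assms(2)])
  show "(\<lambda>k. c k * z ^ k) sums power_series c z"
    unfolding power_series_def by (rule summable_sums[OF summable_norm_cancel[OF *]])
qed

lemma power_series_tail:
  assumes c: "summable (\<lambda>k. cmod (c k))" and z: "cmod z \<le> 1"
  shows "cmod ((\<Sum>k<m. c k * z ^ k) - power_series c z) \<le> (\<Sum>k. cmod (c (k + m)))"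
proof -
  have sums: "(\<lambda>k. c k * z ^ k) sums power_series c z" by (rule abs_power_series(2)[OF c z])
  have abs: "summable (\<lambda>k. cmod (c (k + m) * z ^ (k + m)))"
    by (rule summable_ignore_initial_segment[OF abs_power_series(1)[OF c z]])
  have "power_series c z = (\<Sum>k. c (k + m) * z ^ (k + m)) + (\<Sum>k<m. c k * z ^ k)"
    using suminf_split_initial_segment[OF sums_summable[OF sums], of m] sums by (simp add: sums_iff)
  then have "cmod ((\<Sum>k<m. c k * z ^ k) - power_series c z) = cmod (\<Sum>k. c (k + m) * z ^ (k + m))"
    by (simp add: norm_minus_commute)
  also have "\<dots> \<le> (\<Sum>k. cmod (c (k + m) * z ^ (k + m)))" by (rule summable_norm[OF abs])
  also have "\<dots> \<le> (\<Sum>k. cmod (c (k + m)))"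
    by (rule suminf_le[OF norm_power_series_term[OF z] abs summable_ignore_initial_segment[OF c]])
  finally show ?thesis .
qed

lemma power_series_cnj:
  assumes "summable (\<lambda>k. cmod (c k))" "cmod z \<le> 1"
  shows "power_series (\<lambda>k. cnj (c k)) (cnj z) = cnj (power_series c z)"
  using sums_cnj[THEN iffD2, OF abs_power_series(2)[OF assms]]
  by (simp add: power_series_def sums_iff)

lemma power_series_uniform_limit:
  assumes "summable (\<lambda>k. cmod (c k))"
  shows "uniform_limit (cball 0 1) (\<lambda>m z. \<Sum>k<m. c k * z ^ k) (power_series c) sequentially"
  unfolding power_series_def[abs_def]
  by (rule Weierstrass_m_test[OF _ assms], rule norm_power_series_term) simp

lemma continuous_on_power_series:
  assumes "summable (\<lambda>k. cmod (c k))"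
  shows "continuous_on (cball 0 1) (power_series c)"
proof (rule uniform_limit_theorem[OF _ power_series_uniform_limit[OF assms]])
  show "\<forall>\<^sub>F m in sequentially. continuous_on (cball 0 1) (\<lambda>z. \<Sum>k<m. c k * z ^ k)"
    by (intro always_eventually allI continuous_intros)
qed simp

text \<open>
  The Wiener algebra of the disc: functions given on the closed disc by an absolutely convergent power
  series. Boundary values of its members are ordinary sums.
\<close>
definition wiener :: "(complex \<Rightarrow> complex) \<Rightarrow> bool" where
  "wiener g \<longleftrightarrow> (\<exists>c. summable (\<lambda>k. cmod (c k)) \<and> (\<forall>z. cmod z \<le> 1 \<longrightarrow> power_series c z = g z))"

lemma wienerE:
  assumes "wiener g"
  obtains c where "summable (\<lambda>k. cmod (c k))" "\<And>z. cmod z \<le> 1 \<Longrightarrow> power_series c z = g z"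
proof -
  from assms obtain c where c: "summable (\<lambda>k. cmod (c k)) \<and> (\<forall>z. cmod z \<le> 1 \<longrightarrow> power_series c z = g z)"
    unfolding wiener_def by (rule exE)
  show ?thesis by (rule that[of c]) (simp_all add: c)
qed

lemma wienerI:
  assumes "summable (\<lambda>k. cmod (c k))" "\<And>z. cmod z \<le> 1 \<Longrightarrow> (\<lambda>k. c k * z ^ k) sums g z"
  shows "wiener g"
  unfolding wiener_def power_series_def
proof (rule exI[of _ c], rule conjI[OF assms(1)], rule allI, rule impI)
  show "(\<Sum>k. c k * z ^ k) = g z" if "cmod z \<le> 1" for z
    by (rule sums_unique[OF assms(2)[OF that], symmetric])
qed

text \<open>
  If the series converges at a point of modulus larger than \<open>1\<close>, it converges absolutely on the closed disc.
\<close>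
lemma wiener_holomorphic:
  assumes "g holomorphic_on ball 0 R" "R > 1"
  shows "wiener g"
proof (rule wienerI)
  let ?c = "\<lambda>k. (deriv ^^ k) g 0 / fact k"
  have s: "(\<lambda>k. ?c k * z ^ k) sums g z" if "cmod z < R" for z
    using holomorphic_power_series[OF assms(1), of z] that by simp
  obtain r where r: "1 < r" "r < R" using assms(2) dense by blast
  have "summable (\<lambda>k. norm (?c k * 1 ^ k))"
    by (rule powser_insidea[of ?c "of_real r" 1]) (use s[of "of_real r"] r in \<open>auto simp: sums_iff\<close>)
  then show "summable (\<lambda>k. cmod (?c k))" by simp
  show "cmod z \<le> 1 \<Longrightarrow> (\<lambda>k. ?c k * z ^ k) sums g z" for z by (rule s) (use assms(2) in simp)
qed

lemma power_series_product:
  assumes a: "summable (\<lambda>k. cmod (a k))" and b: "summable (\<lambda>k. cmod (b k))"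
  defines "c \<equiv> \<lambda>k. \<Sum>i\<le>k. a i * b (k - i)"
  shows "summable (\<lambda>k. cmod (c k))" "(\<Sum>k. cmod (c k)) \<le> (\<Sum>k. cmod (a k)) * (\<Sum>k. cmod (b k))"
    "cmod z \<le> 1 \<Longrightarrow> power_series c z = power_series a z * power_series b z"
proof -
  have S: "(\<lambda>k. \<Sum>i\<le>k. cmod (a i) * cmod (b (k - i))) sums ((\<Sum>k. cmod (a k)) * (\<Sum>k. cmod (b k)))"
    by (rule Cauchy_product_sums) (use a b in auto)
  have le: "cmod (c k) \<le> (\<Sum>i\<le>k. cmod (a i) * cmod (b (k - i)))" for k
    unfolding c_def by (rule order_trans[OF norm_sum]) (simp add: norm_mult)
  show 1: "summable (\<lambda>k. cmod (c k))"
    by (rule summable_comparison_test'[OF sums_summable[OF S]]) (simp add: le)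
  show "(\<Sum>k. cmod (c k)) \<le> (\<Sum>k. cmod (a k)) * (\<Sum>k. cmod (b k))"
    unfolding sums_unique[OF S] by (rule suminf_le[OF le 1 sums_summable[OF S]])
  assume z: "cmod z \<le> 1"
  have "(\<lambda>k. \<Sum>i\<le>k. (a i * z ^ i) * (b (k - i) * z ^ (k - i))) sums
      ((\<Sum>k. a k * z ^ k) * (\<Sum>k. b k * z ^ k))"
    by (rule Cauchy_product_sums) (use abs_power_series[OF a z] abs_power_series[OF b z] in auto)
  also have "(\<lambda>k. \<Sum>i\<le>k. (a i * z ^ i) * (b (k - i) * z ^ (k - i))) = (\<lambda>k. c k * z ^ k)"
  proof
    fix k
    have "(\<Sum>i\<le>k. (a i * z ^ i) * (b (k - i) * z ^ (k - i))) = (\<Sum>i\<le>k. a i * b (k - i) * z ^ k)"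
    proof (rule sum.cong[OF refl])
      fix i assume "i \<in> {..k}"
      then have "z ^ k = z ^ i * z ^ (k - i)" by (simp flip: power_add)
      then show "(a i * z ^ i) * (b (k - i) * z ^ (k - i)) = a i * b (k - i) * z ^ k" by simp
    qed
    then show "(\<Sum>i\<le>k. (a i * z ^ i) * (b (k - i) * z ^ (k - i))) = c k * z ^ k"
      by (simp add: c_def sum_distrib_right)
  qed
  finally show "power_series c z = power_series a z * power_series b z"
    by (simp add: power_series_def sums_iff)
qed

lemma wiener_mult:
  assumes "wiener g" "wiener h"
  shows "wiener (\<lambda>z. g z * h z)"
proof -
  obtain a where a: "summable (\<lambda>k. cmod (a k))" "\<And>z. cmod z \<le> 1 \<Longrightarrow> power_series a z = g z"
    by (rule wienerE[OF assms(1)]) (rule that)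
  obtain b where b: "summable (\<lambda>k. cmod (b k))" "\<And>z. cmod z \<le> 1 \<Longrightarrow> power_series b z = h z"
    by (rule wienerE[OF assms(2)]) (rule that)
  show ?thesis
    unfolding wiener_def
  proof (intro exI[of _ "\<lambda>k. \<Sum>i\<le>k. a i * b (k - i)"] conjI allI impI)
    show "summable (\<lambda>k. cmod (\<Sum>i\<le>k. a i * b (k - i)))" by (rule power_series_product(1)[OF a(1) b(1)])
    show "power_series (\<lambda>k. \<Sum>i\<le>k. a i * b (k - i)) z = g z * h z" if "cmod z \<le> 1" for z
      using power_series_product(3)[OF a(1) b(1) that] a(2)[OF that] b(2)[OF that] by (simp only:)
  qed
qed

lemma wiener_const: "wiener (\<lambda>z. c)"
  by (rule wiener_holomorphic[where R = 2]) auto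

lemma wiener_power: "wiener g \<Longrightarrow> wiener (\<lambda>z. g z ^ m)"
proof (induction m)
  case 0
  then show ?case using wiener_const[of 1] by simp
next
  case (Suc m)
  then show ?case using wiener_mult[of g "\<lambda>z. g z ^ m"] by simp
qed

text \<open>
  The \<open>m\<close>-th power of \<open>g\<close> has coefficients of absolute sum at most \<open>S\<^sup>m\<close>, where \<open>S\<close> is that of \<open>g\<close>; so
  the exponential series can be rearranged by powers of \<open>z\<close>.
\<close>
lemma wiener_exp:
  assumes "wiener g"
  shows "wiener (\<lambda>z. exp (g z))"
proof -
  obtain c where c: "summable (\<lambda>k. cmod (c k))" "\<And>z. cmod z \<le> 1 \<Longrightarrow> power_series c z = g z"
    by (rule wienerE[OF assms]) (rule that)
  define S where "S = (\<Sum>k. cmod (c k))"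
  have S0: "S \<ge> 0" unfolding S_def by (rule suminf_nonneg[OF c(1)]) simp
  have "\<exists>e. summable (\<lambda>k. cmod (e k)) \<and> (\<Sum>k. cmod (e k)) \<le> S ^ m \<and>
      (\<forall>z. cmod z \<le> 1 \<longrightarrow> power_series e z = g z ^ m)" for m
  proof (induction m)
    case 0
    have s: "(\<lambda>k. if k = 0 then 1 else 0) sums (1::real)"
      using sums_single[of 0 "\<lambda>_. 1"] by simp
    have t: "(\<lambda>k. (if k = 0 then 1 else 0) * z ^ k) sums 1" for z :: complex
      using sums_single[of 0 "\<lambda>k. z ^ k"] by (simp add: if_distrib[where f = "\<lambda>x. x * _"] cong: if_cong)
    show ?case
      by (rule exI[of _ "\<lambda>k. if k = 0 then 1 else 0"])
        (use s t in \<open>simp add: if_distrib[where f = cmod] sums_iff power_series_def cong: if_cong\<close>)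
  next
    case (Suc m)
    then obtain e where e: "summable (\<lambda>k. cmod (e k))" "(\<Sum>k. cmod (e k)) \<le> S ^ m"
      "\<And>z. cmod z \<le> 1 \<Longrightarrow> power_series e z = g z ^ m" by (elim exE conjE) auto
    note P = power_series_product[OF c(1) e(1)]
    have "S * (\<Sum>k. cmod (e k)) \<le> S * S ^ m" by (rule mult_left_mono[OF e(2) S0])
    then show ?case
      by (intro exI[of _ "\<lambda>k. \<Sum>i\<le>k. c i * e (k - i)"] conjI P(1))
        (use P(2,3) c(2) e(3) in \<open>auto simp: S_def\<close>)
  qed
  then have "\<forall>m. \<exists>e. summable (\<lambda>k. cmod (e k)) \<and> (\<Sum>k. cmod (e k)) \<le> S ^ m \<and>
      (\<forall>z. cmod z \<le> 1 \<longrightarrow> power_series e z = g z ^ m)" by (rule allI)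
  from choice[OF this] obtain e where e: "\<And>m. summable (\<lambda>k. cmod (e m k))" "\<And>m. (\<Sum>k. cmod (e m k)) \<le> S ^ m"
      "\<And>m z. cmod z \<le> 1 \<Longrightarrow> power_series (e m) z = g z ^ m" by auto
  define p where "p m k = e m k / fact m" for m k :: nat
  have p1: "summable (\<lambda>k. cmod (p m k))" for m
    unfolding p_def norm_divide by (intro summable_divide e)
  have p2: "(\<Sum>k. cmod (p m k)) \<le> S ^ m / fact m" for m
    unfolding p_def norm_divide using suminf_divide[OF e(1)[of m], of "fact m"] e(2)[of m]
    by (simp add: divide_right_mono)
  have p3: "summable (\<lambda>m. S ^ m / fact m)"
    using summable_exp[of S] by (simp add: field_simps)
  note swap = double_series_swap[OF p1 p2 p3]
  show ?thesis
  proof (rule wienerI[of "\<lambda>k. \<Sum>m. p m k"])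
    show "summable (\<lambda>k. cmod (\<Sum>m. p m k))" by (rule swap(3))
    fix z :: complex assume z: "cmod z \<le> 1"
    have q1: "summable (\<lambda>k. cmod (p m k * z ^ k))" for m by (rule abs_power_series[OF p1 z])
    have q2: "(\<Sum>k. cmod (p m k * z ^ k)) \<le> S ^ m / fact m" for m
    proof -
      have "(\<Sum>k. cmod (p m k * z ^ k)) \<le> (\<Sum>k. cmod (p m k))"
        by (intro suminf_le q1 p1) (rule norm_power_series_term[OF z])
      then show ?thesis using p2[of m] by linarith
    qed
    have "(\<Sum>k. \<Sum>m. p m k * z ^ k) = (\<Sum>m. \<Sum>k. p m k * z ^ k)"
      by (rule double_series_swap(4)[OF q1 q2 p3])
    also have "\<dots> = (\<Sum>m. g z ^ m / fact m)"
    proof (rule suminf_cong)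
      fix m
      have "(\<lambda>k. e m k * z ^ k / fact m) sums (g z ^ m / fact m)"
        using abs_power_series(2)[OF e(1) z, of m] e(3)[OF z, of m] by (intro sums_divide) simp
      then show "(\<Sum>k. p m k * z ^ k) = g z ^ m / fact m"
        by (simp add: p_def sums_iff)
    qed
    also have "\<dots> = exp (g z)"
      by (simp add: exp_def scaleR_conv_of_real field_simps)
    finally have "(\<Sum>k. (\<Sum>m. p m k) * z ^ k) = exp (g z)"
      by (simp add: suminf_mult2[OF summable_norm_cancel[OF swap(1)], symmetric])
    moreover have "summable (\<lambda>k. (\<Sum>m. p m k) * z ^ k)"
      by (rule summable_norm_cancel[OF abs_power_series(1)[OF swap(3) z]])
    ultimately show "(\<lambda>k. (\<Sum>m. p m k) * z ^ k) sums exp (g z)" by (simp add: sums_iff)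
  qed
qed

text \<open>
  For the inverse: the zeros in a slightly larger disc form a compact set disjoint from the closed unit disc, so
  \<open>1/\<Phi>\<close> is holomorphic on a disc of radius larger than \<open>1\<close>.
\<close>
lemma canonical_factor_wiener:
  assumes R: "conv_radius \<phi> > 1" and nz: "\<And>z. cmod z \<le> 1 \<Longrightarrow> power_series \<phi> z \<noteq> 0"
  shows "wiener (power_series \<phi>)" "wiener (\<lambda>z. inverse (power_series \<phi> z))"
    "power_series \<phi> holomorphic_on ball 0 1"
proof -
  obtain r :: real where r: "1 < r" "ereal r < conv_radius \<phi>"
  proof -
    obtain q where q: "1 < q" "q < conv_radius \<phi>" using R dense by blast
    then obtain r where "q = ereal r" by (cases q) auto
    then show ?thesis using q that[of r] by simp
  qed
  have eq: "power_series \<phi> = eval_fps (Abs_fps \<phi>)"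
    by (simp add: power_series_def eval_fps_def fun_eq_iff)
  have hol: "power_series \<phi> holomorphic_on ball 0 r"
    unfolding eq
  proof (rule holomorphic_on_eval_fps)
    show "ball (0::complex) r \<subseteq> eball 0 (fps_conv_radius (Abs_fps \<phi>))"
    proof (rule subsetI)
      fix z :: complex assume "z \<in> ball 0 r"
      then have "ereal (cmod z) < ereal r" by simp
      then have "ereal (cmod z) < conv_radius \<phi>" using r(2) by (rule less_trans)
      then show "z \<in> eball 0 (fps_conv_radius (Abs_fps \<phi>))"
        by (simp add: fps_conv_radius_def in_eball_iff)
    qed
  qed
  show "wiener (power_series \<phi>)" by (rule wiener_holomorphic[OF hol r(1)])
  show "power_series \<phi> holomorphic_on ball 0 1"
    by (rule holomorphic_on_subset[OF hol]) (use r in auto)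
  define r2 where "r2 = (1 + r) / 2"
  have r2: "1 < r2" "r2 < r" using r by (auto simp: r2_def field_simps)
  define K where "K = {z \<in> cball 0 r2. power_series \<phi> z = 0}"
  have "compact K"
  proof -
    have "continuous_on (cball 0 r2) (power_series \<phi>)"
      by (rule continuous_on_subset[OF holomorphic_on_imp_continuous_on[OF hol]]) (use r2 in auto)
    then have "closed (cball 0 r2 \<inter> power_series \<phi> -` {0})"
      by (intro continuous_closed_preimage) auto
    moreover have "K = cball 0 r2 \<inter> power_series \<phi> -` {0}" by (auto simp: K_def)
    moreover have "bounded K" by (rule bounded_subset[of "cball 0 r2"]) (auto simp: K_def)
    ultimately show ?thesis by (simp add: compact_eq_bounded_closed)
  qed
  have "\<exists>r3>1. r3 \<le> r2 \<and> (\<forall>z\<in>ball 0 r3. power_series \<phi> z \<noteq> 0)"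
  proof (cases "K = {}")
    case True
    then show ?thesis using r2 by (intro exI[of _ r2]) (auto simp: K_def)
  next
    case False
    obtain z0 where z0: "z0 \<in> K" "\<And>z. z \<in> K \<Longrightarrow> cmod z0 \<le> cmod z"
      using continuous_attains_inf[OF \<open>compact K\<close> False, of cmod] continuous_on_norm_id by blast
    have "cmod z0 > 1" using z0(1) nz[of z0] by (fastforce simp: K_def)
    moreover have "cmod z0 \<le> r2" using z0(1) by (auto simp: K_def)
    moreover have "power_series \<phi> z \<noteq> 0" if "z \<in> ball 0 (cmod z0)" for z
      using z0(2)[of z] that calculation(2) by (auto simp: K_def)
    ultimately show ?thesis by blast
  qed
  then obtain r3 where r3: "r3 > 1" "r3 \<le> r2" "\<And>z. z \<in> ball 0 r3 \<Longrightarrow> power_series \<phi> z \<noteq> 0" by blast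
  have "(\<lambda>z. inverse (power_series \<phi> z)) holomorphic_on ball 0 r3"
    by (intro holomorphic_intros holomorphic_on_subset[OF hol]) (use r3 r2 in auto)
  then show "wiener (\<lambda>z. inverse (power_series \<phi> z))" by (rule wiener_holomorphic) (rule r3)
qed

section \<open>Fourier analysis on the circle\<close>

text \<open>
  The normalized Lebesgue measure of the circle, parametrized by \<open>[-pi, pi]\<close>.
\<close>
definition circ :: "real measure" where
  "circ = density lborel (\<lambda>x. ennreal (indicator {-pi..pi} x / (2 * pi)))"

lemma sets_circ [simp, measurable_cong]: "sets circ = sets borel"
  by (simp add: circ_def)

lemma space_circ [simp]: "space circ = UNIV"
  by (simp add: circ_def)

lemma circ_integral:
  fixes g :: "real \<Rightarrow> 'b::{banach, second_countable_topology}"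
  assumes g: "g \<in> borel_measurable borel"
  shows "(LINT x|circ. g x) = (1 / (2 * pi)) *\<^sub>R (LINT x:{-pi..pi}|lborel. g x)"
    and "integrable circ g \<longleftrightarrow> set_integrable lborel {-pi..pi} g"
proof -
  have m: "(\<lambda>x. indicator {-pi..pi} x / (2 * pi)) \<in> borel_measurable lborel" by measurable
  have nn: "AE x in lborel. 0 \<le> indicator {-pi..pi} x / (2 * pi)" by simp
  have gm: "g \<in> borel_measurable lborel" using g by simp
  have eq: "(indicator {-pi..pi} x / (2 * pi)) *\<^sub>R g x = (1 / (2 * pi)) *\<^sub>R (indicator {-pi..pi} x *\<^sub>R g x)" for x
    by simp
  show "(LINT x|circ. g x) = (1 / (2 * pi)) *\<^sub>R (LINT x:{-pi..pi}|lborel. g x)"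
    unfolding circ_def integral_density[OF gm m nn] eq set_lebesgue_integral_def
    by (rule integral_scaleR_right)
  show "integrable circ g \<longleftrightarrow> set_integrable lborel {-pi..pi} g"
    unfolding circ_def integrable_density[OF gm m nn] eq set_integrable_def
  proof
    assume "integrable lborel (\<lambda>x. (1 / (2 * pi)) *\<^sub>R (indicator {-pi..pi} x *\<^sub>R g x))"
    then have "integrable lborel (\<lambda>x. (2 * pi) *\<^sub>R ((1 / (2 * pi)) *\<^sub>R (indicator {-pi..pi} x *\<^sub>R g x)))"
      by (rule integrable_scaleR_right)
    then show "integrable lborel (\<lambda>x. indicator {-pi..pi} x *\<^sub>R g x)" by simp
  next
    assume "integrable lborel (\<lambda>x. indicator {-pi..pi} x *\<^sub>R g x)"
    then show "integrable lborel (\<lambda>x. (1 / (2 * pi)) *\<^sub>R (indicator {-pi..pi} x *\<^sub>R g x))"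
      by (rule integrable_scaleR_right)
  qed
qed

lemma circ_AE: "(AE x in circ. P x) \<longleftrightarrow> (AE x in lborel. x \<in> {-pi..pi} \<longrightarrow> P x)"
proof -
  have "(AE x in circ. P x) \<longleftrightarrow> (AE x in lborel. 0 < ennreal (indicator {-pi..pi} x / (2 * pi)) \<longrightarrow> P x)"
    unfolding circ_def by (rule AE_density) measurable
  also have "\<dots> \<longleftrightarrow> (AE x in lborel. x \<in> {-pi..pi} \<longrightarrow> P x)"
    by (intro AE_cong) (auto simp: indicator_def)
  finally show ?thesis .
qed

lemma circ_AE_interval: "AE x in circ. x \<in> {-pi..pi}"
  by (simp add: circ_AE)

lemma circ_AE_neq: "AE x in circ. x \<noteq> c"
  unfolding circ_AE using AE_lborel_singleton[of c] by eventually_elim simp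

lemma prob_space_circ: "prob_space circ"
proof
  have "emeasure circ UNIV = (\<integral>\<^sup>+x. ennreal (1 / (2 * pi)) * indicator {-pi..pi} x \<partial>lborel)"
    unfolding circ_def by (subst emeasure_density) (auto intro!: nn_integral_cong simp: indicator_def)
  also have "\<dots> = ennreal (1 / (2 * pi)) * ennreal (2 * pi)"
    by (subst nn_integral_cmult_indicator) auto
  also have "\<dots> = 1" by (simp flip: ennreal_mult)
  finally show "emeasure circ (space circ) = 1" by simp
qed

interpretation circ: prob_space circ by (rule prob_space_circ)

lemma cis_measurable [measurable]: "(\<lambda>x. cis (a * x)) \<in> borel_measurable borel"
  by (intro borel_measurable_continuous_onI continuous_intros)

lemma cis_power: "cis x ^ k = cis (real k * x)"
  by (rule Complex.DeMoivre)

lemma cis_has_vector_derivative: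
  "((\<lambda>x. cis (a * x)) has_vector_derivative \<i> * of_real a * cis (a * x)) (at x within S)"
proof -
  have "((\<lambda>z. exp (\<i> * of_real a * z)) has_field_derivative \<i> * of_real a * exp (\<i> * of_real a * of_real x)) (at (of_real x))"
    by (auto intro!: derivative_eq_intros)
  from has_vector_derivative_real_field[OF this, of S] show ?thesis
    by (simp add: cis_conv_exp mult.assoc)
qed

lemma has_vector_derivative_quotient:
  fixes g :: "real \<Rightarrow> complex"
  assumes "(g has_vector_derivative g') (at x)"
  shows "((\<lambda>y. (g y - g x) / of_real (y - x)) \<longlongrightarrow> g') (at x)"
proof -
  have lim: "((\<lambda>y. norm (g y - g x - (y - x) *\<^sub>R g') / norm (y - x)) \<longlongrightarrow> 0) (at x)"
    using assms unfolding has_vector_derivative_def has_derivative_iff_norm by simp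
  have "((\<lambda>y. norm ((g y - g x) / of_real (y - x) - g')) \<longlongrightarrow> 0) (at x)"
  proof (rule Lim_transform_eventually[OF lim])
    have "\<forall>\<^sub>F y in at x. y \<noteq> x" by (simp add: eventually_at_filter)
    then show "\<forall>\<^sub>F y in at x. norm (g y - g x - (y - x) *\<^sub>R g') / norm (y - x) = norm ((g y - g x) / of_real (y - x) - g')"
    proof eventually_elim
      case (elim y)
      then have "(g y - g x) / of_real (y - x) - g' = (g y - g x - (y - x) *\<^sub>R g') / of_real (y - x)"
        by (simp add: field_simps scaleR_conv_of_real)
      then show ?case by (simp only: norm_divide norm_of_real real_norm_def)
    qed
  qed
  then show ?thesis by (simp add: tendsto_norm_zero_iff LIM_zero_cancel)
qed

lemma circ_integral_cis:
  "(LINT x|circ. cis (of_int k * x)) = (if k = 0 then 1 else 0)"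
proof (cases "k = 0")
  case True
  then show ?thesis by (simp add: circ.prob_space[simplified])
next
  case False
  let ?F = "\<lambda>x. cis (of_int k * x) / (\<i> * of_int k)"
  have "(LINT x:{-pi..pi}|lborel. cis (of_int k * x)) = ?F pi - ?F (-pi)"
    unfolding set_lebesgue_integral_def
  proof (rule integral_FTC_atLeastAtMost)
    show "(?F has_vector_derivative cis (of_int k * x)) (at x within {-pi..pi})" for x
      using has_vector_derivative_divide[OF cis_has_vector_derivative[of "of_int k" x "{-pi..pi}"], of "\<i> * of_int k"] False
      by simp
  qed (auto intro!: continuous_intros)
  also have "cis (of_int k * pi) = cis (of_int k * (-pi))"
  proof -
    have "cis (of_int k * pi) = cis (of_int k * (-pi) + 2 * pi * of_int k)" by (simp add: algebra_simps)
    also have "\<dots> = cis (of_int k * (-pi)) * cis (2 * pi * of_int k)" by (simp only: cis_mult)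
    also have "cis (2 * pi * of_int k) = 1" by (rule cis_multiple_2pi) simp
    finally show ?thesis by (simp only: mult_1_right)
  qed
  finally have "(LINT x:{-pi..pi}|lborel. cis (of_int k * x)) = 0" by simp
  then show ?thesis using False by (simp add: circ_integral)
qed

definition fourier :: "(real \<Rightarrow> complex) \<Rightarrow> int \<Rightarrow> complex" where
  "fourier g k = (LINT x|circ. g x * cis (- of_int k * x))"

lemma integrable_mult_cis:
  assumes "integrable circ g"
  shows "integrable circ (\<lambda>x. g x * cis (a * x))"
  by (rule Bochner_Integration.integrable_bound[OF assms])
    (use borel_measurable_integrable[OF assms] in \<open>auto simp: norm_mult\<close>)

lemma sq_integrable_cis: "sq_integrable circ (\<lambda>x. cis (a * x))"
  by (rule sq_integrable_bounded[where C = 1]) (auto intro: circ.finite_measure_axioms)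

lemma sq_integrable_imp_integrable:
  assumes "finite_measure N" "sq_integrable N g"
  shows "integrable N g"
proof -
  have "integrable N (\<lambda>x. g x * cnj 1)"
    by (rule sq_integrable_prod[OF assms(2)]) (rule sq_integrable_bounded[where C = 1, OF assms(1)], auto)
  then show ?thesis by simp
qed

lemma l2n_trig_sum:
  assumes "finite S"
  shows "(l2n circ (\<lambda>x. \<Sum>k\<in>S. c k * cis (of_int k * x)))\<^sup>2 = (\<Sum>k\<in>S. (cmod (c k))\<^sup>2)"
proof -
  let ?s = "\<lambda>x. \<Sum>k\<in>S. c k * cis (of_int k * x)"
  have int: "integrable circ (\<lambda>x. cis (of_int j * x))" for j
    by (intro sq_integrable_imp_integrable[OF circ.finite_measure_axioms] sq_integrable_cis)
  have "complex_of_real ((l2n circ ?s)\<^sup>2) = (LINT x|circ. ?s x * cnj (?s x))"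
    by (simp only: l2n_sq complex_norm_square[symmetric] integral_complex_of_real)
  also have "\<dots> = (LINT x|circ. (\<Sum>k\<in>S. \<Sum>j\<in>S. c k * cnj (c j) * cis (of_int (k - j) * x)))"
  proof (rule Bochner_Integration.integral_cong[OF refl])
    fix x
    have "cis (of_int k * x) * cnj (cis (of_int j * x)) = cis (of_int (k - j) * x)" for k j
      by (simp add: cis_cnj cis_mult algebra_simps)
    then show "?s x * cnj (?s x) = (\<Sum>k\<in>S. \<Sum>j\<in>S. c k * cnj (c j) * cis (of_int (k - j) * x))"
      by (simp add: sum_product cnj_sum mult_ac del: of_int_diff)
  qed
  also have "\<dots> = (\<Sum>k\<in>S. \<Sum>j\<in>S. c k * cnj (c j) * (LINT x|circ. cis (of_int (k - j) * x)))"
    using int by (simp del: of_int_diff)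
  also have "\<dots> = (\<Sum>k\<in>S. \<Sum>j\<in>S. if j = k then c k * cnj (c k) else 0)"
    unfolding circ_integral_cis by (intro sum.cong) auto
  also have "\<dots> = complex_of_real (\<Sum>k\<in>S. (cmod (c k))\<^sup>2)"
    using assms by (simp add: complex_norm_square[symmetric])
  finally show ?thesis by (simp only: of_real_eq_iff)
qed

text \<open>
  The partial Fourier sum is orthogonal to the remainder.
\<close>
lemma bessel:
  assumes g: "sq_integrable circ g" and S: "finite S"
  shows "(\<Sum>k\<in>S. (cmod (fourier g k))\<^sup>2) \<le> (l2n circ g)\<^sup>2"
proof -
  define s where "s x = (\<Sum>k\<in>S. fourier g k * cis (of_int k * x))" for x
  have sq: "sq_integrable circ s"
    unfolding s_def by (intro sq_integrable_sum sq_integrable_cmult sq_integrable_cis)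
  have gint: "integrable circ (\<lambda>x. g x * cis (a * x))" for a
    by (intro integrable_mult_cis sq_integrable_imp_integrable[OF circ.finite_measure_axioms] g)
  have gs: "(LINT x|circ. g x * cnj (s x)) = of_real (\<Sum>k\<in>S. (cmod (fourier g k))\<^sup>2)"
  proof -
    have "(LINT x|circ. g x * cnj (s x)) = (LINT x|circ. (\<Sum>k\<in>S. cnj (fourier g k) * (g x * cis (- of_int k * x))))"
      by (simp add: s_def cis_cnj sum_distrib_left mult_ac)
    also have "\<dots> = (\<Sum>k\<in>S. cnj (fourier g k) * fourier g k)"
      using gint[of "- of_int _"] by (simp add: fourier_def)
    also have "\<dots> = of_real (\<Sum>k\<in>S. (cmod (fourier g k))\<^sup>2)"
      by (simp add: complex_norm_square[symmetric] mult.commute)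
    finally show ?thesis .
  qed
  have ss: "(LINT x|circ. s x * cnj (s x)) = of_real (\<Sum>k\<in>S. (cmod (fourier g k))\<^sup>2)"
  proof -
    have "(LINT x|circ. s x * cnj (s x)) = complex_of_real ((l2n circ s)\<^sup>2)"
      by (simp only: l2n_sq complex_norm_square[symmetric] integral_complex_of_real)
    then show ?thesis unfolding s_def by (simp add: l2n_trig_sum[OF S])
  qed
  have "(LINT x|circ. (g x - s x) * cnj (s x)) = 0"
    using sq_integrable_prod[OF g sq] sq_integrable_prod[OF sq sq] gs ss by (simp add: left_diff_distrib)
  from l2n_pythagoras[OF sq_integrable_diff[OF g sq] sq this]
  have "(l2n circ g)\<^sup>2 \<ge> (l2n circ s)\<^sup>2" by simp
  then show ?thesis unfolding s_def by (simp add: l2n_trig_sum[OF S])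
qed

lemma bessel_summable:
  assumes g: "sq_integrable circ g"
  shows "summable (\<lambda>k. (cmod (fourier g (int k)))\<^sup>2)" "summable (\<lambda>k. (cmod (fourier g (- int k)))\<^sup>2)"
proof -
  have *: "summable (\<lambda>k. (cmod (fourier g (h k)))\<^sup>2)" if "inj h" for h :: "nat \<Rightarrow> int"
  proof (rule summableI_nonneg_bounded)
    fix m
    have "(\<Sum>k<m. (cmod (fourier g (h k)))\<^sup>2) = (\<Sum>k\<in>h ` {..<m}. (cmod (fourier g k))\<^sup>2)"
      using that by (subst sum.reindex) (auto intro: inj_on_subset)
    also have "\<dots> \<le> (l2n circ g)\<^sup>2" by (intro bessel g) auto
    finally show "(\<Sum>k<m. (cmod (fourier g (h k)))\<^sup>2) \<le> (l2n circ g)\<^sup>2" .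
  qed simp
  show "summable (\<lambda>k. (cmod (fourier g (int k)))\<^sup>2)" by (rule *) (auto simp: inj_def)
  show "summable (\<lambda>k. (cmod (fourier g (- int k)))\<^sup>2)" by (rule *) (auto simp: inj_def)
qed

lemma fourier_tendsto_0:
  assumes g: "sq_integrable circ g"
  shows "(\<lambda>k. fourier g (int k)) \<longlonglongrightarrow> 0" "(\<lambda>k. fourier g (- int k)) \<longlonglongrightarrow> 0"
proof -
  have *: "h \<longlonglongrightarrow> 0" if "summable (\<lambda>k. (cmod (h k))\<^sup>2)" for h :: "nat \<Rightarrow> complex"
  proof -
    have "(\<lambda>k. sqrt ((cmod (h k))\<^sup>2)) \<longlonglongrightarrow> sqrt 0"
      by (intro tendsto_real_sqrt summable_LIMSEQ_zero that)
    then show ?thesis by (simp add: tendsto_norm_zero_iff)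
  qed
  show "(\<lambda>k. fourier g (int k)) \<longlonglongrightarrow> 0" "(\<lambda>k. fourier g (- int k)) \<longlonglongrightarrow> 0"
    by (rule *, rule bessel_summable[OF g])+
qed

lemma sq_integrable_continuous:
  fixes g :: "real \<Rightarrow> complex"
  assumes "continuous_on {-pi..pi} g" "g \<in> borel_measurable borel"
  shows "sq_integrable circ g"
proof -
  have "bounded (g ` {-pi..pi})" by (intro compact_imp_bounded compact_continuous_image assms) auto
  then obtain C where C: "\<And>x. x \<in> {-pi..pi} \<Longrightarrow> cmod (g x) \<le> C" by (force simp: bounded_iff)
  show ?thesis
  proof (rule sq_integrable_bound[where h = "\<lambda>_. C\<^sup>2"])
    show "AE x in circ. (cmod (g x))\<^sup>2 \<le> C\<^sup>2"
      using circ_AE_interval by eventually_elim (intro power_mono C, auto)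
  qed (use assms in auto)
qed

lemma power_series_cis_measurable:
  assumes "summable (\<lambda>k. cmod (c k))"
  shows "(\<lambda>x. power_series c (cis (a * x))) \<in> borel_measurable borel"
    and "cmod z \<le> 1 \<Longrightarrow> cmod (power_series c z) \<le> (\<Sum>k. cmod (c k))"
proof -
  have "continuous_on UNIV (power_series c \<circ> (\<lambda>x. cis (a * x)))"
    by (rule continuous_on_compose) (auto intro!: continuous_intros continuous_on_subset[OF continuous_on_power_series[OF assms]])
  then show "(\<lambda>x. power_series c (cis (a * x))) \<in> borel_measurable borel"
    by (intro borel_measurable_continuous_onI) (simp add: comp_def)
  assume z: "cmod z \<le> 1"
  have "cmod (power_series c z) \<le> (\<Sum>k. cmod (c k * z ^ k))"
    unfolding power_series_def by (rule summable_norm[OF abs_power_series(1)[OF assms z]])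
  also have "\<dots> \<le> (\<Sum>k. cmod (c k))"
    by (intro suminf_le abs_power_series(1)[OF assms z] assms norm_power_series_term[OF z])
  finally show "cmod (power_series c z) \<le> (\<Sum>k. cmod (c k))" .
qed

lemma sq_integrable_power_series:
  assumes "summable (\<lambda>k. cmod (c k))"
  shows "sq_integrable circ (\<lambda>x. power_series c (cis (a * x)))"
  by (rule sq_integrable_bounded[OF circ.finite_measure_axioms])
    (use power_series_cis_measurable[OF assms, of a] in \<open>auto intro!: power_series_cis_measurable(2)[OF assms]\<close>)

lemma parseval_power_series:
  assumes c: "summable (\<lambda>k. cmod (c k))"
  shows "(\<lambda>k. (cmod (c k))\<^sup>2) sums (l2n circ (\<lambda>x. power_series c (cis x)))\<^sup>2"
proof -
  let ?s = "\<lambda>m x. \<Sum>k<m. c k * cis x ^ k"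
  have sq: "sq_integrable circ (?s m)" for m
    by (intro sq_integrable_sum sq_integrable_cmult) (simp add: cis_power sq_integrable_cis)
  have norm: "(l2n circ (?s m))\<^sup>2 = (\<Sum>k<m. (cmod (c k))\<^sup>2)" for m
  proof -
    have eq: "?s m = (\<lambda>x. \<Sum>k\<in>int ` {..<m}. c (nat k) * cis (of_int k * x))"
      by (simp add: sum.reindex cis_power)
    have "(l2n circ (?s m))\<^sup>2 = (\<Sum>k\<in>int ` {..<m}. (cmod (c (nat k)))\<^sup>2)"
      unfolding eq by (rule l2n_trig_sum) simp
    then show ?thesis by (simp add: sum.reindex)
  qed
  have "L2_tendsto circ ?s (\<lambda>x. power_series c (cis x))"
  proof (rule L2_tendsto_uniform[OF circ.finite_measure_axioms sq])
    show "sq_integrable circ (\<lambda>x. power_series c (cis x))"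
      using sq_integrable_power_series[OF c, of 1] by simp
    show "cmod (?s m x - power_series c (cis x)) \<le> (\<Sum>k. cmod (c (k + m)))" for m x
      by (rule power_series_tail[OF c]) simp
  qed (rule suminf_exist_split2[OF c])
  from tendsto_power[OF L2_tendsto_norm[OF this], of 2] show ?thesis
    by (simp add: norm sums_def)
qed

text \<open>
  A power series on the circle has no negative frequencies, so its product with \<open>e\<^sup>i\<^sup>j\<^sup>x\<close> has mean zero for
  \<open>j > 0\<close>. This is the source of the orthogonality of \<open>r\<close> to the past.
\<close>
lemma integral_power_series_cis:
  assumes c: "summable (\<lambda>k. cmod (c k))"
  shows "(LINT x|circ. power_series c (cis x) * cis (of_int j * x)) = (if j \<le> 0 then c (nat (- j)) else 0)"
proof -
  have sums: "(\<lambda>k. LINT x|circ. c k * cis x ^ k * cis (of_int j * x)) sums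
      (LINT x|circ. (\<Sum>k. c k * cis x ^ k * cis (of_int j * x)))"
  proof (rule sums_integral)
    have eq: "(\<lambda>x. c k * cis x ^ k * cis (of_int j * x)) = (\<lambda>x. c k * cis ((real k + of_int j) * x))" for k
      by (simp add: cis_power mult.assoc cis_mult ring_distribs fun_eq_iff)
    show "integrable circ (\<lambda>x. c k * cis x ^ k * cis (of_int j * x))" for k
      unfolding eq
      by (intro integrable_mult_right sq_integrable_imp_integrable[OF circ.finite_measure_axioms] sq_integrable_cis)
    show "AE x in circ. summable (\<lambda>k. norm (c k * cis x ^ k * cis (of_int j * x)))"
      using c by (intro AE_I2) (simp add: norm_mult norm_power)
    show "summable (\<lambda>k. LINT x|circ. norm (c k * cis x ^ k * cis (of_int j * x)))"
      using c by (simp add: norm_mult norm_power circ.prob_space[simplified])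
  qed
  have terms: "(LINT x|circ. c k * cis x ^ k * cis (of_int j * x)) = (if int k = - j then c k else 0)" for k
  proof -
    have "(LINT x|circ. c k * cis x ^ k * cis (of_int j * x)) = (LINT x|circ. c k * cis (of_int (int k + j) * x))"
      by (simp add: cis_power mult.assoc cis_mult ring_distribs)
    then show ?thesis by (auto simp: circ_integral_cis simp del: of_int_add)
  qed
  have "(\<lambda>k. if int k = - j then c k else 0) sums (if j \<le> 0 then c (nat (- j)) else 0)"
  proof (cases "j \<le> 0")
    case True
    have "(\<lambda>k. if int k = - j then c k else 0) = (\<lambda>k. if k = nat (-j) then c k else 0)"
      using True by (auto simp: fun_eq_iff)
    then show ?thesis using sums_single[of "nat (-j)" c] True by simp
  next
    case False
    then have "(\<lambda>k. if int k = - j then c k else 0) = (\<lambda>k. 0)" by (auto simp: fun_eq_iff)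
    then show ?thesis using False by simp
  qed
  moreover have "(\<Sum>k. c k * cis x ^ k * cis (of_int j * x)) = power_series c (cis x) * cis (of_int j * x)" for x
    using sums_mult2[OF abs_power_series(2)[OF c, of "cis x"], of "cis (of_int j * x)"] by (simp add: sums_iff)
  ultimately show ?thesis using sums unfolding terms by (simp add: sums_iff)
qed

text \<open>
  Chernoff's argument: \<open>g - g x0 = q (e\<^sup>i\<^sup>x - e\<^sup>i\<^sup>x\<^sup>0)\<close> with a bounded \<open>q\<close>, so the coefficients of \<open>g - g x0\<close> are
  differences of shifted coefficients of \<open>q\<close>. The partial sums at \<open>x0\<close> telescope to two
  coefficients of \<open>q\<close>, which vanish in the limit by Bessel's inequality.
\<close>
lemma fourier_inversion:
  assumes cont: "continuous_on {-pi..pi} g" and g: "g \<in> borel_measurable borel"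
    and x0: "x0 \<in> {-pi<..<pi}" and diff: "(g has_vector_derivative g') (at x0)"
  shows "(\<lambda>N. \<Sum>k\<in>{- int N..int N}. fourier g k * cis (of_int k * x0)) \<longlonglongrightarrow> g x0"
proof -
  have [measurable]: "g \<in> borel_measurable borel" by (rule g)
  have cis_inj: "cis x \<noteq> cis x0" if "x \<in> {-pi..pi}" "x \<noteq> x0" for x
  proof
    assume "cis x = cis x0"
    then have "cis (x - x0) = 1" by (simp add: cis_divide[symmetric])
    then obtain m :: int where m: "x - x0 = of_int m * 2 * pi"
      using cos_one_2pi_int[of "x - x0"] by (auto simp: complex_eq_iff)
    have "\<bar>x - x0\<bar> < 2 * pi" using that(1) x0 by auto
    then have "\<bar>of_int m\<bar> * (2 * pi) < 1 * (2 * pi)" unfolding m by (simp add: abs_mult)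
    then have "\<bar>of_int m :: real\<bar> < 1" by (subst (asm) mult_less_cancel_right) auto
    then have "m = 0" by linarith
    then show False using m that(2) by simp
  qed
  \<comment> \<open>The value at \<open>x0\<close> is the limit of the quotient, which makes \<open>q\<close> continuous.\<close>
  define q where "q x = (if x = x0 then g' / (\<i> * cis x0) else (g x - g x0) / (cis x - cis x0))" for x
  have qm [measurable]: "q \<in> borel_measurable borel"
    unfolding q_def using g by (intro measurable_If) (auto intro!: borel_measurable_divide borel_measurable_diff simp: cis_measurable[of 1, simplified])
  have "continuous_on {-pi..pi} q"
    unfolding continuous_on_eq_continuous_within
  proof
    fix x assume x: "x \<in> {-pi..pi}"
    show "continuous (at x within {-pi..pi}) q"
    proof (cases "x = x0")
      case True
      have "((\<lambda>y. ((g y - g x0) / of_real (y - x0)) / ((cis y - cis x0) / of_real (y - x0))) \<longlongrightarrow> g' / (\<i> * cis x0)) (at x0)"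
        using has_vector_derivative_quotient[OF diff] has_vector_derivative_quotient[OF cis_has_vector_derivative[of 1 x0 UNIV]]
        by (intro tendsto_divide) simp_all
      moreover have "\<forall>\<^sub>F y in at x0. ((g y - g x0) / of_real (y - x0)) / ((cis y - cis x0) / of_real (y - x0)) = q y"
        by (auto simp: q_def eventually_at_filter)
      ultimately have "(q \<longlongrightarrow> g' / (\<i> * cis x0)) (at x0)" by (rule Lim_transform_eventually)
      then have "(q \<longlongrightarrow> q x0) (at x0)" by (simp add: q_def)
      then show ?thesis
        unfolding True continuous_within by (rule tendsto_within_subset) simp
    next
      case False
      have "continuous (at x within {-pi..pi}) cis"
        using continuous_on_cis[OF continuous_on_id, of "{-pi..pi}"] x by (simp add: continuous_on_eq_continuous_within)
      then have "continuous (at x within {-pi..pi}) (\<lambda>x. (g x - g x0) / (cis x - cis x0))"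
        using cont x cis_inj[OF x False]
        by (intro continuous_intros) (auto simp: continuous_on_eq_continuous_within)
      moreover have "\<forall>\<^sub>F y in at x within {-pi..pi}. q y = (g y - g x0) / (cis y - cis x0)"
        using False by (auto simp: q_def eventually_at dist_commute intro!: exI[of _ "dist x x0"])
      ultimately show ?thesis
        unfolding continuous_within using False
        by (subst tendsto_cong[where g = "\<lambda>y. (g y - g x0) / (cis y - cis x0)"]) (auto simp: q_def)
    qed
  qed
  then have qsq: "sq_integrable circ q" using qm by (rule sq_integrable_continuous)
  have qint: "integrable circ (\<lambda>x. q x * cis (a * x))" for a
    by (intro integrable_mult_cis sq_integrable_imp_integrable[OF circ.finite_measure_axioms] qsq)
  have coeff: "fourier g k = (if k = 0 then g x0 else 0) + (fourier q (k - 1) - cis x0 * fourier q k)" for k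
  proof -
    have "fourier g k = (LINT x|circ. g x0 * cis (of_int (- k) * x) +
        (q x * cis (- of_int (k - 1) * x) - cis x0 * (q x * cis (- of_int k * x))))"
      unfolding fourier_def
    proof (rule integral_cong_AE)
      show "AE x in circ. g x * cis (- of_int k * x) = g x0 * cis (of_int (- k) * x) +
        (q x * cis (- of_int (k - 1) * x) - cis x0 * (q x * cis (- of_int k * x)))"
        using circ_AE_interval circ_AE_neq[of x0]
      proof eventually_elim
        case (elim x)
        have g_eq: "g x = g x0 + q x * (cis x - cis x0)" using cis_inj[OF elim] elim by (simp add: q_def)
        have cis_eq: "cis (- of_int (k - 1) * x) = cis x * cis (- of_int k * x)"
          by (simp add: cis_mult algebra_simps)
        show ?case unfolding g_eq cis_eq by (simp add: algebra_simps)
      qed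
    qed measurable
    also have "\<dots> = g x0 * (LINT x|circ. cis (of_int (- k) * x)) + (fourier q (k - 1) - cis x0 * fourier q k)"
      using qint[of "- of_int (k - 1)"] qint[of "- of_int k"]
        sq_integrable_imp_integrable[OF circ.finite_measure_axioms sq_integrable_cis, of "of_int (- k)"]
      unfolding fourier_def by (simp del: of_int_diff of_int_minus)
    also have "\<dots> = (if k = 0 then g x0 else 0) + (fourier q (k - 1) - cis x0 * fourier q k)"
      unfolding circ_integral_cis by simp
    finally show ?thesis .
  qed
  have partial: "(\<Sum>k\<in>{- int N..int N}. fourier g k * cis (of_int k * x0))
     = g x0 + cis (- real N * x0) * fourier q (- int (Suc N)) - cis (real (Suc N) * x0) * fourier q (int N)" for N
  proof (induction N)
    case 0
    then show ?case by (simp add: coeff)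
  next
    case (Suc N)
    have "{- int (Suc N)..int (Suc N)} = insert (- int (Suc N)) (insert (int (Suc N)) {- int N..int N})" by auto
    then have "(\<Sum>k\<in>{- int (Suc N)..int (Suc N)}. fourier g k * cis (of_int k * x0))
      = fourier g (- int (Suc N)) * cis (- real (Suc N) * x0) + (fourier g (int (Suc N)) * cis (real (Suc N) * x0)
        + (\<Sum>k\<in>{- int N..int N}. fourier g k * cis (of_int k * x0)))"
      by simp
    also have "fourier g (- int (Suc N)) = fourier q (- int (Suc (Suc N))) - cis x0 * fourier q (- int (Suc N))"
      by (simp add: coeff)
    also have "fourier g (int (Suc N)) = fourier q (int N) - cis x0 * fourier q (int (Suc N))"
      by (simp add: coeff)
    also note Suc.IH
    also have "cis (- real N * x0) = cis x0 * cis (- real (Suc N) * x0)"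
      by (simp add: cis_mult algebra_simps)
    finally have "(\<Sum>k\<in>{- int (Suc N)..int (Suc N)}. fourier g k * cis (of_int k * x0))
      = g x0 + cis (- real (Suc N) * x0) * fourier q (- int (Suc (Suc N)))
        - (cis x0 * cis (real (Suc N) * x0)) * fourier q (int (Suc N))"
      by (simp only: ring_distribs mult_ac add_ac diff_conv_add_uminus minus_add_distrib) (simp add: algebra_simps)
    also have "cis x0 * cis (real (Suc N) * x0) = cis (real (Suc (Suc N)) * x0)"
      by (simp add: cis_mult algebra_simps)
    finally show ?case .
  qed
  have "(\<lambda>N. cis (- real N * x0) * fourier q (- int (Suc N))) \<longlonglongrightarrow> 0"
  proof (rule tendsto_norm_zero_cancel)
    show "(\<lambda>N. cmod (cis (- real N * x0) * fourier q (- int (Suc N)))) \<longlonglongrightarrow> 0"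
      using tendsto_norm_zero[OF LIMSEQ_Suc[OF fourier_tendsto_0(2)[OF qsq]]] by (simp add: norm_mult)
  qed
  moreover have "(\<lambda>N. cis (real (Suc N) * x0) * fourier q (int N)) \<longlonglongrightarrow> 0"
  proof (rule tendsto_norm_zero_cancel)
    show "(\<lambda>N. cmod (cis (real (Suc N) * x0) * fourier q (int N))) \<longlonglongrightarrow> 0"
      using tendsto_norm_zero[OF fourier_tendsto_0(1)[OF qsq]] by (simp add: norm_mult)
  qed
  ultimately have "(\<lambda>N. g x0 + cis (- real N * x0) * fourier q (- int (Suc N)) - cis (real (Suc N) * x0) * fourier q (int N)) \<longlonglongrightarrow> g x0 + 0 - 0"
    by (intro tendsto_diff tendsto_add tendsto_const)
  then show ?thesis by (simp only: partial add_0_right diff_zero)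
qed

section \<open>Herglotz integrals and the logarithm of a boundary modulus\<close>

text \<open>
  For real \<open>g\<close> this is the holomorphic function on the disc whose real part is the Poisson integral of \<open>g\<close>.
\<close>
definition herglotz :: "(real \<Rightarrow> complex) \<Rightarrow> complex \<Rightarrow> complex" where
  "herglotz g z = (LINT x|circ. (cis x + z) / (cis x - z) * g x)"

lemma herglotz_kernel_bound:
  assumes "cmod z < 1"
  shows "cmod ((cis x + z) / (cis x - z)) \<le> 2 / (1 - cmod z)"
proof -
  have "cmod (cis x + z) \<le> 2" using norm_triangle_ineq[of "cis x" z] assms by simp
  moreover have "1 - cmod z \<le> cmod (cis x - z)" using norm_triangle_ineq2[of "cis x" z] by simp
  ultimately show ?thesis using assms unfolding norm_divide by (intro frac_le) auto
qed

lemma herglotz_kernel_measurable [measurable]: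
  "(\<lambda>x. (cis x + z) / (cis x - z)) \<in> borel_measurable borel"
  using cis_measurable[of 1] by simp

lemma herglotz_kernel_sums:
  assumes "cmod z < 1"
  shows "(\<lambda>k. (if k = 0 then 1 else 2) * cis (- real k * x) * z ^ k) sums ((cis x + z) / (cis x - z))"
proof -
  let ?w = "z * cis (- x)"
  have w: "cmod ?w < 1" using assms by (simp add: norm_mult)
  have "(\<lambda>k. 2 * ?w ^ k - (if k = 0 then 1 else 0)) sums (2 * (1 / (1 - ?w)) - 1)"
    using sums_single[of 0 "\<lambda>_. 1 :: complex"]
    by (intro sums_diff sums_mult geometric_sums w) simp
  also have "(\<lambda>k. 2 * ?w ^ k - (if k = 0 then 1 else 0)) = (\<lambda>k. (if k = 0 then 1 else 2) * cis (- real k * x) * z ^ k)"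
    by (auto simp: fun_eq_iff power_mult_distrib cis_power)
  also have "2 * (1 / (1 - ?w)) - 1 = (cis x + z) / (cis x - z)"
  proof -
    have nz: "1 - ?w \<noteq> 0" "cis x - z \<noteq> 0" using w assms by auto
    have c: "cis (- x) * cis x = 1" by (simp add: cis_mult)
    have "2 * (1 / (1 - ?w)) - 1 = (1 + ?w) / (1 - ?w)" using nz(1) by (simp add: field_simps)
    also have "\<dots> = ((1 + ?w) * cis x) / ((1 - ?w) * cis x)" by simp
    also have "\<dots> = (cis x + z) / (cis x - z)" using c by (simp add: algebra_simps)
    finally show ?thesis .
  qed
  finally show ?thesis .
qed

lemma herglotz_integrable:
  assumes g: "integrable circ g" and z: "cmod z < 1"
  shows "integrable circ (\<lambda>x. (cis x + z) / (cis x - z) * g x)"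
proof (rule Bochner_Integration.integrable_bound[OF integrable_mult_right[OF integrable_norm[OF g]]])
  show "(\<lambda>x. (cis x + z) / (cis x - z) * g x) \<in> borel_measurable circ"
    using borel_measurable_integrable[OF g] by measurable
  show "AE x in circ. norm ((cis x + z) / (cis x - z) * g x) \<le> norm (2 / (1 - cmod z) * norm (g x))"
    using z mult_right_mono[OF herglotz_kernel_bound[OF z]]
    by (intro AE_I2) (simp add: norm_mult abs_mult del: times_divide_eq_left times_divide_eq_right)
qed

text \<open>
  The kernel is \<open>1 + 2 \<Sum>k\<ge>1. z\<^sup>k e\<^sup>-\<^sup>i\<^sup>k\<^sup>x\<close>, which is integrated termwise.
\<close>
lemma herglotz_sums:
  assumes g: "integrable circ g" and z: "cmod z < 1"
  shows "(\<lambda>k. (if k = 0 then 1 else 2) * fourier g (int k) * z ^ k) sums herglotz g z"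
proof -
  let ?c = "\<lambda>k::nat. if k = 0 then 1 else 2 :: complex"
  have sums: "(\<lambda>k. LINT x|circ. ?c k * z ^ k * (g x * cis (- real k * x))) sums
      (LINT x|circ. (\<Sum>k. ?c k * z ^ k * (g x * cis (- real k * x))))"
  proof (rule sums_integral)
    show "integrable circ (\<lambda>x. ?c k * z ^ k * (g x * cis (- real k * x)))" for k
      by (intro integrable_mult_right integrable_mult_cis g)
    have s: "summable (\<lambda>k. cmod (?c k * z ^ k))"
    proof (rule summable_comparison_test'[where N = 0])
      show "summable (\<lambda>k. 2 * cmod z ^ k)" using z by (intro summable_mult summable_geometric) simp
    qed (auto simp: norm_mult norm_power)
    have eq: "norm (?c k * z ^ k * (g x * cis (- real k * x))) = cmod (?c k * z ^ k) * cmod (g x)" for k x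
      by (simp add: norm_mult)
    show "AE x in circ. summable (\<lambda>k. norm (?c k * z ^ k * (g x * cis (- real k * x))))"
      unfolding eq by (intro AE_I2 summable_mult2 s)
    show "summable (\<lambda>k. LINT x|circ. norm (?c k * z ^ k * (g x * cis (- real k * x))))"
      unfolding eq by (simp only: integral_mult_right_zero) (intro summable_mult2 s)
  qed
  have inner: "(\<Sum>k. ?c k * z ^ k * (g x * cis (- real k * x))) = (cis x + z) / (cis x - z) * g x" for x
    using sums_mult2[OF herglotz_kernel_sums[OF z, of x], of "g x"] by (simp add: sums_iff mult_ac)
  have coeff: "(LINT x|circ. ?c k * z ^ k * (g x * cis (- real k * x))) = ?c k * fourier g (int k) * z ^ k" for k
    by (simp only: integral_mult_right_zero fourier_def of_int_of_nat_eq) (simp only: mult_ac)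
  show ?thesis
    using sums unfolding inner coeff herglotz_def[symmetric] .
qed

lemma circ_integral_reflect:
  fixes g :: "real \<Rightarrow> complex"
  assumes "g \<in> borel_measurable borel"
  shows "(LINT x|circ. g (- x)) = (LINT x|circ. g x)"
proof -
  have m: "(\<lambda>x. g (- x)) \<in> borel_measurable borel" using assms by measurable
  have "(LINT x|lborel. indicator {-pi..pi} x *\<^sub>R g x) = (LINT x|lborel. indicator {-pi..pi} (- x) *\<^sub>R g (- x))"
    using lborel_integral_real_affine[of "-1" "\<lambda>x. indicator {-pi..pi} x *\<^sub>R g x" 0] by simp
  also have "\<dots> = (LINT x|lborel. indicator {-pi..pi} x *\<^sub>R g (- x))"
    by (intro Bochner_Integration.integral_cong) (auto simp: indicator_def)
  finally show ?thesis
    unfolding circ_integral(1)[OF assms] circ_integral(1)[OF m] set_lebesgue_integral_def by simp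
qed

text \<open>
  When the coefficients of \<open>p\<close> are real, the averaged function is the real part of \<open>p\<close> on the circle, and this is
  the Schwarz integral formula. Only \<open>p(e\<^sup>i\<^sup>x)\<close> contributes positive frequencies; both parts
  contribute half of \<open>p 0\<close>.
\<close>
lemma schwarz_formula:
  assumes p: "summable (\<lambda>k. cmod (p k))" and z: "cmod z < 1"
  shows "herglotz (\<lambda>x. (power_series p (cis x) + power_series p (cis (- x))) / 2) z = power_series p z"
proof -
  let ?P = "\<lambda>x. power_series p (cis x)" and ?Q = "\<lambda>x. power_series p (cis (- x))"
  have i: "integrable circ (\<lambda>x. power_series p (cis (a * x)))" for a
    by (intro sq_integrable_imp_integrable[OF circ.finite_measure_axioms] sq_integrable_power_series p)
  have iP: "integrable circ ?P" and iQ: "integrable circ ?Q" using i[of 1] i[of "-1"] by simp_all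
  have m: "(\<lambda>x. ?P x * cis (a * x)) \<in> borel_measurable borel" for a
  proof -
    have [measurable]: "?P \<in> borel_measurable borel" using power_series_cis_measurable(1)[OF p, of 1] by simp
    show ?thesis by measurable
  qed
  have fP: "fourier ?P (int k) = p k" for k
    using integral_power_series_cis[OF p, of "- int k"] by (simp add: fourier_def)
  have fQ: "fourier ?Q (int k) = (if k = 0 then p 0 else 0)" for k
  proof -
    have "fourier ?Q (int k) = (LINT x|circ. ?P (- x) * cis (real k * (- x)))" by (simp add: fourier_def)
    also have "\<dots> = (LINT x|circ. ?P x * cis (real k * x))"
      by (rule circ_integral_reflect) (rule m)
    finally show ?thesis using integral_power_series_cis[OF p, of "int k"] by simp
  qed
  let ?g = "\<lambda>x. (?P x + ?Q x) / 2"
  have ig: "integrable circ ?g" using iP iQ by simp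
  have fg: "fourier ?g (int k) = (fourier ?P (int k) + fourier ?Q (int k)) / 2" for k
    using integrable_mult_cis[OF iP, of "- real k"] integrable_mult_cis[OF iQ, of "- real k"]
    by (simp add: fourier_def ring_distribs add_divide_distrib)
  have "(if k = 0 then 1 else 2) * fourier ?g (int k) * z ^ k = p k * z ^ k" for k
    unfolding fg fP fQ by simp
  with herglotz_sums[OF ig z] have "(\<lambda>k. p k * z ^ k) sums herglotz ?g z" by simp
  then show ?thesis by (simp add: power_series_def sums_iff)
qed

text \<open>
  The boundary values of \<open>ln |1 - \<rho> z\<^sup>m|\<close>; the case of interest \<open>\<rho> = 1\<close> has logarithmic singularities and is
  reached as a limit \<open>\<rho> \<rightarrow> 1\<close>.
\<close>
definition log_modulus :: "nat \<Rightarrow> real \<Rightarrow> real \<Rightarrow> real" where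
  "log_modulus m \<rho> x = ln (cmod (1 - of_real \<rho> * cis (- (x * real m))))"

lemma log_modulus_measurable [measurable]: "log_modulus m \<rho> \<in> borel_measurable borel"
proof -
  have [measurable]: "(\<lambda>x. cis (- (x * real m))) \<in> borel_measurable borel"
    using cis_measurable[of "- real m"] by (simp add: mult.commute)
  show ?thesis unfolding log_modulus_def[abs_def] by measurable
qed

text \<open>
  For \<open>\<rho> < 1\<close> the logarithm of \<open>1 - \<rho> z\<^sup>m\<close> is holomorphic on a disc of radius \<open>\<rho>\<^sup>-\<^sup>1\<^sup>/\<^sup>m > 1\<close>, so the Schwarz
  formula applies.
\<close>
lemma herglotz_log_modulus_inside:
  assumes m: "m > 0" and \<rho>: "0 < \<rho>" "\<rho> < 1" and z: "cmod z < 1"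
  shows "herglotz (\<lambda>x. of_real (log_modulus m \<rho> x)) z = Ln (1 - of_real \<rho> * z ^ m)"
proof -
  define P where "P \<zeta> = Ln (1 - of_real \<rho> * \<zeta> ^ m)" for \<zeta> :: complex
  \<comment> \<open>The radius at which \<open>\<rho> \<zeta>\<^sup>m\<close> reaches modulus \<open>1\<close>.\<close>
  define R where "R = root m (1 / \<rho>)"
  have R: "R > 1" "R ^ m = 1 / \<rho>" using m \<rho> by (auto simp: R_def)
  have re: "Re (1 - of_real \<rho> * \<zeta> ^ m) > 0" if "cmod \<zeta> < R" for \<zeta> :: complex
  proof -
    have "cmod \<zeta> ^ m < R ^ m" using that m by (intro power_strict_mono) auto
    then have "cmod (of_real \<rho> * \<zeta> ^ m) < 1" using R \<rho> by (simp add: norm_mult norm_power field_simps)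
    then show ?thesis using complex_Re_le_cmod[of "of_real \<rho> * \<zeta> ^ m"] by simp
  qed
  have nonpos: "1 - of_real \<rho> * \<zeta> ^ m \<notin> \<real>\<^sub>\<le>\<^sub>0" if "cmod \<zeta> < R" for \<zeta> :: complex
    using re[OF that] by (auto simp: complex_nonpos_Reals_iff)
  have "P holomorphic_on ball 0 R"
    unfolding P_def using nonpos by (intro holomorphic_intros) auto
  then have "wiener P" by (rule wiener_holomorphic) (rule R(1))
  then obtain p where p: "summable (\<lambda>k. cmod (p k))" "\<And>z. cmod z \<le> 1 \<Longrightarrow> power_series p z = P z"
    by (rule wienerE) (rule that)
  have bd: "(power_series p (cis x) + power_series p (cis (- x))) / 2 = of_real (log_modulus m \<rho> x)" for x
  proof -
    have np: "1 - of_real \<rho> * cis (- x) ^ m \<notin> \<real>\<^sub>\<le>\<^sub>0" using R by (intro nonpos) simp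
    have "P (cis x) = cnj (P (cis (- x)))"
      unfolding P_def cnj_Ln[OF np] by (simp add: cis_cnj)
    then have "P (cis x) + P (cis (- x)) = of_real (2 * Re (P (cis (- x))))"
      by (simp add: complex_eq_iff)
    also have "Re (P (cis (- x))) = log_modulus m \<rho> x"
      unfolding P_def log_modulus_def using np
      by (subst Re_Ln) (auto simp: cis_power mult.commute)
    finally show ?thesis by (simp add: p(2))
  qed
  from schwarz_formula[OF p(1) z] show ?thesis
    unfolding bd using z by (simp add: p(2) P_def)
qed

text \<open>
  By the triangle inequality, since the distance of \<open>\<rho> w\<close> from the circle, which is \<open>1 - \<rho>\<close>, is at most
  its distance from \<open>1\<close>. The bound is uniform in \<open>\<rho>\<close> and provides the dominating functions below.
\<close>
lemma one_minus_scaled_ge: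
  assumes "cmod w = 1" "0 \<le> \<rho>" "\<rho> \<le> 1"
  shows "cmod (1 - w) \<le> 2 * cmod (1 - of_real \<rho> * w)"
proof -
  have "1 - w = (1 - of_real \<rho> * w) - of_real (1 - \<rho>) * w" by (simp add: algebra_simps)
  then have "cmod (1 - w) \<le> cmod (1 - of_real \<rho> * w) + cmod (of_real (1 - \<rho>) * w)"
    by (metis norm_triangle_ineq4)
  also have "cmod (of_real (1 - \<rho>) * w) = 1 - \<rho>" using assms by (simp only: norm_mult norm_of_real) simp
  also have "1 - \<rho> \<le> cmod (1 - of_real \<rho> * w)"
    using norm_triangle_ineq2[of 1 "of_real \<rho> * w"] assms by (simp add: norm_mult)
  finally show ?thesis by simp
qed

lemma log_modulus_bounds:
  assumes \<rho>: "0 < \<rho>" "\<rho> \<le> 1" and nz: "cis (- (x * real m)) \<noteq> 1"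
  shows "log_modulus m \<rho> x \<le> ln 2" "log_modulus m 1 x - ln 2 \<le> log_modulus m \<rho> x"
proof -
  let ?w = "cis (- (x * real m))"
  have ge: "cmod (1 - ?w) \<le> 2 * cmod (1 - of_real \<rho> * ?w)"
    by (rule one_minus_scaled_ge) (use \<rho> in auto)
  have pos: "0 < cmod (1 - ?w)" using nz by simp
  then have pos': "0 < cmod (1 - of_real \<rho> * ?w)" using ge by linarith
  have "cmod (1 - of_real \<rho> * ?w) \<le> 2"
    using norm_triangle_ineq4[of 1 "of_real \<rho> * ?w"] \<rho> by (simp add: norm_mult)
  then show "log_modulus m \<rho> x \<le> ln 2" unfolding log_modulus_def using pos' by simp
  have "ln (cmod (1 - ?w)) \<le> ln (2 * cmod (1 - of_real \<rho> * ?w))" using ge pos pos' by simp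
  then show "log_modulus m 1 x - ln 2 \<le> log_modulus m \<rho> x"
    unfolding log_modulus_def using pos' by (simp add: ln_mult)
qed

lemma cis_eq_1_AE:
  assumes "m > 0"
  shows "AE x in lborel. cis (- (x * real m)) \<noteq> 1"
proof (rule AE_I')
  let ?S = "range (\<lambda>j::int. - (of_int j * 2 * pi / real m))"
  show "?S \<in> null_sets lborel" by (intro countable_imp_null_set_lborel) simp
  show "{x \<in> space lborel. \<not> cis (- (x * real m)) \<noteq> 1} \<subseteq> ?S"
  proof
    fix x assume "x \<in> {x \<in> space lborel. \<not> cis (- (x * real m)) \<noteq> 1}"
    then have "cis (- (x * real m)) = 1" by simp
    then have "cos (- (x * real m)) = 1" by (metis cis.sel(1) one_complex.sel(1))
    then obtain j :: int where "- (x * real m) = of_int j * 2 * pi" using cos_one_2pi_int by blast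
    then have "x = - (of_int j * 2 * pi / real m)" using assms by (simp add: field_simps)
    then show "x \<in> ?S" by blast
  qed
qed

lemma cis_eq_1_AE_circ: "m > 0 \<Longrightarrow> AE x in circ. cis (- (x * real m)) \<noteq> 1"
  using cis_eq_1_AE[of m] by (auto simp: circ_AE elim: eventually_mono)

text \<open>
  The radii \<open>\<rho>\<close> along which the boundary is approached.
\<close>
definition approach :: "nat \<Rightarrow> real" where "approach j = real (Suc j) / real (Suc (Suc j))"

lemma approach: "0 < approach j" "approach j < 1" "approach \<longlonglongrightarrow> 1"
proof -
  show "0 < approach j" "approach j < 1" by (simp_all add: approach_def)
  have "(\<lambda>j. real j / real (Suc j)) \<longlonglongrightarrow> 1" by (rule LIMSEQ_n_over_Suc_n)
  from LIMSEQ_Suc[OF this] show "approach \<longlonglongrightarrow> 1" by (simp add: approach_def[abs_def])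
qed

lemma log_modulus_tendsto:
  assumes "cis (- (x * real m)) \<noteq> 1"
  shows "(\<lambda>j. log_modulus m (approach j) x) \<longlonglongrightarrow> log_modulus m 1 x"
proof -
  have "(\<lambda>j. ln (cmod (1 - of_real (approach j) * cis (- (x * real m))))) \<longlonglongrightarrow> ln (cmod (1 - of_real 1 * cis (- (x * real m))))"
    using assms by (intro tendsto_intros approach) auto
  then show ?thesis by (simp add: log_modulus_def)
qed

text \<open>
  The functions \<open>ln 2 - ln |1 - \<rho> e\<^sup>-\<^sup>i\<^sup>m\<^sup>x|\<close> are nonnegative and all have mean \<open>ln 2\<close>, because
  \<open>Ln (1 - \<rho> z\<^sup>m)\<close> vanishes at \<open>0\<close>. Fatou's lemma bounds the integral of their limit,
  without any local analysis of the singularities.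
\<close>
lemma integrable_log_modulus:
  assumes m: "m > 0"
  shows "integrable circ (log_modulus m 1)"
proof -
  let ?h = "\<lambda>j x. ln 2 - log_modulus m (approach j) x"
  have inside: "integrable circ (log_modulus m (approach j))" for j
  proof (rule circ.integrable_const_bound[where B = "\<bar>ln (1 - approach j)\<bar> + ln 2"])
    show "AE x in circ. norm (log_modulus m (approach j) x) \<le> \<bar>ln (1 - approach j)\<bar> + ln 2"
      using cis_eq_1_AE_circ[OF m]
    proof eventually_elim
      case (elim x)
      have "1 - approach j \<le> cmod (1 - of_real (approach j) * cis (- (x * real m)))"
        using norm_triangle_ineq2[of 1 "of_real (approach j) * cis (- (x * real m))"] approach(1,2)[of j]
        by (simp add: norm_mult)
      then have "ln (1 - approach j) \<le> log_modulus m (approach j) x"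
        unfolding log_modulus_def using approach(2)[of j] by (subst ln_le_cancel_iff) auto
      moreover have "log_modulus m (approach j) x \<le> ln 2"
        using log_modulus_bounds(1)[of "approach j" x m] approach(1,2)[of j] elim by simp
      moreover have "0 \<le> ln (2::real)" by simp
      ultimately show ?case unfolding real_norm_def by arith
    qed
  qed measurable
  have "complex_of_real (LINT x|circ. log_modulus m (approach j) x) = 0" for j
  proof -
    have "complex_of_real (LINT x|circ. log_modulus m (approach j) x)
        = herglotz (\<lambda>x. of_real (log_modulus m (approach j) x)) 0"
      by (simp add: herglotz_def)
    also have "\<dots> = 0" using herglotz_log_modulus_inside[OF m approach(1,2), of 0 j] m by (simp add: power_0_left)
    finally show ?thesis .
  qed
  then have zero: "(LINT x|circ. log_modulus m (approach j) x) = 0" for j by simp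
  have "(\<integral>\<^sup>+x. ennreal (ln 2 - log_modulus m 1 x) \<partial>circ) = (\<integral>\<^sup>+x. liminf (\<lambda>j. ennreal (?h j x)) \<partial>circ)"
  proof (rule nn_integral_cong_AE)
    show "AE x in circ. ennreal (ln 2 - log_modulus m 1 x) = liminf (\<lambda>j. ennreal (?h j x))"
      using cis_eq_1_AE_circ[OF m]
    proof eventually_elim
      case (elim x)
      have "(\<lambda>j. ennreal (?h j x)) \<longlonglongrightarrow> ennreal (ln 2 - log_modulus m 1 x)"
        by (intro tendsto_ennrealI tendsto_intros log_modulus_tendsto elim)
      then show ?case by (rule lim_imp_Liminf[OF trivial_limit_sequentially, symmetric])
    qed
  qed
  also have "\<dots> \<le> liminf (\<lambda>j. \<integral>\<^sup>+x. ennreal (?h j x) \<partial>circ)"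
    by (rule nn_integral_liminf) measurable
  also have "(\<lambda>j. \<integral>\<^sup>+x. ennreal (?h j x) \<partial>circ) = (\<lambda>j. ennreal (ln 2))"
  proof
    fix j
    have "(\<integral>\<^sup>+x. ennreal (?h j x) \<partial>circ) = ennreal (LINT x|circ. ?h j x)"
    proof (rule nn_integral_eq_integral)
      show "integrable circ (?h j)" using inside by simp
      show "AE x in circ. 0 \<le> ?h j x"
        using cis_eq_1_AE_circ[OF m]
        by eventually_elim (use log_modulus_bounds(1) approach(1,2)[of j] in auto)
    qed
    also have "(LINT x|circ. ?h j x) = ln 2" using inside[of j] zero[of j] by (simp add: circ.prob_space[simplified])
    finally show "(\<integral>\<^sup>+x. ennreal (?h j x) \<partial>circ) = ennreal (ln 2)" .
  qed
  also have "liminf (\<lambda>j::nat. ennreal (ln 2)) = ennreal (ln 2)" by (simp add: Liminf_const)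
  finally have le: "(\<integral>\<^sup>+x. ennreal (ln 2 - log_modulus m 1 x) \<partial>circ) \<le> ennreal (ln 2)" .
  have "integrable circ (\<lambda>x. ln 2 - log_modulus m 1 x)"
  proof (rule integrableI_nonneg)
    show "AE x in circ. 0 \<le> ln 2 - log_modulus m 1 x"
      using cis_eq_1_AE_circ[OF m] by eventually_elim (use log_modulus_bounds(1)[of 1] in auto)
  qed (use le in \<open>auto intro: le_less_trans\<close>)
  from Bochner_Integration.integrable_diff[OF _ this, of "\<lambda>_. ln 2"] show ?thesis by simp
qed

text \<open>
  The integrands for \<open>\<rho> < 1\<close> are dominated by a multiple of \<open>2 ln 2 + |ln |1 - e\<^sup>-\<^sup>i\<^sup>m\<^sup>x||\<close>. Exponentiating before the
  limit avoids the question of the branch of the logarithm.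
\<close>
lemma exp_herglotz_log_modulus:
  assumes m: "m > 0" and z: "cmod z < 1"
  shows "exp (herglotz (\<lambda>x. of_real (log_modulus m 1 x)) z) = 1 - z ^ m"
proof -
  let ?H = "\<lambda>x. (cis x + z) / (cis x - z)"
  have lim: "(\<lambda>j. herglotz (\<lambda>x. of_real (log_modulus m (approach j) x)) z) \<longlonglongrightarrow> herglotz (\<lambda>x. of_real (log_modulus m 1 x)) z"
    unfolding herglotz_def
  proof (rule integral_dominated_convergence[where w = "\<lambda>x. 2 / (1 - cmod z) * (2 * ln 2 + \<bar>log_modulus m 1 x\<bar>)"])
    show "integrable circ (\<lambda>x. 2 / (1 - cmod z) * (2 * ln 2 + \<bar>log_modulus m 1 x\<bar>))"
      using integrable_log_modulus[OF m] by (intro integrable_mult_right) simp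
    show "AE x in circ. (\<lambda>j. ?H x * of_real (log_modulus m (approach j) x)) \<longlonglongrightarrow> ?H x * of_real (log_modulus m 1 x)"
      using cis_eq_1_AE_circ[OF m]
      by eventually_elim (intro tendsto_intros log_modulus_tendsto)
    show "AE x in circ. norm (?H x * of_real (log_modulus m (approach j) x)) \<le> 2 / (1 - cmod z) * (2 * ln 2 + \<bar>log_modulus m 1 x\<bar>)" for j
      using cis_eq_1_AE_circ[OF m]
    proof eventually_elim
      case (elim x)
      have "\<bar>log_modulus m (approach j) x\<bar> \<le> 2 * ln 2 + \<bar>log_modulus m 1 x\<bar>"
      proof -
        have "log_modulus m (approach j) x \<le> ln 2" "log_modulus m 1 x - ln 2 \<le> log_modulus m (approach j) x"
          using log_modulus_bounds[of "approach j" x m] approach(1,2)[of j] elim by simp_all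
        moreover have "0 \<le> ln (2::real)" by simp
        ultimately show ?thesis by arith
      qed
      then show ?case
        using herglotz_kernel_bound[OF z, of x] z unfolding norm_mult norm_of_real by (intro mult_mono) auto
    qed
  qed measurable
  have "(\<lambda>j. exp (herglotz (\<lambda>x. of_real (log_modulus m (approach j) x)) z)) \<longlonglongrightarrow> exp (herglotz (\<lambda>x. of_real (log_modulus m 1 x)) z)"
    by (intro tendsto_intros lim)
  moreover have "exp (herglotz (\<lambda>x. of_real (log_modulus m (approach j) x)) z) = 1 - of_real (approach j) * z ^ m" for j
  proof -
    have "cmod (z ^ m) \<le> 1" using z by (simp add: norm_power power_le_one)
    have "cmod (of_real (approach j) * z ^ m) = approach j * cmod (z ^ m)"
      using approach(1)[of j] by (simp add: norm_mult)
    also have "\<dots> \<le> approach j * 1" by (rule mult_left_mono) (use \<open>cmod (z ^ m) \<le> 1\<close> approach(1)[of j] in auto)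
    also have "\<dots> < 1" using approach(2) by simp
    finally have "cmod (of_real (approach j) * z ^ m) < 1" .
    then have "1 - of_real (approach j) * z ^ m \<noteq> 0" by auto
    then show ?thesis by (simp add: herglotz_log_modulus_inside[OF m approach(1,2) z])
  qed
  moreover have "(\<lambda>j. 1 - of_real (approach j) * z ^ m) \<longlonglongrightarrow> 1 - of_real 1 * z ^ m"
    by (intro tendsto_intros approach)
  ultimately show ?thesis by (simp add: LIMSEQ_unique)
qed

section \<open>The factor with boundary modulus sin(x/2)/(x/2)\<close>

text \<open>
  The logarithm of \<open>sin(x/2) / (x/2)\<close>, the quotient of \<open>|1 - e\<^sup>-\<^sup>i\<^sup>x|\<close> and \<open>|x|\<close>.
\<close>
definition log_sinc :: "real \<Rightarrow> real" where
  "log_sinc x = (if x = 0 then 0 else ln (2 * sin (x / 2) / x))"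

definition log_sinc_deriv :: "real \<Rightarrow> real" where
  "log_sinc_deriv x = (if x = 0 then 0 else cos (x / 2) / (2 * sin (x / 2)) - 1 / x)"

lemma log_sinc_measurable [measurable]: "log_sinc \<in> borel_measurable borel" 
  unfolding log_sinc_def[abs_def] by measurable

lemma log_sinc_deriv_measurable [measurable]: "log_sinc_deriv \<in> borel_measurable borel"
  unfolding log_sinc_deriv_def[abs_def] by measurable

lemma sin_half_pos:
  assumes "x \<in> {-pi..pi}" "x \<noteq> 0"
  shows "sin (x / 2) \<noteq> 0" "0 < 2 * sin (x / 2) / x"
proof -
  have "0 < 2 * sin (x / 2) / x"
  proof (cases "x > 0")
    case True
    then have "0 < sin (x / 2)" using assms by (intro sin_gt_zero) auto
    then show ?thesis using True by simp
  next
    case False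
    then have "0 < sin (- (x / 2))" using assms by (intro sin_gt_zero) auto
    then have "sin (x / 2) < 0" by simp
    then show ?thesis using False assms by (simp add: divide_neg_neg)
  qed
  then show "sin (x / 2) \<noteq> 0" "0 < 2 * sin (x / 2) / x" by auto
qed

lemma cmod_one_minus_cis: "cmod (1 - cis y) = 2 * \<bar>sin (y / 2)\<bar>"
proof (rule power2_eq_imp_eq)
  have "(cmod (1 - cis y))\<^sup>2 = 1 - 2 * cos y + ((cos y)\<^sup>2 + (sin y)\<^sup>2)"
    by (simp add: cmod_power2 power2_diff)
  also have "\<dots> = 2 * (1 - cos y)" by (simp add: sin_cos_squared_add2)
  also have "cos y = 1 - 2 * (sin (y / 2))\<^sup>2" using cos_double_sin[of "y / 2"] by simp
  finally show "(cmod (1 - cis y))\<^sup>2 = (2 * \<bar>sin (y / 2)\<bar>)\<^sup>2" by (simp add: power_mult_distrib)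
qed auto

lemma log_sinc_eq:
  assumes "x \<in> {-pi..pi}" "x \<noteq> 0"
  shows "log_sinc x = log_modulus 1 1 x - ln \<bar>x\<bar>"
proof -
  have "log_modulus 1 1 x - ln \<bar>x\<bar> = ln (2 * \<bar>sin (x / 2)\<bar> / \<bar>x\<bar>)"
    using sin_half_pos(1)[OF assms] assms by (simp add: log_modulus_def cmod_one_minus_cis ln_div)
  also have "2 * \<bar>sin (x / 2)\<bar> / \<bar>x\<bar> = \<bar>2 * sin (x / 2) / x\<bar>" by (simp add: abs_mult)
  also have "\<dots> = 2 * sin (x / 2) / x" by (rule abs_of_pos[OF sin_half_pos(2)[OF assms]])
  finally show ?thesis using assms by (simp add: log_sinc_def)
qed

lemma log_sinc_even: "log_sinc (- x) = log_sinc x"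
  by (simp add: log_sinc_def)

lemma log_sinc_has_derivative:
  assumes "x \<in> {-pi..pi}" "x \<noteq> 0"
  shows "(log_sinc has_field_derivative log_sinc_deriv x) (at x)"
proof (rule has_field_derivative_transform_within_open[where S = "- {0}"])
  note pos = sin_half_pos[OF assms]
  have "((\<lambda>y. ln (2 * sin (y / 2) / y)) has_field_derivative
      ((cos (x / 2) * x - 2 * sin (x / 2)) / (x * x)) / (2 * sin (x / 2) / x)) (at x)"
    using pos assms(2) by (auto intro!: derivative_eq_intros)
  also have "((cos (x / 2) * x - 2 * sin (x / 2)) / (x * x)) / (2 * sin (x / 2) / x) = log_sinc_deriv x"
    using pos(1) assms(2) by (simp add: log_sinc_deriv_def field_simps)
  finally show "((\<lambda>y. ln (2 * sin (y / 2) / y)) has_field_derivative log_sinc_deriv x) (at x)" .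
qed (use assms in \<open>auto simp: log_sinc_def\<close>)

lemma log_sinc_continuous: "continuous_on {-pi..pi} log_sinc"
proof (rule continuous_at_imp_continuous_on, rule ballI)
  fix x :: real assume x: "x \<in> {-pi..pi}"
  show "isCont log_sinc x"
  proof (cases "x = 0")
    case True
    have "((\<lambda>x. ln (2 * sin (x / 2) / x)) \<longlongrightarrow> 0) (at_right (0::real))" by real_asymp
    moreover have "((\<lambda>x. ln (2 * sin (x / 2) / x)) \<longlongrightarrow> 0) (at_left (0::real))" by real_asymp
    ultimately have "((\<lambda>x. ln (2 * sin (x / 2) / x)) \<longlongrightarrow> 0) (at (0::real))"
      by (simp add: filterlim_split_at)
    moreover have "\<forall>\<^sub>F x in at (0::real). ln (2 * sin (x / 2) / x) = log_sinc x"
      by (auto simp: log_sinc_def eventually_at_filter)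
    ultimately have "(log_sinc \<longlongrightarrow> 0) (at 0)" by (rule Lim_transform_eventually)
    then show ?thesis unfolding True isCont_def by (simp add: log_sinc_def)
  next
    case False
    then show ?thesis using log_sinc_has_derivative[OF x] DERIV_isCont by blast
  qed
qed

lemma log_sinc_deriv_continuous: "continuous_on {-pi..pi} log_sinc_deriv"
proof (rule continuous_at_imp_continuous_on, rule ballI)
  fix x :: real assume x: "x \<in> {-pi..pi}"
  have ev: "\<forall>\<^sub>F y in at x. cos (y / 2) / (2 * sin (y / 2)) - 1 / y = log_sinc_deriv y"
  proof -
    have "\<forall>\<^sub>F y in at x. y \<noteq> 0"
      by (cases "x = 0") (auto simp: eventually_at_filter eventually_neq_at_within intro: eventually_mono[OF t1_space_nhds])
    then show ?thesis by eventually_elim (simp add: log_sinc_deriv_def)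
  qed
  show "isCont log_sinc_deriv x"
  proof (cases "x = 0")
    case True
    have "((\<lambda>x. cos (x / 2) / (2 * sin (x / 2)) - 1 / x) \<longlongrightarrow> 0) (at_right (0::real))" by real_asymp
    moreover have "((\<lambda>x. cos (x / 2) / (2 * sin (x / 2)) - 1 / x) \<longlongrightarrow> 0) (at_left (0::real))" by real_asymp
    ultimately have "((\<lambda>x. cos (x / 2) / (2 * sin (x / 2)) - 1 / x) \<longlongrightarrow> 0) (at x)"
      unfolding True by (simp add: filterlim_split_at)
    then have "(log_sinc_deriv \<longlongrightarrow> 0) (at x)" using ev by (rule Lim_transform_eventually)
    then show ?thesis unfolding isCont_def by (simp add: True log_sinc_deriv_def)
  next
    case False
    have "((\<lambda>y. cos (y / 2) / (2 * sin (y / 2)) - 1 / y) \<longlongrightarrow> cos (x / 2) / (2 * sin (x / 2)) - 1 / x) (at x)"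
      using sin_half_pos(1)[OF x False] False by (intro tendsto_intros) auto
    then have "(log_sinc_deriv \<longlongrightarrow> cos (x / 2) / (2 * sin (x / 2)) - 1 / x) (at x)"
      using ev by (rule Lim_transform_eventually)
    then show ?thesis unfolding isCont_def using False by (simp add: log_sinc_deriv_def)
  qed
qed

abbreviation "clog_sinc \<equiv> \<lambda>x. complex_of_real (log_sinc x)"
abbreviation "clog_sinc_deriv \<equiv> \<lambda>x. complex_of_real (log_sinc_deriv x)"

lemma clog_sinc_sq: "sq_integrable circ clog_sinc" "sq_integrable circ clog_sinc_deriv"
  by (rule sq_integrable_continuous;
      auto intro!: continuous_on_of_real log_sinc_continuous log_sinc_deriv_continuous)+

text \<open>
  Integration by parts; the boundary terms cancel because \<open>log_sinc\<close> is even and \<open>k\<close> is an integer.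
\<close>
lemma fourier_log_sinc_deriv:
  assumes "k \<noteq> 0"
  shows "fourier clog_sinc_deriv k = \<i> * of_int k * fourier clog_sinc k"
proof -
  let ?a = "- real_of_int k"
  let ?G = "\<lambda>x. clog_sinc x * cis (?a * x)"
  let ?h = "\<lambda>x. clog_sinc_deriv x * cis (?a * x) - \<i> * of_int k * (clog_sinc x * cis (?a * x))"
  have cont: "continuous_on {-pi..pi} ?h"
    by (intro continuous_intros continuous_on_of_real log_sinc_continuous log_sinc_deriv_continuous)
  have "(?h has_integral (?G pi - ?G (-pi))) {-pi..pi}"
  proof (rule fundamental_theorem_of_calculus_interior_strong[where S = "{0}"])
    show "(?G has_vector_derivative ?h x) (at x)" if x: "x \<in> {-pi<..<pi} - {0}" for x
    proof -
      have "(clog_sinc has_vector_derivative clog_sinc_deriv x) (at x)"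
        using log_sinc_has_derivative[of x] x
        by (intro has_vector_derivative_of_real) (auto simp: has_real_derivative_iff_has_vector_derivative[symmetric])
      from has_vector_derivative_mult[OF this cis_has_vector_derivative[of ?a x UNIV]]
      show ?thesis by (simp add: algebra_simps)
    qed
    show "continuous_on {-pi..pi} ?G"
      by (intro continuous_intros continuous_on_of_real log_sinc_continuous)
  qed auto
  moreover have "?G pi = ?G (-pi)"
  proof -
    have "cis (?a * pi) = cis (?a * (-pi) + 2 * pi * of_int (-k))" by (simp add: algebra_simps)
    also have "\<dots> = cis (?a * (-pi)) * cis (2 * pi * of_int (-k))" by (simp only: cis_mult)
    also have "cis (2 * pi * of_int (-k)) = 1" by (rule cis_multiple_2pi) simp
    finally have "cis (?a * pi) = cis (?a * (-pi))" by (simp only: mult_1_right)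
    then show ?thesis by (simp only: log_sinc_even)
  qed
  ultimately have "integral {-pi..pi} ?h = 0" by (simp only: integral_unique right_minus_eq)
  then have "(LINT x:{-pi..pi}|lborel. ?h x) = 0"
    using set_borel_integral_eq_integral(2)[OF borel_integrable_atLeastAtMost'[OF cont]] by simp
  then have "(LINT x|circ. ?h x) = 0"
  proof (subst circ_integral(1))
    show "?h \<in> borel_measurable borel" by measurable
  qed simp
  then show ?thesis
    using integrable_mult_cis[OF sq_integrable_imp_integrable[OF circ.finite_measure_axioms clog_sinc_sq(1)], of ?a]
      integrable_mult_cis[OF sq_integrable_imp_integrable[OF circ.finite_measure_axioms clog_sinc_sq(2)], of ?a]
    by (simp add: fourier_def)
qed

text \<open>
  The coefficients are those of the derivative divided by \<open>i k\<close>. Both factors are square-summable.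
\<close>
lemma summable_fourier_log_sinc: "summable (\<lambda>k. cmod (fourier clog_sinc (int k)))"
proof (rule summable_comparison_test')
  show "summable (\<lambda>k. (cmod (fourier clog_sinc_deriv (int k)))\<^sup>2 + 1 / (real k)\<^sup>2)"
    using inverse_power_summable[of 2, where 'a = real]
    by (intro summable_add bessel_summable clog_sinc_sq) (simp add: inverse_eq_divide)
  fix k :: nat assume "1 \<le> k"
  then have k: "k > 0" by simp
  define d where "d = cmod (fourier clog_sinc_deriv (int k))"
  have "d = real k * cmod (fourier clog_sinc (int k))"
    using fourier_log_sinc_deriv[of "int k"] k by (simp add: d_def norm_mult)
  then have "cmod (fourier clog_sinc (int k)) = d * (1 / real k)" using k by simp
  also have "\<dots> \<le> d\<^sup>2 + (1 / real k)\<^sup>2"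
  proof -
    have "0 \<le> d * (1 / real k)" by (simp add: d_def)
    moreover have "2 * (d * (1 / real k)) \<le> d\<^sup>2 + (1 / real k)\<^sup>2"
      using sum_squares_bound[of d "1 / real k"] by (simp only: mult.assoc)
    ultimately show ?thesis by linarith
  qed
  finally show "norm (cmod (fourier clog_sinc (int k))) \<le> (cmod (fourier clog_sinc_deriv (int k)))\<^sup>2 + 1 / (real k)\<^sup>2"
    by (simp add: d_def power_divide)
qed

text \<open>
  The coefficients of the holomorphic function on the disc with boundary real part \<open>log_sinc\<close>.
\<close>
definition sinc_coeff :: "nat \<Rightarrow> complex" where
  "sinc_coeff k = (if k = 0 then 1 else 2) * fourier clog_sinc (int k)"

lemma summable_sinc_coeff: "summable (\<lambda>k. cmod (sinc_coeff k))"
  by (rule summable_comparison_test'[OF summable_mult[OF summable_fourier_log_sinc, of 2], where N = 0])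
    (auto simp: sinc_coeff_def norm_mult)

lemma power_series_sinc_coeff:
  assumes "cmod z < 1"
  shows "power_series sinc_coeff z = herglotz clog_sinc z"
  using herglotz_sums[OF sq_integrable_imp_integrable[OF circ.finite_measure_axioms clog_sinc_sq(1)] assms]
  by (simp add: power_series_def sinc_coeff_def sums_iff)

text \<open>
  By inversion, \<open>log_sinc x\<close> is the symmetric Fourier sum; as \<open>log_sinc\<close> is real, the terms \<open>k\<close> and \<open>-k\<close> are
  conjugate, and their sum is the real part of a term of the power series.
\<close>
lemma Re_power_series_sinc_coeff:
  assumes "x \<in> {-pi<..<pi}" "x \<noteq> 0"
  shows "Re (power_series sinc_coeff (cis x)) = log_sinc x"
proof -
  have "(clog_sinc has_vector_derivative clog_sinc_deriv x) (at x)"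
    using log_sinc_has_derivative[of x] assms
    by (intro has_vector_derivative_of_real) (auto simp: has_real_derivative_iff_has_vector_derivative[symmetric])
  then have inv: "(\<lambda>N. \<Sum>k\<in>{- int N..int N}. fourier clog_sinc k * cis (of_int k * x)) \<longlonglongrightarrow> clog_sinc x"
    by (intro fourier_inversion) (use assms in \<open>auto intro!: continuous_on_of_real log_sinc_continuous\<close>)
  have neg: "fourier clog_sinc (- k) = cnj (fourier clog_sinc k)" for k
    by (simp add: fourier_def cis_cnj flip: Bochner_Integration.integral_cnj)
  have partial: "(\<Sum>k\<in>{- int N..int N}. fourier clog_sinc k * cis (of_int k * x))
      = of_real (Re (\<Sum>k<Suc N. sinc_coeff k * cis x ^ k))" for N
  proof (induction N)
    case 0
    have "fourier clog_sinc 0 = cnj (fourier clog_sinc 0)" using neg[of 0] by simp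
    then show ?case by (simp add: sinc_coeff_def complex_eq_iff)
  next
    case (Suc N)
    have set: "{- int (Suc N)..int (Suc N)} = insert (- int (Suc N)) (insert (int (Suc N)) {- int N..int N})" by auto
    let ?t = "fourier clog_sinc (int (Suc N)) * cis (real (Suc N) * x)"
    have "fourier clog_sinc (- int (Suc N)) * cis (of_int (- int (Suc N)) * x) = cnj ?t"
    proof -
      have "cis (of_int (- int (Suc N)) * x) = cnj (cis (real (Suc N) * x))"
        by (simp add: cis_cnj algebra_simps)
      then show ?thesis by (simp only: neg complex_cnj_mult)
    qed
    then have "(\<Sum>k\<in>{- int (Suc N)..int (Suc N)}. fourier clog_sinc k * cis (of_int k * x))
       = cnj ?t + (?t + of_real (Re (\<Sum>k<Suc N. sinc_coeff k * cis x ^ k)))"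
      unfolding set using Suc.IH by (simp del: of_nat_Suc sum.lessThan_Suc)
    also have "cnj ?t + (?t + of_real (Re (\<Sum>k<Suc N. sinc_coeff k * cis x ^ k)))
       = of_real (2 * Re ?t + Re (\<Sum>k<Suc N. sinc_coeff k * cis x ^ k))"
      by (simp add: complex_eq_iff)
    also have "2 * Re ?t = Re (sinc_coeff (Suc N) * cis x ^ Suc N)"
      by (simp add: sinc_coeff_def cis_power del: power_Suc)
    finally show ?case by (simp add: add.commute del: power_Suc)
  qed
  have "(\<lambda>N. \<Sum>k<Suc N. sinc_coeff k * cis x ^ k) \<longlonglongrightarrow> power_series sinc_coeff (cis x)"
    by (rule LIMSEQ_Suc) (use abs_power_series(2)[OF summable_sinc_coeff, of "cis x"] in \<open>simp add: sums_def\<close>)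
  then have "(\<lambda>N. complex_of_real (Re (\<Sum>k<Suc N. sinc_coeff k * cis x ^ k))) \<longlonglongrightarrow> of_real (Re (power_series sinc_coeff (cis x)))"
    by (intro tendsto_of_real tendsto_Re)
  with inv have "clog_sinc x = complex_of_real (Re (power_series sinc_coeff (cis x)))"
    unfolding partial by (rule LIMSEQ_unique)
  then show ?thesis by simp
qed

section \<open>The moving average coefficients\<close>

text \<open>
  The integrand splits, almost everywhere, into the logarithms of \<open>|1 - e\<^sup>-\<^sup>i\<^sup>\<mu>\<^sup>x|\<close>, \<open>|1 - e\<^sup>-\<^sup>i\<^sup>x|\<close> and
  \<open>sin(x/2) / (x/2)\<close>.
\<close>
lemma w_factor_eq:
  assumes \<mu>: "\<mu> > 0" and z: "cmod z < 1"
  shows "w_factor n \<mu> z = ((1 - z ^ \<mu>) / (1 - z)) ^ n * exp (power_series sinc_coeff z) ^ n"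
proof -
  let ?H = "\<lambda>x. (cis x + z) / (cis x - z)"
  let ?L = "\<lambda>x. ln (cmod (1 - cis (- (x * real \<mu>))) ^ (2 * n) / x ^ (2 * n))"
  let ?lm = "\<lambda>m x. complex_of_real (log_modulus m 1 x)"
  have im: "integrable circ (\<lambda>x. ?H x * ?lm m x)" if "m > 0" for m
    by (intro herglotz_integrable[OF _ z] integrable_of_real integrable_log_modulus that)
  have isc: "integrable circ (\<lambda>x. ?H x * clog_sinc x)"
    by (intro herglotz_integrable[OF _ z] sq_integrable_imp_integrable[OF circ.finite_measure_axioms] clog_sinc_sq)
  have [measurable]: "(\<lambda>x. cis (- (x * real \<mu>))) \<in> borel_measurable borel"
    using cis_measurable[of "- real \<mu>"] by (simp add: mult.commute)
  have meas: "(\<lambda>x. ?H x * of_real (?L x)) \<in> borel_measurable borel" by measurable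
  have "(LINT x|circ. ?H x * of_real (?L x))
      = (LINT x|circ. of_nat (2 * n) * (?H x * ?lm \<mu> x - ?H x * ?lm 1 x + ?H x * clog_sinc x))"
  proof (rule integral_cong_AE)
    show "AE x in circ. ?H x * of_real (?L x) = of_nat (2 * n) * (?H x * ?lm \<mu> x - ?H x * ?lm 1 x + ?H x * clog_sinc x)"
      using circ_AE_interval circ_AE_neq[of 0] cis_eq_1_AE_circ[OF \<mu>]
    proof eventually_elim
      case (elim x)
      have "x ^ (2 * n) = \<bar>x\<bar> ^ (2 * n)" by (simp add: power_mult)
      then have "?L x = real (2 * n) * (ln (cmod (1 - cis (- (x * real \<mu>)))) - ln \<bar>x\<bar>)"
        using elim by (simp add: ln_div ln_realpow right_diff_distrib)
      also have "\<dots> = real (2 * n) * (log_modulus \<mu> 1 x - log_modulus 1 1 x + log_sinc x)"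
        using log_sinc_eq[OF elim(1,2)] by (simp add: log_modulus_def)
      finally have L: "?L x = real (2 * n) * (log_modulus \<mu> 1 x - log_modulus 1 1 x + log_sinc x)" .
      have alg: "h * complex_of_real (real (2 * n) * (a - b + c))
          = of_nat (2 * n) * (h * of_real a - h * of_real b + h * of_real c)" for h a b c
        by (simp add: algebra_simps)
      show ?case unfolding L by (rule alg)
    qed
    show "(\<lambda>x. ?H x * of_real (?L x)) \<in> borel_measurable circ" using meas by simp
  qed measurable
  also have "\<dots> = of_nat (2 * n) * (herglotz (?lm \<mu>) z - herglotz (?lm 1) z + herglotz clog_sinc z)"
    using im[OF \<mu>] im[of 1] isc by (simp add: herglotz_def)
  finally have int: "(LINT x|circ. ?H x * of_real (?L x)) = \<dots>" .
  have "(LINT x:{-pi..pi}|lborel. ?H x * of_real (?L x)) = of_real (2 * pi) * (LINT x|circ. ?H x * of_real (?L x))"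
    unfolding circ_integral(1)[OF meas] by (simp add: scaleR_conv_of_real)
  then have "1 / (4 * of_real pi) * (LINT x:{-pi..pi}|lborel. ?H x * of_real (?L x))
      = of_nat n * (herglotz (?lm \<mu>) z - herglotz (?lm 1) z + herglotz clog_sinc z)"
    unfolding int by simp
  then have "w_factor n \<mu> z = exp (herglotz (?lm \<mu>) z - herglotz (?lm 1) z + herglotz clog_sinc z) ^ n"
    unfolding w_factor_def by (simp only: exp_of_nat_mult)
  also have "exp (herglotz (?lm \<mu>) z - herglotz (?lm 1) z + herglotz clog_sinc z)
      = (1 - z ^ \<mu>) / (1 - z) * exp (power_series sinc_coeff z)"
    using exp_herglotz_log_modulus[OF \<mu> z] exp_herglotz_log_modulus[of 1, OF _ z]
    by (simp add: exp_add exp_diff power_series_sinc_coeff[OF z])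
  finally show ?thesis by (simp only: power_mult_distrib)
qed

lemma fps_expansion_coeffs:
  assumes "summable (\<lambda>k. cmod (c k))" "\<And>z. cmod z < 1 \<Longrightarrow> power_series c z = g z"
  shows "fps_nth (fps_expansion g 0) k = c k"
proof -
  have "g has_fps_expansion Abs_fps c"
  proof (rule has_fps_expansionI)
    have "\<forall>\<^sub>F z in nhds 0. z \<in> ball (0 :: complex) 1" by (intro eventually_nhds_in_open) auto
    then show "\<forall>\<^sub>F z in nhds 0. (\<lambda>k. fps_nth (Abs_fps c) k * z ^ k) sums g z"
    proof eventually_elim
      case (elim z)
      then show ?case using abs_power_series(2)[OF assms(1), of z] assms(2)[of z] by simp
    qed
  qed
  from fps_nth_fps_expansion[OF this, of k] show ?thesis by (simp add: fps_expansion_def)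
qed

text \<open>
  The quotient \<open>(1 - z\<^sup>\<mu>) / (1 - z)\<close> is a polynomial, so \<open>\<Phi>\<^sub>\<mu>\<close> lies in the Wiener algebra; its coefficients are
  determined by its values in the open disc, where the formula for \<open>w\<^sub>\<mu>\<close> makes sense.
\<close>
lemma phi_mu_power_series:
  assumes \<mu>: "\<mu> > 0" and R: "conv_radius \<phi> > 1" and nz: "\<And>z. cmod z \<le> 1 \<Longrightarrow> power_series \<phi> z \<noteq> 0"
  shows "summable (\<lambda>k. cmod (phi_mu n \<mu> \<phi> k))"
    and "cmod z \<le> 1 \<Longrightarrow> power_series (phi_mu n \<mu> \<phi>) z
       = (\<Sum>i<\<mu>. z ^ i) ^ n * exp (power_series sinc_coeff z) ^ n * power_series \<phi> z"
proof -
  let ?G = "\<lambda>z. (\<Sum>i<\<mu>. z ^ i) ^ n * exp (power_series sinc_coeff z) ^ n * power_series \<phi> z"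
  have sc: "wiener (power_series sinc_coeff)"
    unfolding wiener_def using summable_sinc_coeff by (intro exI[of _ sinc_coeff] conjI allI impI refl)
  have pol: "wiener (\<lambda>z. \<Sum>i<\<mu>. z ^ i)"
    by (rule wiener_holomorphic[where R = 2]) (auto intro!: holomorphic_intros)
  have "wiener ?G"
    by (rule wiener_mult[OF wiener_mult[OF wiener_power[OF pol] wiener_power[OF wiener_exp[OF sc]]]
          canonical_factor_wiener(1)[OF R nz]])
  then obtain c where c: "summable (\<lambda>k. cmod (c k))" "\<And>z. cmod z \<le> 1 \<Longrightarrow> power_series c z = ?G z"
    by (rule wienerE) (rule that)
  have "phi_mu n \<mu> \<phi> k = c k" for k
    unfolding phi_mu_def
  proof (rule fps_expansion_coeffs[OF c(1)])
    fix z :: complex assume z: "cmod z < 1"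
    then have "z \<noteq> 1" by auto
    then have "(1 - z ^ \<mu>) / (1 - z) = (\<Sum>i<\<mu>. z ^ i)" by (simp add: one_diff_power_eq)
    then show "power_series c z = w_factor n \<mu> z * power_series \<phi> z"
      using c(2)[of z] w_factor_eq[OF \<mu> z, of n] z by simp
  qed
  then have eq: "phi_mu n \<mu> \<phi> = c" by (rule ext)
  show "summable (\<lambda>k. cmod (phi_mu n \<mu> \<phi> k))" unfolding eq by (rule c)
  show "cmod z \<le> 1 \<Longrightarrow> power_series (phi_mu n \<mu> \<phi>) z = ?G z" unfolding eq by (rule c)
qed

text \<open>
  \<open>\<Phi>\<^sub>\<mu>\<close> may vanish on the circle, but only like the polynomial \<open>(1 - z\<^sup>\<mu>)\<^sup>n\<close>: up to this factor it is
  invertible in the Wiener algebra. This is how outerness of \<open>\<Phi>\<^sub>\<mu>\<close> will be used.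
\<close>
lemma phi_mu_quasi_inverse:
  assumes \<mu>: "\<mu> > 0" and R: "conv_radius \<phi> > 1" and nz: "\<And>z. cmod z \<le> 1 \<Longrightarrow> power_series \<phi> z \<noteq> 0"
  obtains G where "wiener G"
    "\<And>z. cmod z \<le> 1 \<Longrightarrow> power_series (phi_mu n \<mu> \<phi>) z * G z = (1 - z ^ \<mu>) ^ n"
proof -
  let ?G = "\<lambda>z. (1 - z) ^ n * (inverse (power_series \<phi> z) * exp ((-1) * power_series sinc_coeff z) ^ n)"
  have sc: "wiener (power_series sinc_coeff)"
    unfolding wiener_def using summable_sinc_coeff by (intro exI[of _ sinc_coeff] conjI allI impI refl)
  have pol: "wiener (\<lambda>z. (1 - z) ^ n)"
    by (rule wiener_holomorphic[where R = 2]) (auto intro!: holomorphic_intros)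
  have "wiener ?G"
    by (rule wiener_mult[OF pol wiener_mult[OF canonical_factor_wiener(2)[OF R nz]
          wiener_power[OF wiener_exp[OF wiener_mult[OF wiener_const sc]]]]])
  moreover have "power_series (phi_mu n \<mu> \<phi>) z * ?G z = (1 - z ^ \<mu>) ^ n" if z: "cmod z \<le> 1" for z
  proof -
    let ?S = "(\<Sum>i<\<mu>. z ^ i) ^ n" and ?E = "exp (power_series sinc_coeff z) ^ n"
      and ?E' = "exp ((-1) * power_series sinc_coeff z) ^ n" and ?F = "power_series \<phi> z"
    have "power_series (phi_mu n \<mu> \<phi>) z * ?G z = (?S * ?E * ?F) * ((1 - z) ^ n * (inverse ?F * ?E'))"
      by (simp only: phi_mu_power_series(2)[OF \<mu> R nz z])
    also have "\<dots> = ((1 - z) ^ n * ?S) * (?E * ?E') * (?F * inverse ?F)" by (simp only: mult_ac)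
    also have "(1 - z) ^ n * ?S = (1 - z ^ \<mu>) ^ n"
      by (simp add: one_diff_power_eq power_mult_distrib)
    also have "?E * ?E' = 1"
      by (simp add: power_mult_distrib[symmetric] exp_minus_inverse)
    also have "?F * inverse ?F = 1" using nz[OF z] by simp
    finally show ?thesis by simp
  qed
  ultimately show ?thesis by (rule that)
qed

text \<open>
  The square of this identity is \<open>|\<kappa>|\<^sup>2 f = |\<Phi>\<^sub>\<mu>|\<^sup>2\<close>. On the circle
  \<open>|1 - z| |1 + z + \<dots> + z\<^sup>\<mu>\<^sup>-\<^sup>1| = |1 - z\<^sup>\<mu>|\<close>, and \<open>|e\<^sup>S|\<close> replaces \<open>|1 - z|\<close> by \<open>|x|\<close>.
\<close>
lemma norm_increment_kernel:
  assumes \<mu>: "\<mu> > 0" and R: "conv_radius \<phi> > 1" and nz: "\<And>z. cmod z \<le> 1 \<Longrightarrow> power_series \<phi> z \<noteq> 0"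
    and x: "x \<in> {-pi<..<pi}" "x \<noteq> 0"
  shows "cmod (increment_kernel n \<mu> x) * cmod (power_series \<phi> (cis (- x)))
    = cmod (power_series (phi_mu n \<mu> \<phi>) (cis (- x)))"
proof -
  have "cmod (exp (power_series sinc_coeff (cis (- x)))) = exp (log_sinc (- x))"
    using Re_power_series_sinc_coeff[of "- x"] x by simp
  also have "\<dots> = 2 * sin (x / 2) / x" using sin_half_pos(2)[of x] x by (simp add: log_sinc_def)
  also have "\<dots> = \<bar>2 * sin (x / 2) / x\<bar>"
    by (rule abs_of_pos[OF sin_half_pos(2), symmetric]) (use x in auto)
  also have "\<dots> = cmod (1 - cis (- x)) / \<bar>x\<bar>"
    by (simp add: cmod_one_minus_cis abs_mult)
  finally have u: "cmod (exp (power_series sinc_coeff (cis (- x)))) = cmod (1 - cis (- x)) / \<bar>x\<bar>" .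
  have "cmod (1 - cis (- x)) * cmod (\<Sum>i<\<mu>. cis (- x) ^ i) = cmod (1 - cis (- x) ^ \<mu>)"
    by (simp add: one_diff_power_eq norm_mult)
  also have "cis (- x) ^ \<mu> = cis (- (real \<mu> * x))" by (simp add: cis_power)
  finally have "cmod (\<Sum>i<\<mu>. cis (- x) ^ i) * (cmod (1 - cis (- x)) / \<bar>x\<bar>) = cmod (1 - cis (- (real \<mu> * x))) / \<bar>x\<bar>"
    by (simp add: mult.commute)
  then have "cmod (\<Sum>i<\<mu>. cis (- x) ^ i) * cmod (exp (power_series sinc_coeff (cis (- x)))) = cmod (1 - cis (- (real \<mu> * x))) / \<bar>x\<bar>"
    unfolding u .
  then have "cmod (\<Sum>i<\<mu>. cis (- x) ^ i) ^ n * cmod (exp (power_series sinc_coeff (cis (- x)))) ^ n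
      = cmod (1 - cis (- (real \<mu> * x))) ^ n / \<bar>x\<bar> ^ n"
    by (metis power_mult_distrib power_divide)
  then show ?thesis
    using x(2) phi_mu_power_series(2)[OF \<mu> R nz, of "cis (- x)" n]
    by (simp only: norm_mult norm_power increment_kernel_def norm_divide norm_cis if_False norm_of_real norm_ii mult_1_left order_refl)
qed

lemma increment_kernel_measurable [measurable]: "increment_kernel n \<mu> \<in> borel_measurable borel"
proof -
  have [measurable]: "(\<lambda>x. cis (- (real \<mu> * x))) \<in> borel_measurable borel"
    using cis_measurable[of "- real \<mu>"] by simp
  show ?thesis unfolding increment_kernel_def[abs_def] by measurable
qed

lemma increment_kernel_bound: "cmod (increment_kernel n \<mu> x) \<le> real \<mu> ^ n"
proof (cases "x = 0")
  case False
  have "\<bar>sin (- (real \<mu> * x) / 2)\<bar> \<le> \<bar>- (real \<mu> * x) / 2\<bar>" by (rule abs_sin_x_le_abs_x)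
  then have "cmod (1 - cis (- (real \<mu> * x))) \<le> real \<mu> * \<bar>x\<bar>"
    by (simp add: cmod_one_minus_cis abs_mult)
  then have "cmod (1 - cis (- (real \<mu> * x))) / \<bar>x\<bar> \<le> real \<mu>" using False by (simp add: field_simps)
  then have "(cmod (1 - cis (- (real \<mu> * x))) / \<bar>x\<bar>) ^ n \<le> real \<mu> ^ n" by (intro power_mono) auto
  then show ?thesis using False by (simp add: increment_kernel_def norm_divide norm_power norm_mult power_divide)
qed (simp add: increment_kernel_def norm_power)

section \<open>The summation operator and the Hankel product\<close>

definition period_fps :: "nat \<Rightarrow> complex fps" where
  "period_fps \<mu> = Abs_fps (\<lambda>i. if \<mu> dvd i then 1 else 0)"

lemma d_coeff_period: "d_coeff n \<mu> k = fps_nth (period_fps \<mu> ^ n) k"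
  by (simp add: d_coeff_def period_fps_def)

lemma period_fps_inverse:
  assumes "\<mu> > 0"
  shows "period_fps \<mu> * (1 - fps_X ^ \<mu>) = 1"
proof (rule fps_ext)
  fix k
  have "fps_nth (period_fps \<mu> * (1 - fps_X ^ \<mu>)) k
      = fps_nth (period_fps \<mu>) k - (if k < \<mu> then 0 else fps_nth (period_fps \<mu>) (k - \<mu>))"
    by (simp add: right_diff_distrib fps_mult_fps_X_power_nonzero fps_X_power_mult_right_nth)
  also have "\<dots> = fps_nth 1 k"
  proof (cases "k < \<mu>")
    case True
    then have "\<mu> dvd k \<longleftrightarrow> k = 0" by (auto dest: dvd_imp_le)
    then show ?thesis using True by (simp add: period_fps_def)
  next
    case False
    then have "\<mu> dvd k \<longleftrightarrow> \<mu> dvd (k - \<mu>)" by (simp add: dvd_minus_self)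
    then show ?thesis using False assms by (simp add: period_fps_def)
  qed
  finally show "fps_nth (period_fps \<mu> * (1 - fps_X ^ \<mu>)) k = fps_nth 1 k" .
qed

lemma d_coeff_Suc_rec:
  assumes "\<mu> > 0"
  shows "d_coeff (Suc r) \<mu> k = d_coeff r \<mu> k + (if k < \<mu> then 0 else d_coeff (Suc r) \<mu> (k - \<mu>))"
proof -
  have "period_fps \<mu> ^ Suc r * (1 - fps_X ^ \<mu>) = period_fps \<mu> ^ r"
  proof -
    have "period_fps \<mu> ^ Suc r * (1 - fps_X ^ \<mu>) = period_fps \<mu> ^ r * (period_fps \<mu> * (1 - fps_X ^ \<mu>))"
      by (simp only: power_Suc mult_ac)
    then show ?thesis by (simp only: period_fps_inverse[OF assms] mult_1_right)
  qed
  then have "fps_nth (period_fps \<mu> ^ Suc r * (1 - fps_X ^ \<mu>)) k = d_coeff r \<mu> k"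
    by (simp only: d_coeff_period)
  moreover have "fps_nth (period_fps \<mu> ^ Suc r * (1 - fps_X ^ \<mu>)) k
      = d_coeff (Suc r) \<mu> k - (if k < \<mu> then 0 else d_coeff (Suc r) \<mu> (k - \<mu>))"
    unfolding d_coeff_period by (simp only: right_diff_distrib mult_1_right fps_sub_nth fps_X_power_mult_right_nth)
  ultimately show ?thesis by (simp add: algebra_simps)
qed

text \<open>
  The generating function satisfies \<open>(1 - X\<^sup>\<mu>) P\<^sup>r\<^sup>+\<^sup>1 = P\<^sup>r\<close> for \<open>P = 1 / (1 - X\<^sup>\<mu>)\<close>, which is Pascal's rule along
  the multiples of \<open>\<mu>\<close>.
\<close>
lemma d_coeff_eq:
  assumes \<mu>: "\<mu> > 0"
  shows "d_coeff (Suc r) \<mu> k = (if \<mu> dvd k then of_nat ((r + k div \<mu>) choose (k div \<mu>)) else 0)"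
proof (induction r arbitrary: k)
  case 0
  then show ?case by (simp add: d_coeff_period period_fps_def)
next
  case (Suc r)
  show ?case
  proof (induction k rule: less_induct)
    case (less k)
    show ?case
    proof (cases "k < \<mu>")
      case True
      then show ?thesis
        using d_coeff_Suc_rec[OF \<mu>, of "Suc r" k] Suc.IH[of k] by simp
    next
      case False
      have dvd: "\<mu> dvd k \<longleftrightarrow> \<mu> dvd (k - \<mu>)" using False by (simp add: dvd_minus_self)
      have "k div \<mu> = Suc ((k - \<mu>) div \<mu>)" using False \<mu> by (simp add: le_div_geq)
      then obtain i where i: "k div \<mu> = Suc i" "(k - \<mu>) div \<mu> = i" by simp
      have "d_coeff (Suc (Suc r)) \<mu> k = d_coeff (Suc r) \<mu> k + d_coeff (Suc (Suc r)) \<mu> (k - \<mu>)"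
        using d_coeff_Suc_rec[OF \<mu>, of "Suc r" k] False by simp
      also have "\<dots> = (if \<mu> dvd k then of_nat ((r + Suc i) choose Suc i) else 0)
           + (if \<mu> dvd k then of_nat ((Suc r + i) choose i) else 0)"
        using less.IH[of "k - \<mu>"] False \<mu> Suc.IH[of k] dvd i by simp
      finally show ?thesis using i by (simp add: add.commute)
    qed
  qed
qed

text \<open>
  Summation by parts: the total variation of a monotone weight with values in \<open>[0, 1]\<close> is at most \<open>1\<close>, so
  weighting the increments of \<open>X\<close> costs a factor of \<open>2\<close> at most.
\<close>
lemma abel_bound:
  fixes X :: "nat \<Rightarrow> complex" and w :: "nat \<Rightarrow> real"
  assumes X: "\<And>i. cmod (X i) \<le> C" and w0: "\<And>i. 0 \<le> w i" and w1: "\<And>i. w i \<le> 1"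
    and mono: "\<And>i. w i \<le> w (Suc i)"
  shows "cmod (\<Sum>i<I. of_real (w i) * (X (Suc i) - X i)) \<le> 2 * C"
proof (cases I)
  case 0
  then show ?thesis using order_trans[OF norm_ge_zero X[of 0]] by simp
next
  case (Suc J)
  have id: "(\<Sum>i<Suc J. of_real (w i) * (X (Suc i) - X i))
      = of_real (w J) * X (Suc J) - of_real (w 0) * X 0 - (\<Sum>i<J. of_real (w (Suc i) - w i) * X (Suc i))" for J
    by (induction J) (simp_all add: algebra_simps)
  have "cmod (\<Sum>i<Suc J. of_real (w i) * (X (Suc i) - X i))
      \<le> cmod (of_real (w J) * X (Suc J)) + cmod (of_real (w 0) * X 0) + cmod (\<Sum>i<J. of_real (w (Suc i) - w i) * X (Suc i))"
    unfolding id by (intro order_trans[OF norm_triangle_ineq4] add_mono norm_triangle_ineq4 order_refl)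
  also have "cmod (of_real (w J) * X (Suc J)) \<le> w J * C"
    using w0 X by (simp add: norm_mult mult_left_mono)
  also have "cmod (of_real (w 0) * X 0) \<le> w 0 * C"
    using w0 X by (simp add: norm_mult mult_left_mono)
  also have "cmod (\<Sum>i<J. of_real (w (Suc i) - w i) * X (Suc i)) \<le> (\<Sum>i<J. (w (Suc i) - w i) * C)"
  proof (rule sum_norm_le)
    fix i
    have "cmod (of_real (w (Suc i) - w i)) = w (Suc i) - w i" using mono[of i] by (simp only: norm_of_real)
    then show "cmod (of_real (w (Suc i) - w i) * X (Suc i)) \<le> (w (Suc i) - w i) * C"
      unfolding norm_mult using mono[of i] X[of "Suc i"] by (simp add: mult_left_mono)
  qed
  also have "(\<Sum>i<J. (w (Suc i) - w i) * C) = (w J - w 0) * C"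
    by (simp only: sum_distrib_right[symmetric] sum_lessThan_telescope)
  also have "w J * C + w 0 * C + (w J - w 0) * C = w J * (2 * C)" by (simp add: algebra_simps)
  also have "\<dots> \<le> 2 * C"
    using w0 w1 order_trans[OF norm_ge_zero X[of 0]] by (simp add: mult_left_le_one_le)
  finally show ?thesis using Suc by simp
qed

text \<open>
  The weight that transforms the coefficients of one row of \<open>D\<close> into those of a row further down. Its quotient of
  successive values is at least \<open>1\<close> because
  \<open>(r + 1 + i) (i0 + i + 1) - (i + 1) (r + 1 + i0 + i) = r i0\<close>.
\<close>
lemma binomial_ratio:
  fixes r i0 :: nat
  defines "w \<equiv> \<lambda>i. real ((r + i) choose i) / real ((r + (i0 + i)) choose (i0 + i))"
  shows "0 \<le> w i" "w i \<le> 1" "w i \<le> w (Suc i)"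
proof -
  define B where "B i = real ((r + i) choose i)" for i
  have Bpos: "B i > 0" for i by (simp add: B_def)
  have rec: "real (Suc i) * B (Suc i) = real (Suc r + i) * B i" for i
  proof -
    have "Suc i * ((r + Suc i) choose Suc i) = (Suc r + i) * ((r + i) choose i)"
      using Suc_times_binomial_eq[of "r + i" i] by (simp add: mult.commute)
    then show ?thesis unfolding B_def by (metis of_nat_mult)
  qed
  have w: "w i = B i / B (i0 + i)" for i by (simp add: w_def B_def)
  show "0 \<le> w i" using Bpos by (simp add: w less_imp_le)
  have mono: "B i \<le> B (Suc i)" for i
    by (simp add: B_def binomial_Suc_Suc)
  have "B i \<le> B (i0 + i)"
    by (induction i0) (auto intro: order_trans[OF _ mono])
  then show "w i \<le> 1" using Bpos[of "i0 + i"] by (simp add: w)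
  have "B (Suc i) = real (Suc r + i) * B i / real (Suc i)"
    using rec[of i] by (simp add: field_simps)
  moreover have "B (i0 + Suc i) = real (Suc r + (i0 + i)) * B (i0 + i) / real (Suc (i0 + i))"
    using rec[of "i0 + i"] by (simp add: field_simps)
  ultimately have wS: "w (Suc i) = w i * ((real (Suc r + i) * real (Suc (i0 + i))) / (real (Suc i) * real (Suc r + (i0 + i))))"
    by (simp add: w mult_ac)
  have "real (Suc i) * real (Suc r + (i0 + i)) \<le> real (Suc r + i) * real (Suc (i0 + i))"
    by (simp add: algebra_simps)
  then have "1 \<le> (real (Suc r + i) * real (Suc (i0 + i))) / (real (Suc i) * real (Suc r + (i0 + i)))"
    by (subst le_divide_eq_1_pos) auto
  from mult_left_mono[OF this \<open>0 \<le> w i\<close>] show "w i \<le> w (Suc i)"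
    unfolding wS by (simp only: mult_1_right)
qed

lemma D_mat_sums_iff: "(\<lambda>j. D_mat n \<mu> k j * x j) sums s \<longleftrightarrow> (\<lambda>m. d_coeff n \<mu> m * x (k + m)) sums s"
proof -
  have "(\<lambda>m. D_mat n \<mu> k (m + k) * x (m + k)) sums s \<longleftrightarrow> (\<lambda>j. D_mat n \<mu> k j * x j) sums s"
    by (rule sums_zero_iff_shift) (simp add: D_mat_def)
  then show ?thesis by (simp add: D_mat_def add.commute)
qed

lemma D_op_sums:
  assumes "summable (\<lambda>j. D_mat n \<mu> k j * a j)"
  shows "(\<lambda>m. d_coeff n \<mu> m * a (k + m)) sums D_op n \<mu> a k"
  using summable_sums[OF assms] unfolding D_op_def D_mat_sums_iff .

lemma sum_multiples:
  fixes f :: "nat \<Rightarrow> complex"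
  assumes \<mu>: "\<mu> > 0" and zero: "\<And>m. \<not> \<mu> dvd m \<Longrightarrow> f m = 0"
  shows "(\<Sum>m<\<mu> * I. f m) = (\<Sum>i<I. f (\<mu> * i))"
    and "\<exists>I. (\<Sum>m<N. f m) = (\<Sum>i<I. f (\<mu> * i))"
proof -
  have *: "(\<Sum>m<N. f m) = (\<Sum>i\<in>{i. \<mu> * i < N}. f (\<mu> * i))" for N
  proof -
    have "(\<Sum>m<N. f m) = (\<Sum>m\<in>(\<lambda>i. \<mu> * i) ` {i. \<mu> * i < N}. f m)"
      by (rule sum.mono_neutral_right) (auto simp: zero image_iff dvd_def intro!: zero)
    also have "\<dots> = (\<Sum>i\<in>{i. \<mu> * i < N}. f (\<mu> * i))"
      using \<mu> by (subst sum.reindex) (auto simp: inj_on_def)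
    finally show ?thesis .
  qed
  have "{i. \<mu> * i < \<mu> * I} = {..<I}" using \<mu> by auto
  then show "(\<Sum>m<\<mu> * I. f m) = (\<Sum>i<I. f (\<mu> * i))" unfolding * by simp
  have "\<exists>I. {i. \<mu> * i < N} = {..<I}"
  proof (induction N)
    case (Suc N)
    then obtain I where I: "{i. \<mu> * i < N} = {..<I}" by blast
    show ?case
    proof (cases "\<mu> * I = N")
      case True
      then have "{i. \<mu> * i < Suc N} = {..<Suc I}"
        using \<mu> by (auto simp: less_Suc_eq simp flip: True)
      then show ?thesis by blast
    next
      case False
      have "\<not> \<mu> * I < N" using I by (metis lessThan_iff less_irrefl mem_Collect_eq)
      then have "\<mu> * I > N" using False by simp
      have "\<mu> * i < Suc N \<longleftrightarrow> i < I" for i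
      proof
        assume "\<mu> * i < Suc N"
        then have "\<mu> * i < \<mu> * I" using \<open>\<mu> * I > N\<close> by linarith
        then show "i < I" by simp
      next
        assume "i < I"
        then have "i \<in> {i. \<mu> * i < N}" using I by simp
        then show "\<mu> * i < Suc N" by simp
      qed
      then show ?thesis by (intro exI[of _ I]) auto
    qed
  qed (auto intro: exI[of _ 0])
  then show "\<exists>I. (\<Sum>m<N. f m) = (\<Sum>i<I. f (\<mu> * i))" unfolding * by metis
qed

text \<open>
  In each residue class modulo \<open>\<mu>\<close> all rows of \<open>D a\<close> are obtained from the first one by weights as in
  \<open>binomial_ratio\<close>; the first row converges, so its partial sums are bounded, and the Abel bound
  carries this over to the other rows. There are finitely many classes.
\<close>
lemma D_partial_sums_bounded:
  fixes a :: "nat \<Rightarrow> complex"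
  assumes \<mu>: "\<mu> > 0" and n: "n > 0"
    and conv: "\<And>k. summable (\<lambda>m. d_coeff n \<mu> m * a (k + m))"
  shows "\<exists>K. \<forall>N p. cmod (\<Sum>m<N. d_coeff n \<mu> m * a (p + m)) \<le> K"
proof -
  obtain r where r: "n = Suc r" using n by (cases n) auto
  have d: "d_coeff n \<mu> (\<mu> * i) = of_nat ((r + i) choose i)" "\<not> \<mu> dvd m \<Longrightarrow> d_coeff n \<mu> m = 0" for i m
    using \<mu> by (simp_all add: r d_coeff_eq)
  have "\<forall>k. \<exists>C. \<forall>N. cmod (\<Sum>m<N. d_coeff n \<mu> m * a (k + m)) \<le> C"
  proof
    fix k
    have "Bseq (\<lambda>N. \<Sum>m<N. d_coeff n \<mu> m * a (k + m))"
      using conv[of k] by (intro convergent_imp_Bseq) (simp add: summable_iff_convergent)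
    then show "\<exists>C. \<forall>N. cmod (\<Sum>m<N. d_coeff n \<mu> m * a (k + m)) \<le> C" unfolding Bseq_def by blast
  qed
  from choice[OF this] obtain C where C: "\<And>k N. cmod (\<Sum>m<N. d_coeff n \<mu> m * a (k + m)) \<le> C k" by blast
  have C0: "0 \<le> C k" for k using C[of k 0] by simp
  define K where "K = 2 * (\<Sum>k<\<mu>. C k)"
  have "cmod (\<Sum>m<N. d_coeff n \<mu> m * a (p + m)) \<le> K" for N p
  proof -
    define k i0 where "k = p mod \<mu>" and "i0 = p div \<mu>"
    have p: "p = k + \<mu> * i0" by (simp add: k_def i0_def)
    \<comment> \<open>\<open>X\<close> runs through partial sums of the first row of the class of \<open>k\<close>, starting at the multiple \<open>i0\<close>.\<close>
    define w where "w i = real ((r + i) choose i) / real ((r + (i0 + i)) choose (i0 + i))" for i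
    define X where "X i = (\<Sum>m<\<mu> * (i0 + i). d_coeff n \<mu> m * a (k + m))" for i
    obtain I where I: "(\<Sum>m<N. d_coeff n \<mu> m * a (p + m)) = (\<Sum>i<I. d_coeff n \<mu> (\<mu> * i) * a (p + \<mu> * i))"
      using sum_multiples(2)[OF \<mu>, of "\<lambda>m. d_coeff n \<mu> m * a (p + m)" N] d(2) by auto
    have step: "X (Suc i) - X i = of_nat ((r + (i0 + i)) choose (i0 + i)) * a (k + \<mu> * (i0 + i))" for i
    proof -
      have "X i = (\<Sum>j<i0 + i. d_coeff n \<mu> (\<mu> * j) * a (k + \<mu> * j))" for i
        unfolding X_def by (rule sum_multiples(1)[OF \<mu>]) (simp add: d(2))
      then show ?thesis by (simp add: d(1))
    qed
    have "d_coeff n \<mu> (\<mu> * i) * a (p + \<mu> * i) = of_real (w i) * (X (Suc i) - X i)" for i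
      unfolding step d(1) by (simp add: w_def p algebra_simps)
    then have "cmod (\<Sum>m<N. d_coeff n \<mu> m * a (p + m)) = cmod (\<Sum>i<I. of_real (w i) * (X (Suc i) - X i))"
      unfolding I by simp
    also have "\<dots> \<le> 2 * C k"
      by (rule abel_bound) (unfold X_def w_def, rule C, (rule binomial_ratio)+)
    also have "C k \<le> (\<Sum>k<\<mu>. C k)"
      using \<mu> C0 by (intro member_le_sum) (auto simp: k_def)
    finally show ?thesis by (simp add: K_def)
  qed
  then show ?thesis by blast
qed

text \<open>
  Formally an interchange of the two summations. The sum over \<open>j\<close> is absolutely convergent and the partial sums of
  the series for \<open>D\<close> are uniformly bounded, so Tannery's theorem justifies it.
\<close>
lemma D_op_A_op:
  assumes \<mu>: "\<mu> > 0" and n: "n > 0"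
    and conv: "\<And>k. summable (\<lambda>j. D_mat n \<mu> k j * a j)"
    and c: "summable (\<lambda>j. cmod (c j))"
  shows "D_op n \<mu> (A_op a c) k = (\<Sum>j. c j * D_op n \<mu> a (k + j))"
proof -
  note b = D_op_sums[OF conv]
  obtain K where K: "\<And>N p. cmod (\<Sum>m<N. d_coeff n \<mu> m * a (p + m)) \<le> K"
    using D_partial_sums_bounded[OF \<mu> n sums_summable[OF b]] by blast
  \<comment> \<open>The bound for the partial sums of length \<open>1\<close> says that \<open>a\<close> itself is bounded.\<close>
  have "d_coeff n \<mu> 0 = 1"
    using n \<mu> d_coeff_eq[OF \<mu>, of "n - 1" 0] by simp
  then have abound: "cmod (a p) \<le> K" for p using K[of p 1] by simp
  have asum: "summable (\<lambda>j. a (k + j) * c j)" for k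
  proof (rule summable_norm_cancel, rule summable_comparison_test'[OF summable_mult[OF c, of K]])
    show "norm (norm (a (k + j) * c j)) \<le> K * cmod (c j)" for j
      by (simp add: norm_mult abound mult_right_mono)
  qed
  have partial: "(\<Sum>m<N. d_coeff n \<mu> m * A_op a c (k + m)) = (\<Sum>j. c j * (\<Sum>m<N. d_coeff n \<mu> m * a (k + j + m)))" for N
  proof -
    have "(\<Sum>m<N. d_coeff n \<mu> m * A_op a c (k + m)) = (\<Sum>m<N. \<Sum>j. d_coeff n \<mu> m * (a (k + m + j) * c j))"
      unfolding A_op_def by (intro sum.cong refl suminf_mult[symmetric] asum)
    also have "\<dots> = (\<Sum>j. \<Sum>m<N. d_coeff n \<mu> m * (a (k + m + j) * c j))"
      by (rule suminf_sum[symmetric]) (intro summable_mult asum)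
    also have "\<dots> = (\<Sum>j. c j * (\<Sum>m<N. d_coeff n \<mu> m * a (k + j + m)))"
      by (simp add: sum_distrib_left mult_ac add_ac)
    finally show ?thesis .
  qed
  have lim: "(\<lambda>N. c j * (\<Sum>m<N. d_coeff n \<mu> m * a (k + j + m))) \<longlonglongrightarrow> c j * D_op n \<mu> a (k + j)" for j
    using b[of "k + j"] by (intro tendsto_intros) (simp add: sums_def)
  have bound: "norm (c j * (\<Sum>m<N. d_coeff n \<mu> m * a (k + j + m))) \<le> K * cmod (c j)" for j N
    using mult_right_mono[OF K[of "k + j" N], of "cmod (c j)"] by (simp add: norm_mult mult.commute)
  have ev: "\<forall>\<^sub>F (j, N) in at_top \<times>\<^sub>F sequentially. norm (c j * (\<Sum>m<N. d_coeff n \<mu> m * a (k + j + m))) \<le> K * cmod (c j)"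
    by (rule always_eventually) (use bound in simp)
  have "(\<lambda>N. \<Sum>j. c j * (\<Sum>m<N. d_coeff n \<mu> m * a (k + j + m))) \<longlonglongrightarrow> (\<Sum>j. c j * D_op n \<mu> a (k + j))"
    by (rule tannerys_theorem[OF lim ev summable_mult[OF c] trivial_limit_sequentially, THEN conjunct2, THEN conjunct2])
  then have "(\<lambda>m. d_coeff n \<mu> m * A_op a c (k + m)) sums (\<Sum>j. c j * D_op n \<mu> a (k + j))"
    unfolding sums_def partial .
  then show ?thesis unfolding D_mat_sums_iff[symmetric] by (simp add: D_op_def sums_iff)
qed

text \<open>
  The product of \<open>\<Sum>k. b k z\<^sup>k\<close> and \<open>\<Sum>j. c j z\<^sup>-\<^sup>j\<close> on the circle, sorted by the sign of the frequency \<open>k - j\<close>. The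
  terms with \<open>k \<ge> j\<close> form the first series, and \<open>g m\<close> collects those with \<open>j - k = m \<ge> 1\<close>.
\<close>
lemma product_split:
  assumes b: "summable (\<lambda>k. cmod (b k))" and c: "summable (\<lambda>k. cmod (c k))"
  shows "summable (\<lambda>k. cmod (\<Sum>j. c j * b (k + j)))"
    and "\<exists>g. summable (\<lambda>k. cmod (g k)) \<and> g 0 = 0 \<and> (\<forall>x. power_series b (cis x) * power_series c (cis (- x))
      = power_series (\<lambda>k. \<Sum>j. c j * b (k + j)) (cis x) + power_series g (cis (- x)))"
proof -
  define Sb where "Sb = (\<Sum>k. cmod (b k))"
  have brow: "summable (\<lambda>k. cmod (b (k + j)))" for j by (rule summable_ignore_initial_segment[OF b])
  have brow_le: "(\<Sum>k. cmod (b (k + j))) \<le> Sb" for j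
    unfolding Sb_def suminf_split_initial_segment[OF b, of j] by (simp add: sum_nonneg)
  have p1: "summable (\<lambda>k. cmod (c j * b (k + j)))" for j
    unfolding norm_mult by (rule summable_mult[OF brow])
  have p2: "(\<Sum>k. cmod (c j * b (k + j))) \<le> cmod (c j) * Sb" for j
    unfolding norm_mult suminf_mult[OF brow] by (rule mult_left_mono[OF brow_le]) simp
  have p3: "summable (\<lambda>j. cmod (c j) * Sb)" by (rule summable_mult2[OF c])
  note P = double_series_swap[OF p1 p2 p3]
  show r: "summable (\<lambda>k. cmod (\<Sum>j. c j * b (k + j)))" by (rule P(3))
  define q where "q j m = (if 1 \<le> m \<and> m \<le> j then c j * b (j - m) else 0)" for j m :: nat
  have qfin: "q j m = 0" if "m \<notin> {1..j}" for j m using that by (auto simp: q_def)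
  have q1: "summable (\<lambda>m. cmod (q j m))" for j
    by (rule summable_finite[of "{1..j}"]) (auto simp: qfin)
  have q2: "(\<Sum>m. cmod (q j m)) \<le> cmod (c j) * Sb" for j
  proof -
    have "(\<Sum>m. cmod (q j m)) = (\<Sum>m\<in>{1..j}. cmod (q j m))"
      by (rule suminf_finite) (auto simp: qfin)
    also have "\<dots> = (\<Sum>m\<in>{1..j}. cmod (c j) * cmod (b (j - m)))"
      by (rule sum.cong) (auto simp: q_def norm_mult)
    also have "\<dots> = cmod (c j) * (\<Sum>k<j. cmod (b k))"
      unfolding sum_distrib_left[symmetric]
      by (rule arg_cong[where f = "\<lambda>x. _ * x"], rule sum.reindex_bij_witness[of _ "\<lambda>k. j - k" "\<lambda>m. j - m"]) auto
    also have "\<dots> \<le> cmod (c j) * Sb"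
      unfolding Sb_def by (intro mult_left_mono sum_le_suminf b) auto
    finally show ?thesis .
  qed
  note Q = double_series_swap[OF q1 q2 p3]
  define g where "g m = (\<Sum>j. q j m)" for m
  have g: "summable (\<lambda>k. cmod (g k))" unfolding g_def by (rule Q(3))
  have g0: "g 0 = 0" by (simp add: g_def q_def)
  have "power_series b (cis x) * power_series c (cis (- x))
      = power_series (\<lambda>k. \<Sum>j. c j * b (k + j)) (cis x) + power_series g (cis (- x))" for x
  proof -
    let ?z = "cis x" and ?y = "cis (- x)"
    have zy: "?z ^ k * ?y ^ k = 1" for k by (simp add: power_mult_distrib[symmetric] cis_mult)
    have pz1: "summable (\<lambda>k. cmod (c j * b (k + j) * ?z ^ k))" for j using p1 by (simp add: norm_mult norm_power)
    have pz2: "(\<Sum>k. cmod (c j * b (k + j) * ?z ^ k)) \<le> cmod (c j) * Sb" for j using p2 by (simp add: norm_mult norm_power)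
    have qy1: "summable (\<lambda>m. cmod (q j m * ?y ^ m))" for j using q1 by (simp add: norm_mult norm_power)
    have qy2: "(\<Sum>m. cmod (q j m * ?y ^ m)) \<le> cmod (c j) * Sb" for j using q2 by (simp add: norm_mult norm_power)
    note PZ = double_series_swap[OF pz1 pz2 p3] and QY = double_series_swap[OF qy1 qy2 p3]
    have row: "power_series b ?z * (c j * ?y ^ j) = (\<Sum>k. c j * b (k + j) * ?z ^ k) + (\<Sum>m. q j m * ?y ^ m)" for j
    proof -
      have bz: "(\<lambda>k. b k * ?z ^ k) sums power_series b ?z" by (rule abs_power_series(2)[OF b]) simp
      have "power_series b ?z = (\<Sum>k. b (k + j) * ?z ^ (k + j)) + (\<Sum>k<j. b k * ?z ^ k)"
        using suminf_split_initial_segment[OF sums_summable[OF bz], of j] bz by (simp add: sums_iff)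
      then have "power_series b ?z * (c j * ?y ^ j)
          = (\<Sum>k. b (k + j) * ?z ^ (k + j)) * (c j * ?y ^ j) + (\<Sum>k<j. b k * ?z ^ k * (c j * ?y ^ j))"
        by (simp only: ring_distribs sum_distrib_right)
      also have "(\<Sum>k. b (k + j) * ?z ^ (k + j)) * (c j * ?y ^ j) = (\<Sum>k. b (k + j) * ?z ^ (k + j) * (c j * ?y ^ j))"
        by (rule suminf_mult2) (rule summable_ignore_initial_segment[OF sums_summable[OF bz]])
      also have "\<dots> = (\<Sum>k. c j * b (k + j) * ?z ^ k)"
      proof (rule suminf_cong)
        fix k
        have "b (k + j) * ?z ^ (k + j) * (c j * ?y ^ j) = c j * b (k + j) * ?z ^ k * (?z ^ j * ?y ^ j)"
          by (simp only: power_add mult_ac)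
        then show "b (k + j) * ?z ^ (k + j) * (c j * ?y ^ j) = c j * b (k + j) * ?z ^ k" by (simp only: zy mult_1_right)
      qed
      also have "(\<Sum>k<j. b k * ?z ^ k * (c j * ?y ^ j)) = (\<Sum>m\<in>{1..j}. q j m * ?y ^ m)"
      proof (rule sum.reindex_bij_witness[of _ "\<lambda>m. j - m" "\<lambda>k. j - k"])
        fix k assume k: "k \<in> {..<j}"
        then have "?y ^ j = ?y ^ k * ?y ^ (j - k)" by (simp flip: power_add)
        then have "b k * ?z ^ k * (c j * ?y ^ j) = c j * b k * ?y ^ (j - k) * (?z ^ k * ?y ^ k)" by (simp only: mult_ac)
        then show "q j (j - k) * ?y ^ (j - k) = b k * ?z ^ k * (c j * ?y ^ j)"
          using k by (simp only: zy) (simp add: q_def)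
      qed auto
      also have "\<dots> = (\<Sum>m. q j m * ?y ^ m)" by (rule suminf_finite[symmetric]) (auto simp: qfin)
      finally show ?thesis .
    qed
    have cy: "(\<lambda>j. c j * ?y ^ j) sums power_series c ?y" by (rule abs_power_series(2)[OF c]) simp
    have sP: "summable (\<lambda>j. \<Sum>k. c j * b (k + j) * ?z ^ k)"
      by (rule summable_norm_cancel, rule summable_comparison_test'[OF p3])
        (use order_trans[OF summable_norm[OF pz1] pz2] in simp)
    have sQ: "summable (\<lambda>j. \<Sum>m. q j m * ?y ^ m)"
      by (rule summable_norm_cancel, rule summable_comparison_test'[OF p3])
        (use order_trans[OF summable_norm[OF qy1] qy2] in simp)
    have "power_series b ?z * power_series c ?y = (\<Sum>j. power_series b ?z * (c j * ?y ^ j))"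
      using sums_mult[OF cy, of "power_series b ?z"] by (simp add: sums_iff)
    also have "\<dots> = (\<Sum>j. \<Sum>k. c j * b (k + j) * ?z ^ k) + (\<Sum>j. \<Sum>m. q j m * ?y ^ m)"
      unfolding row by (rule suminf_add[OF sP sQ, symmetric])
    also have "(\<Sum>j. \<Sum>k. c j * b (k + j) * ?z ^ k) = (\<Sum>k. \<Sum>j. c j * b (k + j) * ?z ^ k)"
      by (rule PZ(4)[symmetric])
    also have "\<dots> = power_series (\<lambda>k. \<Sum>j. c j * b (k + j)) ?z"
      unfolding power_series_def
      by (intro suminf_cong suminf_mult2[symmetric] summable_norm_cancel[OF P(1)])
    also have "(\<Sum>j. \<Sum>m. q j m * ?y ^ m) = (\<Sum>m. \<Sum>j. q j m * ?y ^ m)"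
      by (rule QY(4)[symmetric])
    also have "\<dots> = power_series g ?y"
      unfolding power_series_def g_def
      by (intro suminf_cong suminf_mult2[symmetric] summable_norm_cancel[OF Q(1)])
    finally show ?thesis .
  qed
  then show "\<exists>g. summable (\<lambda>k. cmod (g k)) \<and> g 0 = 0 \<and> (\<forall>x. power_series b (cis x) * power_series c (cis (- x))
      = power_series (\<lambda>k. \<Sum>j. c j * b (k + j)) (cis x) + power_series g (cis (- x)))"
    using g g0 by (intro exI[of _ g]) simp
qed

section \<open>Projection onto the past\<close>

text \<open>
  Up to the constant \<open>2 pi\<close>, the isometry \<open>u \<kappa> \<mapsto> u \<Psi>\<close> from \<open>L\<^sub>2(f)\<close> to the circle, with \<open>\<Psi>\<close> defined below, is available as soon as \<open>f\<close> has a
  canonical factorization.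
\<close>
locale factorized_density =
  fixes n \<mu> :: nat and f :: "real \<Rightarrow> real" and \<phi> :: "nat \<Rightarrow> complex"
  assumes n: "n > 0" and \<mu>: "\<mu> > 0" and integrable_density: "set_integrable lborel {-pi..pi} f"
    and factorization: "canonical_factorization f \<phi>"
begin

abbreviation "K \<equiv> L2_density_space f"
abbreviation "\<kappa> \<equiv> increment_kernel n \<mu>"
abbreviation "\<psi> \<equiv> phi_mu n \<mu> \<phi>"

definition \<Psi> :: "real \<Rightarrow> complex" where "\<Psi> x = power_series \<psi> (cis (- x))"

lemma radius: "conv_radius \<phi> > 1" and factor_nonzero: "\<And>z. cmod z \<le> 1 \<Longrightarrow> power_series \<phi> z \<noteq> 0"
  and f_eq: "AE x in lborel. x \<in> {-pi..pi} \<longrightarrow> f x = (cmod (power_series \<phi> (cis (- x))))\<^sup>2"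
  using factorization by (auto simp: canonical_factorization_def)

lemma nonneg: "AE x in lborel. x \<in> {-pi..pi} \<longrightarrow> 0 \<le> f x"
  using f_eq by eventually_elim simp

lemma abs_psi: "summable (\<lambda>k. cmod (\<psi> k))"
  by (rule phi_mu_power_series(1)[OF \<mu> radius factor_nonzero])

lemma Psi_measurable [measurable]: "\<Psi> \<in> borel_measurable borel"
  using power_series_cis_measurable(1)[OF abs_psi, of "-1"] by (simp add: \<Psi>_def[abs_def])

text \<open>
  By the quasi-inverse a boundary zero is a \<open>\<mu>\<close>-th root of unity.
\<close>
lemma Psi_nonzero: "AE x in circ. \<Psi> x \<noteq> 0"
  using cis_eq_1_AE_circ[OF \<mu>]
proof eventually_elim
  case (elim x)
  obtain G where G: "\<And>z. cmod z \<le> 1 \<Longrightarrow> power_series \<psi> z * G z = (1 - z ^ \<mu>) ^ n"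
    by (rule phi_mu_quasi_inverse[OF \<mu> radius, of n]) (erule factor_nonzero, rule that)
  have "cis (- x) ^ \<mu> \<noteq> 1" using elim by (simp add: cis_power mult.commute)
  then show ?case using G[of "cis (- x)"] by (auto simp: \<Psi>_def)
qed

lemma weight_eq:
  "AE x in lborel. indicator {-pi..pi} x * f x * (cmod (\<kappa> x))\<^sup>2 = indicator {-pi..pi} x * (cmod (\<Psi> x))\<^sup>2"
proof -
  have "AE x in lborel. x \<noteq> 0 \<and> x \<noteq> pi \<and> x \<noteq> -pi" by (intro AE_conjI AE_lborel_singleton)
  with f_eq show ?thesis
  proof eventually_elim
    case (elim x)
    show ?case
    proof (cases "x \<in> {-pi..pi}")
      case True
      then have "cmod (\<kappa> x) * cmod (power_series \<phi> (cis (- x))) = cmod (\<Psi> x)"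
        unfolding \<Psi>_def by (intro norm_increment_kernel[OF \<mu> radius factor_nonzero]) (use elim in auto)
      then have "(cmod (\<kappa> x) * cmod (power_series \<phi> (cis (- x))))\<^sup>2 = (cmod (\<Psi> x))\<^sup>2" by simp
      then show ?thesis using True elim by (simp add: power_mult_distrib mult.commute)
    qed simp
  qed
qed

lemma weighted_integral:
  fixes q :: "real \<Rightarrow> 'b::{banach, second_countable_topology}"
  assumes [measurable]: "q \<in> borel_measurable borel"
  shows "(LINT x|K. (cmod (\<kappa> x))\<^sup>2 *\<^sub>R q x) = (2 * pi) *\<^sub>R (LINT x|circ. (cmod (\<Psi> x))\<^sup>2 *\<^sub>R q x)"
    and "integrable K (\<lambda>x. (cmod (\<kappa> x))\<^sup>2 *\<^sub>R q x) \<longleftrightarrow> integrable circ (\<lambda>x. (cmod (\<Psi> x))\<^sup>2 *\<^sub>R q x)"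
proof -
  have [measurable]: "(\<lambda>x. indicator {-pi..pi} x * f x) \<in> borel_measurable borel"
    by (rule truncated_density(1)[OF integrable_density nonneg])
  have m1: "(\<lambda>x. (cmod (\<kappa> x))\<^sup>2 *\<^sub>R q x) \<in> borel_measurable borel" by measurable
  have m2: "(\<lambda>x. (cmod (\<Psi> x))\<^sup>2 *\<^sub>R q x) \<in> borel_measurable borel" by measurable
  have eq: "AE x in lborel. (indicator {-pi..pi} x * f x) *\<^sub>R ((cmod (\<kappa> x))\<^sup>2 *\<^sub>R q x)
      = indicator {-pi..pi} x *\<^sub>R ((cmod (\<Psi> x))\<^sup>2 *\<^sub>R q x)"
    using weight_eq by eventually_elim simp
  have M: "(\<lambda>x. (indicator {-pi..pi} x * f x) *\<^sub>R ((cmod (\<kappa> x))\<^sup>2 *\<^sub>R q x)) \<in> borel_measurable lborel"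
    "(\<lambda>x. indicator {-pi..pi} x *\<^sub>R ((cmod (\<Psi> x))\<^sup>2 *\<^sub>R q x)) \<in> borel_measurable lborel"
    by measurable
  show "(LINT x|K. (cmod (\<kappa> x))\<^sup>2 *\<^sub>R q x) = (2 * pi) *\<^sub>R (LINT x|circ. (cmod (\<Psi> x))\<^sup>2 *\<^sub>R q x)"
    unfolding L2_density_space_integral(1)[OF integrable_density nonneg m1] circ_integral(1)[OF m2]
      set_lebesgue_integral_def integral_cong_AE[OF M eq] by simp
  show "integrable K (\<lambda>x. (cmod (\<kappa> x))\<^sup>2 *\<^sub>R q x) \<longleftrightarrow> integrable circ (\<lambda>x. (cmod (\<Psi> x))\<^sup>2 *\<^sub>R q x)"
    unfolding L2_density_space_integral(2)[OF integrable_density nonneg m1] circ_integral(2)[OF m2]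
      set_integrable_def by (rule integrable_cong_AE[OF M eq])
qed

lemma weighted_norm:
  assumes [measurable]: "G \<in> borel_measurable borel"
  shows "sq_integrable K (\<lambda>x. G x * \<kappa> x) \<longleftrightarrow> sq_integrable circ (\<lambda>x. G x * \<Psi> x)"
    and "(l2n K (\<lambda>x. G x * \<kappa> x))\<^sup>2 = 2 * pi * (l2n circ (\<lambda>x. G x * \<Psi> x))\<^sup>2"
proof -
  have [measurable]: "(\<lambda>x. (cmod (G x))\<^sup>2) \<in> borel_measurable borel" by measurable
  note W = weighted_integral[of "\<lambda>x. (cmod (G x))\<^sup>2"]
  show "sq_integrable K (\<lambda>x. G x * \<kappa> x) \<longleftrightarrow> sq_integrable circ (\<lambda>x. G x * \<Psi> x)"
    using W(2) by (simp add: sq_integrable_def norm_mult power_mult_distrib mult.commute)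
  show "(l2n K (\<lambda>x. G x * \<kappa> x))\<^sup>2 = 2 * pi * (l2n circ (\<lambda>x. G x * \<Psi> x))\<^sup>2"
    using W(1) by (simp add: l2n_sq norm_mult power_mult_distrib mult.commute)
qed

lemma weighted_inner:
  assumes [measurable]: "G \<in> borel_measurable borel" "H \<in> borel_measurable borel"
  shows "(LINT x|K. (G x * \<kappa> x) * cnj (H x * \<kappa> x)) = of_real (2 * pi) * (LINT x|circ. (G x * \<Psi> x) * cnj (H x * \<Psi> x))"
proof -
  have eq: "(G x * c) * cnj (H x * c) = (cmod c)\<^sup>2 *\<^sub>R (G x * cnj (H x))" for c x
    unfolding scaleR_conv_of_real complex_norm_square by simp
  have [measurable]: "(\<lambda>x. G x * cnj (H x)) \<in> borel_measurable borel"
    by (intro borel_measurable_times measurable_compose[OF _ borel_measurable_continuous_onI[OF continuous_on_cnj[OF continuous_on_id]]]) measurable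
  show ?thesis
    unfolding eq by (subst weighted_integral) (simp_all add: scaleR_conv_of_real)
qed

lemma finite_K: "finite_measure K"
proof (rule finite_measureI)
  note d = truncated_density[OF integrable_density nonneg]
  have "emeasure K UNIV = (\<integral>\<^sup>+x. ennreal (indicator {-pi..pi} x * f x) \<partial>lborel)"
    unfolding L2_density_space_def using d(1) by (subst emeasure_density) auto
  also have "\<dots> = ennreal (LINT x|lborel. indicator {-pi..pi} x * f x)"
    by (rule nn_integral_eq_integral) (use d in auto)
  finally show "emeasure K (space K) \<noteq> \<infinity>" by (simp add: L2_density_space_def)
qed

lemma sq_integrable_bounded_kernel:
  assumes "finite_measure N" "sets N = sets borel" "G \<in> borel_measurable borel" "\<And>x. cmod (G x) \<le> C"
  shows "sq_integrable N (\<lambda>x. G x * \<kappa> x)"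
proof (rule sq_integrable_bounded[OF assms(1), where C = "C * real \<mu> ^ n"])
  show "(\<lambda>x. G x * \<kappa> x) \<in> borel_measurable N"
    using assms(2,3) by (simp add: measurable_cong_sets[OF assms(2) refl])
  show "cmod (G x * \<kappa> x) \<le> C * real \<mu> ^ n" for x
    unfolding norm_mult using order_trans[OF norm_ge_zero assms(4)]
    by (intro mult_mono assms(4) increment_kernel_bound) auto
qed

definition generators :: "(real \<Rightarrow> complex) set" where
  "generators = {\<lambda>x. cis (x * of_int k) * \<kappa> x | k::int. k \<le> -1}"

lemma cis_measurable' [measurable]: "(\<lambda>x. cis (x * a)) \<in> borel_measurable borel"
  using cis_measurable[of a] by (simp add: mult.commute)

text \<open>
  Under the isometry \<open>e\<close> becomes \<open>\<Sum>k. c k e\<^sup>i\<^sup>k\<^sup>x\<close>, while a generator of the past becomes \<open>e\<^sup>i\<^sup>k\<^sup>x \<Psi>\<close> with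
  \<open>k \<le> -1\<close>. The conjugate of \<open>\<Psi>\<close> is a power series in \<open>e\<^sup>i\<^sup>x\<close>, so the product has positive frequencies only and its
  integral vanishes.
\<close>
lemma orthogonal_past:
  assumes c: "summable (\<lambda>k. cmod (c k))"
  defines "e \<equiv> \<lambda>x. power_series c (cis x) * inverse (\<Psi> x) * \<kappa> x"
  shows "sq_integrable K e" "(l2n K e)\<^sup>2 = 2 * pi * (l2n circ (\<lambda>x. power_series c (cis x)))\<^sup>2"
    and "u \<in> L2_past n \<mu> f \<Longrightarrow> (LINT x|K. e x * cnj (u x)) = 0"
proof -
  let ?r = "\<lambda>x. power_series c (cis x)"
  have rm [measurable]: "?r \<in> borel_measurable borel" using power_series_cis_measurable(1)[OF c, of 1] by simp
  have Gm [measurable]: "(\<lambda>x. ?r x * inverse (\<Psi> x)) \<in> borel_measurable borel" by measurable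
  have eqr: "AE x in circ. ?r x * inverse (\<Psi> x) * \<Psi> x = ?r x" using Psi_nonzero by eventually_elim simp
  have rsq: "sq_integrable circ ?r" using sq_integrable_power_series[OF c, of 1] by simp
  show e: "sq_integrable K e"
    unfolding e_def weighted_norm(1)[OF Gm]
    by (subst sq_integrable_cong_AE[OF eqr]) (use rsq in auto)
  show "(l2n K e)\<^sup>2 = 2 * pi * (l2n circ ?r)\<^sup>2"
    unfolding e_def weighted_norm(2)[OF Gm] by (subst l2n_cong_AE[OF eqr]) auto
  have gen: "sq_integrable K g \<and> (LINT x|K. e x * cnj (g x)) = 0" if "g \<in> generators" for g
  proof -
    from that obtain k :: int where k: "k \<le> -1" and g: "g = (\<lambda>x. cis (x * of_int k) * \<kappa> x)"
      by (auto simp: generators_def)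
    have gsq: "sq_integrable K g"
      unfolding g by (rule sq_integrable_bounded_kernel[OF finite_K, where C = 1]) auto
    define d where "d m = (\<Sum>i\<le>m. c i * cnj (\<psi> (m - i)))" for m
    have abs_cnj: "summable (\<lambda>k. cmod (cnj (\<psi> k)))" using abs_psi by simp
    note D = power_series_product[OF c abs_cnj, folded d_def]
    have "(LINT x|K. e x * cnj (g x))
        = of_real (2 * pi) * (LINT x|circ. (?r x * inverse (\<Psi> x) * \<Psi> x) * cnj (cis (x * of_int k) * \<Psi> x))"
      unfolding e_def g by (rule weighted_inner) measurable
    also have "(LINT x|circ. (?r x * inverse (\<Psi> x) * \<Psi> x) * cnj (cis (x * of_int k) * \<Psi> x))
        = (LINT x|circ. power_series d (cis x) * cis (of_int (- k) * x))"
    proof (rule integral_cong_AE)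
      show "AE x in circ. (?r x * inverse (\<Psi> x) * \<Psi> x) * cnj (cis (x * of_int k) * \<Psi> x)
          = power_series d (cis x) * cis (of_int (- k) * x)"
        using Psi_nonzero
      proof eventually_elim
        case (elim x)
        have "cnj (\<Psi> x) = power_series (\<lambda>k. cnj (\<psi> k)) (cis x)"
          using power_series_cnj[OF abs_psi, of "cis (- x)"] by (simp add: \<Psi>_def cis_cnj)
        then have "?r x * cnj (\<Psi> x) = power_series d (cis x)" by (simp add: D(3))
        moreover have "cnj (cis (x * of_int k)) = cis (of_int (- k) * x)" by (simp add: cis_cnj mult.commute)
        ultimately show ?case using elim by (simp add: mult_ac)
      qed
      have [measurable]: "(\<lambda>x. cnj (h x)) \<in> borel_measurable borel" if "h \<in> borel_measurable borel" for h :: "real \<Rightarrow> complex"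
        by (rule measurable_compose[OF that borel_measurable_continuous_onI[OF continuous_on_cnj[OF continuous_on_id]]])
      show "(\<lambda>x. (?r x * inverse (\<Psi> x) * \<Psi> x) * cnj (cis (x * of_int k) * \<Psi> x)) \<in> borel_measurable circ"
        by measurable
      have [measurable]: "(\<lambda>x. power_series d (cis x)) \<in> borel_measurable borel"
        using power_series_cis_measurable(1)[OF D(1), of 1] by simp
      show "(\<lambda>x. power_series d (cis x) * cis (of_int (- k) * x)) \<in> borel_measurable circ" by measurable
    qed
    also have "\<dots> = 0" using integral_power_series_cis[OF D(1), of "- k"] k by simp
    finally show ?thesis using gsq by simp
  qed
  have lc: "(LINT x|K. e x * cnj (s x)) = 0" if "s \<in> lin_combs generators" for s
  proof -
    from that obtain S cf where S: "finite S" "S \<subseteq> generators" and s: "s = (\<lambda>x. \<Sum>g\<in>S. cf g * g x)"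
      by (auto simp: lin_combs_def)
    have int: "integrable K (\<lambda>x. e x * cnj (g x))" if "g \<in> S" for g
      using sq_integrable_prod[OF e] gen S(2) that by blast
    have "(LINT x|K. e x * cnj (s x)) = (LINT x|K. (\<Sum>g\<in>S. cnj (cf g) * (e x * cnj (g x))))"
      by (simp add: s cnj_sum sum_distrib_left mult_ac)
    also have "\<dots> = (\<Sum>g\<in>S. cnj (cf g) * (LINT x|K. e x * cnj (g x)))"
      using int by simp
    also have "\<dots> = 0" using gen S(2) by (intro sum.neutral) auto
    finally show ?thesis .
  qed
  assume "u \<in> L2_past n \<mu> f"
  then obtain s where s: "\<And>k. s k \<in> lin_combs generators" "L2_tendsto K s u"
    unfolding L2_past_def L2_closed_span_def generators_def by blast
  show "(LINT x|K. e x * cnj (u x)) = 0" by (rule L2_tendsto_inner_zero[OF s(2) e lc[OF s(1)]])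
qed

text \<open>
  This is where \<open>\<Phi>\<^sub>\<mu>\<close> being outer is used. With the quasi-inverse \<open>G\<close> and \<open>\<zeta> = e\<^sup>-\<^sup>i\<^sup>x\<close>, the functions
  \<open>q\<^sub>\<rho> = g G / (1 - \<rho> \<zeta>\<^sup>\<mu>)\<^sup>n\<close> have absolutely convergent series without constant term, so their partial sums are combinations
  of \<open>e\<^sup>-\<^sup>i\<^sup>k\<^sup>x\<close> with \<open>k \<ge> 1\<close>. Moreover \<open>q\<^sub>\<rho> \<Psi> = g ((1 - \<zeta>\<^sup>\<mu>) / (1 - \<rho> \<zeta>\<^sup>\<mu>))\<^sup>n\<close> is bounded by \<open>2\<^sup>n |g|\<close>
  and tends to \<open>g\<close> almost everywhere as \<open>\<rho> \<rightarrow> 1\<close>.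
\<close>
lemma analytic_past:
  assumes g: "summable (\<lambda>k. cmod (g k))" and g0: "g 0 = 0"
    and u: "u \<in> borel_measurable borel" and u_eq: "AE x in circ. u x * \<Psi> x = power_series g (cis (- x))"
  shows "(\<lambda>x. u x * \<kappa> x) \<in> L2_past n \<mu> f"
proof -
  have gw: "wiener (power_series g)"
    unfolding wiener_def using g by (intro exI[of _ g] conjI allI impI refl)
  obtain G where G: "wiener G" "\<And>z. cmod z \<le> 1 \<Longrightarrow> power_series \<psi> z * G z = (1 - z ^ \<mu>) ^ n"
    by (rule phi_mu_quasi_inverse[OF \<mu> radius, of n]) (erule factor_nonzero, rule that)
  define E where "E j z = inverse (1 - of_real (approach j) * z ^ \<mu>)" for j and z :: complex
  have den: "1 - of_real (approach j) * z ^ \<mu> \<noteq> 0" if "cmod z < root \<mu> (1 / approach j)" for j and z :: complex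
  proof
    assume "1 - of_real (approach j) * z ^ \<mu> = 0"
    then have "cmod (of_real (approach j) * z ^ \<mu>) = 1" by (metis eq_iff_diff_eq_0 norm_one)
    then have "approach j * cmod z ^ \<mu> = 1" using approach(1)[of j] by (simp add: norm_mult norm_power)
    moreover have "cmod z ^ \<mu> < root \<mu> (1 / approach j) ^ \<mu>" using that \<mu> by (intro power_strict_mono) auto
    moreover have "root \<mu> (1 / approach j) ^ \<mu> = 1 / approach j" using \<mu> approach(1)[of j] by simp
    ultimately show False using approach(1)[of j] by (simp add: field_simps)
  qed
  have Ew: "wiener (E j)" for j
  proof (rule wiener_holomorphic)
    show "E j holomorphic_on ball 0 (root \<mu> (1 / approach j))"
      unfolding E_def using den by (intro holomorphic_intros) auto
    show "1 < root \<mu> (1 / approach j)" using \<mu> approach(1,2)[of j] by simp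
  qed
  have "\<exists>q. summable (\<lambda>k. cmod (q k)) \<and> (\<forall>z. cmod z \<le> 1 \<longrightarrow> power_series q z = power_series g z * (G z * E j z ^ n))" for j
    using wiener_mult[OF gw wiener_mult[OF G(1) wiener_power[OF Ew[of j]]]] unfolding wiener_def .
  then obtain q where q: "\<And>j. summable (\<lambda>k. cmod (q j k))"
    "\<And>j z. cmod z \<le> 1 \<Longrightarrow> power_series (q j) z = power_series g z * (G z * E j z ^ n)"
    by metis
  have q0: "q j 0 = 0" for j
  proof -
    have "power_series c 0 = c 0" for c unfolding power_series_def by (rule powser_zero)
    then show ?thesis using q(2)[of 0 j] g0 by simp
  qed
  \<comment> \<open>The \<open>j\<close>-th approximation is a partial sum with error below \<open>1 / (j + 1)\<close>.\<close>
  have "\<exists>M. \<forall>z. cmod z \<le> 1 \<longrightarrow> cmod ((\<Sum>k<M. q j k * z ^ k) - power_series (q j) z) < 1 / real (Suc j)" for j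
  proof -
    obtain N where "\<forall>m\<ge>N. \<forall>z\<in>cball 0 1. dist (\<Sum>k<m. q j k * z ^ k) (power_series (q j) z) < 1 / real (Suc j)"
      using uniform_limitD[OF power_series_uniform_limit[OF q(1)[of j]], of "1 / real (Suc j)"]
      by (auto simp: eventually_sequentially)
    then show ?thesis by (intro exI[of _ N]) (simp add: dist_norm)
  qed
  then obtain M where M: "\<And>j z. cmod z \<le> 1 \<Longrightarrow> cmod ((\<Sum>k<M j. q j k * z ^ k) - power_series (q j) z) < 1 / real (Suc j)"
    by metis
  define T where "T j x = (\<Sum>k<M j. q j k * cis (- x) ^ k)" for j x
  define s where "s j x = T j x * \<kappa> x" for j x
  have Tm [measurable]: "T j \<in> borel_measurable borel" for j
    using cis_measurable[of "-1"] unfolding T_def[abs_def] by simp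
  have s_lc: "s j \<in> lin_combs generators" for j
  proof -
    have "s j = (\<lambda>x. \<Sum>k\<in>{1..<M j}. q j k * (cis (x * of_int (- int k)) * \<kappa> x))"
    proof
      fix x
      have "T j x = (\<Sum>k\<in>{1..<M j}. q j k * cis (- x) ^ k)"
        unfolding T_def by (rule sum.mono_neutral_right) (auto simp: q0 not_le)
      then show "s j x = (\<Sum>k\<in>{1..<M j}. q j k * (cis (x * of_int (- int k)) * \<kappa> x))"
        by (simp add: s_def sum_distrib_left cis_power mult_ac)
    qed
    moreover have "(\<lambda>x. \<Sum>k\<in>{1..<M j}. q j k * (cis (x * of_int (- int k)) * \<kappa> x)) \<in> lin_combs generators"
    proof (rule lin_combs_sum)
      fix k assume k: "k \<in> {1..<M j}"
      then show "(\<lambda>x. cis (x * of_int (- int k)) * \<kappa> x) \<in> generators"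
        unfolding generators_def by (intro CollectI exI[of _ "- int k"]) auto
    qed simp
    ultimately show ?thesis by simp
  qed
  let ?C = "\<Sum>k. cmod (\<psi> k)"
  have PsiC: "cmod (\<Psi> x) \<le> ?C" for x unfolding \<Psi>_def by (rule power_series_cis_measurable(2)[OF abs_psi]) simp
  let ?g = "\<lambda>x. power_series g (cis (- x))" and ?q = "\<lambda>j x. power_series (q j) (cis (- x))"
  have gm [measurable]: "?g \<in> borel_measurable borel" using power_series_cis_measurable(1)[OF g, of "-1"] by simp
  have qm [measurable]: "?q j \<in> borel_measurable borel" for j using power_series_cis_measurable(1)[OF q(1)[of j], of "-1"] by simp
  have gsq: "sq_integrable circ ?g" using sq_integrable_power_series[OF g, of "-1"] by simp
  have TPsi: "L2_tendsto circ (\<lambda>j x. T j x * \<Psi> x - ?q j x * \<Psi> x) (\<lambda>x. 0)"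
  proof (rule L2_tendsto_uniform[OF circ.finite_measure_axioms])
    have bd: "cmod (T j x * \<Psi> x - ?q j x * \<Psi> x) \<le> ?C * (1 / real (Suc j))" for j x
    proof -
      have "cmod (T j x - ?q j x) \<le> 1 / real (Suc j)" using M[of "cis (- x)" j] by (simp add: T_def)
      then have "cmod (\<Psi> x) * cmod (T j x - ?q j x) \<le> ?C * (1 / real (Suc j))"
        using PsiC order_trans[OF norm_ge_zero PsiC] by (intro mult_mono) auto
      moreover have "T j x * \<Psi> x - ?q j x * \<Psi> x = \<Psi> x * (T j x - ?q j x)" by (simp add: algebra_simps)
      ultimately show ?thesis by (simp only: norm_mult)
    qed
    then show "\<And>j x. cmod (T j x * \<Psi> x - ?q j x * \<Psi> x - 0) \<le> ?C * (1 / real (Suc j))" by simp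
    show "sq_integrable circ (\<lambda>x. T j x * \<Psi> x - ?q j x * \<Psi> x)" for j
      by (rule sq_integrable_bounded[OF circ.finite_measure_axioms _ bd]) measurable
    have "(\<lambda>j. ?C * (1 / real (Suc j))) \<longlonglongrightarrow> ?C * 0"
      by (intro tendsto_intros) (use LIMSEQ_inverse_real_of_nat in \<open>simp add: inverse_eq_divide\<close>)
    then show "(\<lambda>j. ?C * (1 / real (Suc j))) \<longlonglongrightarrow> 0" by simp
  qed simp
  define F where "F j x = ((1 - cis (- x) ^ \<mu>) * E j (cis (- x))) ^ n" for j x
  have qPsi_eq: "?q j x * \<Psi> x = ?g x * F j x" for j x
    using q(2)[of "cis (- x)" j] G(2)[of "cis (- x)"]
    by (simp add: \<Psi>_def F_def power_mult_distrib mult_ac)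
  have F_bound: "cmod (F j x) \<le> 2 ^ n" for j x
  proof -
    let ?w = "cis (- x) ^ \<mu>"
    have w: "cmod ?w = 1" by (simp add: norm_power)
    have le: "cmod (1 - ?w) \<le> 2 * cmod (1 - of_real (approach j) * ?w)"
      using approach(1,2)[of j] by (intro one_minus_scaled_ge w) auto
    have "1 < root \<mu> (1 / approach j)" using \<mu> approach(1,2)[of j] by simp
    then have "1 - of_real (approach j) * ?w \<noteq> 0" by (intro den) simp
    then have pos: "0 < cmod (1 - of_real (approach j) * ?w)" by (rule zero_less_norm_iff[THEN iffD2])
    have "cmod ((1 - ?w) * E j (cis (- x))) = cmod (1 - ?w) / cmod (1 - of_real (approach j) * ?w)"
      by (simp only: E_def norm_mult norm_inverse divide_inverse)
    also have "\<dots> \<le> 2" using le pos by (simp only: pos_divide_le_eq)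
    finally have "cmod ((1 - ?w) * E j (cis (- x))) \<le> 2" .
    then show ?thesis unfolding F_def norm_power by (intro power_mono) auto
  qed
  have F_lim: "AE x in circ. (\<lambda>j. F j x) \<longlonglongrightarrow> 1"
    using cis_eq_1_AE_circ[OF \<mu>]
  proof eventually_elim
    case (elim x)
    then have nz: "1 - of_real 1 * cis (- x) ^ \<mu> \<noteq> 0" by (simp add: cis_power mult.commute)
    have "(\<lambda>j. F j x) \<longlonglongrightarrow> ((1 - cis (- x) ^ \<mu>) * inverse (1 - of_real 1 * cis (- x) ^ \<mu>)) ^ n"
      unfolding F_def E_def by (intro tendsto_intros approach nz)
    then show ?case using nz by simp
  qed
  have Fm [measurable]: "F j \<in> borel_measurable borel" for j
    using cis_measurable[of "-1"] unfolding F_def[abs_def] E_def by simp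
  have qPsi: "L2_tendsto circ (\<lambda>j x. ?q j x * \<Psi> x) ?g"
    unfolding L2_tendsto_def
  proof (intro conjI allI gsq)
    let ?B = "(\<Sum>k. cmod (g k))"
    have gB: "cmod (?g x) \<le> ?B" for x by (rule power_series_cis_measurable(2)[OF g]) simp
    have B0: "0 \<le> ?B" using order_trans[OF norm_ge_zero gB] by blast
    show "sq_integrable circ (\<lambda>x. ?q j x * \<Psi> x)" for j
      unfolding qPsi_eq
    proof (rule sq_integrable_bounded[OF circ.finite_measure_axioms])
      show "cmod (?g x * F j x) \<le> ?B * 2 ^ n" for x
        unfolding norm_mult by (intro mult_mono gB F_bound B0) auto
    qed measurable
    have "(\<lambda>j. LINT x|circ. (cmod (?g x * F j x - ?g x))\<^sup>2) \<longlonglongrightarrow> (LINT x|circ. 0)"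
    proof (rule integral_dominated_convergence[where w = "\<lambda>_. (?B * (2 ^ n + 1))\<^sup>2"])
      show "AE x in circ. (\<lambda>j. (cmod (?g x * F j x - ?g x))\<^sup>2) \<longlonglongrightarrow> 0"
        using F_lim
      proof eventually_elim
        case (elim x)
        have "(\<lambda>j. (cmod (?g x * F j x - ?g x))\<^sup>2) \<longlonglongrightarrow> (cmod (?g x * 1 - ?g x))\<^sup>2" by (intro tendsto_intros elim)
        then show ?case by simp
      qed
      show "AE x in circ. norm ((cmod (?g x * F j x - ?g x))\<^sup>2) \<le> (?B * (2 ^ n + 1))\<^sup>2" for j
      proof (rule AE_I2)
        fix x
        have "cmod (F j x - 1) \<le> 2 ^ n + 1" using F_bound[of j x] norm_triangle_ineq4[of "F j x" 1] by simp
        then have "cmod (?g x) * cmod (F j x - 1) \<le> ?B * (2 ^ n + 1)" by (intro mult_mono gB B0) auto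
        moreover have "cmod (?g x * F j x - ?g x) = cmod (?g x) * cmod (F j x - 1)"
          by (simp add: norm_mult[symmetric] right_diff_distrib)
        ultimately have "(cmod (?g x * F j x - ?g x))\<^sup>2 \<le> (?B * (2 ^ n + 1))\<^sup>2" by (intro power_mono) auto
        then show "norm ((cmod (?g x * F j x - ?g x))\<^sup>2) \<le> (?B * (2 ^ n + 1))\<^sup>2"
          by (simp only: real_norm_def abs_of_nonneg zero_le_power2)
      qed
    qed auto
    then show "(\<lambda>j. LINT x|circ. (cmod (?q j x * \<Psi> x - ?g x))\<^sup>2) \<longlonglongrightarrow> 0" unfolding qPsi_eq by simp
  qed
  have TL: "L2_tendsto circ (\<lambda>j x. T j x * \<Psi> x) ?g"
    using L2_tendsto_add_cmult[OF TPsi qPsi, of 1] by simp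
  have um [measurable]: "u \<in> borel_measurable borel" by (rule u)
  have usq: "sq_integrable circ (\<lambda>x. u x * \<Psi> x)"
    by (subst sq_integrable_cong_AE[OF u_eq]) (use gsq in auto)
  have "L2_tendsto K s (\<lambda>x. u x * \<kappa> x)"
    unfolding L2_tendsto_iff_l2n
  proof (intro conjI allI)
    show "sq_integrable K (\<lambda>x. u x * \<kappa> x)" using usq by (simp add: weighted_norm(1))
    show "sq_integrable K (s k)" for k
      using TL unfolding s_def[abs_def] by (simp add: weighted_norm(1) L2_tendsto_def)
    have eq: "l2n K (\<lambda>x. s j x - u x * \<kappa> x) = sqrt (2 * pi) * l2n circ (\<lambda>x. T j x * \<Psi> x - ?g x)" for j
    proof -
      have "l2n K (\<lambda>x. s j x - u x * \<kappa> x) = l2n K (\<lambda>x. (T j x - u x) * \<kappa> x)"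
        by (simp add: s_def left_diff_distrib)
      also have "\<dots> = sqrt (2 * pi * (l2n circ (\<lambda>x. (T j x - u x) * \<Psi> x))\<^sup>2)"
        by (subst weighted_norm(2)[symmetric]) auto
      also have "l2n circ (\<lambda>x. (T j x - u x) * \<Psi> x) = l2n circ (\<lambda>x. T j x * \<Psi> x - ?g x)"
        by (rule l2n_cong_AE) (use u_eq in \<open>auto elim!: eventually_mono simp: left_diff_distrib\<close>)
      finally show ?thesis by (simp add: real_sqrt_mult)
    qed
    have "(\<lambda>j. sqrt (2 * pi) * l2n circ (\<lambda>x. T j x * \<Psi> x - ?g x)) \<longlonglongrightarrow> sqrt (2 * pi) * 0"
      by (intro tendsto_intros) (use TL in \<open>simp add: L2_tendsto_iff_l2n\<close>)
    then show "(\<lambda>j. l2n K (\<lambda>x. s j x - u x * \<kappa> x)) \<longlonglongrightarrow> 0" unfolding eq by simp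
  qed
  then show ?thesis
    unfolding L2_past_def L2_closed_span_def using s_lc generators_def by auto
qed

end

section \<open>The optimal spectral characteristic\<close>

locale summable_functional = factorized_density n \<mu> f \<phi>
  for n \<mu> :: nat and f :: "real \<Rightarrow> real" and \<phi> :: "nat \<Rightarrow> complex" +
  fixes a :: "nat \<Rightarrow> complex"
  assumes D_summable: "\<And>k. summable (\<lambda>j. D_mat n \<mu> k j * a j)"
    and abs_b: "summable (\<lambda>k. cmod (D_op n \<mu> a k))"
begin

abbreviation "b \<equiv> D_op n \<mu> a"
abbreviation "c \<equiv> D_op n \<mu> (A_op a \<psi>)"
abbreviation "h \<equiv> h_opt n \<mu> a \<phi>"

lemma c_eq: "c = (\<lambda>k. \<Sum>j. \<psi> j * b (k + j))"
  by (rule ext) (rule D_op_A_op[OF \<mu> n D_summable abs_psi])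

lemma abs_c: "summable (\<lambda>k. cmod (c k))"
  unfolding c_eq by (rule product_split(1)[OF abs_b abs_psi])

lemma A_measurable [measurable]: "(\<lambda>x. A_fun n \<mu> a (cis x)) \<in> borel_measurable borel"
  unfolding A_fun_def using power_series_cis_measurable(1)[OF abs_b, of 1] by simp

lemma r_measurable [measurable]: "(\<lambda>x. r_fun n \<mu> a \<phi> (cis x)) \<in> borel_measurable borel"
  unfolding r_fun_def using power_series_cis_measurable(1)[OF abs_c, of 1] by simp

lemma h_eq: "h x = A_fun n \<mu> a (cis x) - r_fun n \<mu> a \<phi> (cis x) * inverse (\<Psi> x)"
  by (simp add: h_opt_def \<Psi>_def)

lemma h_measurable [measurable]: "h \<in> borel_measurable borel"
  unfolding h_eq[abs_def] by measurable

lemma A_bound: "cmod (A_fun n \<mu> a (cis x)) \<le> (\<Sum>k. cmod (b k))"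
  unfolding A_fun_def by (rule power_series_cis_measurable(2)[OF abs_b]) simp

lemma A_kernel_sq:
  assumes "finite_measure N" "sets N = sets borel"
  shows "sq_integrable N (\<lambda>x. A_fun n \<mu> a (cis x) * \<kappa> x)"
  by (rule sq_integrable_bounded_kernel[OF assms A_measurable A_bound])

text \<open>
  The characteristic is chosen so that \<open>h \<Psi> = A \<Psi> - r\<close> is the part of \<open>A \<Psi>\<close> with negative frequencies.
\<close>
lemma h_past: "(\<lambda>x. h x * \<kappa> x) \<in> L2_past n \<mu> f"
proof -
  obtain g where g: "summable (\<lambda>k. cmod (g k))" "g 0 = 0"
    "\<And>x. power_series b (cis x) * \<Psi> x = power_series c (cis x) + power_series g (cis (- x))"
    using product_split(2)[OF abs_b abs_psi] unfolding c_eq[symmetric] \<Psi>_def by blast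
  show ?thesis
  proof (rule analytic_past[OF g(1,2) h_measurable])
    show "AE x in circ. h x * \<Psi> x = power_series g (cis (- x))"
      using Psi_nonzero
    proof eventually_elim
      case (elim x)
      have "h x * \<Psi> x = power_series b (cis x) * \<Psi> x - power_series c (cis x) * (inverse (\<Psi> x) * \<Psi> x)"
        unfolding h_eq A_fun_def r_fun_def by (simp add: algebra_simps)
      then show ?case using elim g(3)[of x] by simp
    qed
  qed
qed

lemma past_sq: "u \<in> L2_past n \<mu> f \<Longrightarrow> sq_integrable K u"
  unfolding L2_past_def L2_closed_span_def L2_tendsto_def by blast

text \<open>
  \<open>A \<kappa> - u\<close> is the sum of the residual \<open>A \<kappa> - h \<kappa>\<close>, which is orthogonal to the past, and of \<open>h \<kappa> - u\<close>,
  which belongs to the past; the residual has the norm of \<open>r\<close>.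
\<close>
lemma residual_pythagoras:
  assumes u: "u \<in> L2_past n \<mu> f"
  shows "(l2n K (\<lambda>x. A_fun n \<mu> a (cis x) * \<kappa> x - u x))\<^sup>2
    = 2 * pi * (l2n circ (\<lambda>x. r_fun n \<mu> a \<phi> (cis x)))\<^sup>2 + (l2n K (\<lambda>x. h x * \<kappa> x - u x))\<^sup>2"
proof -
  define e where "e x = power_series c (cis x) * inverse (\<Psi> x) * \<kappa> x" for x
  note E = orthogonal_past[OF abs_c, folded e_def]
  have sq: "sq_integrable K (\<lambda>x. h x * \<kappa> x)" "sq_integrable K u" using past_sq u h_past by blast+
  have orth: "(LINT x|K. e x * cnj (h x * \<kappa> x - u x)) = 0"
    using E(3)[OF h_past] E(3)[OF u] sq_integrable_prod[OF E(1) sq(1)] sq_integrable_prod[OF E(1) sq(2)]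
    by (simp add: right_diff_distrib)
  have split: "A_fun n \<mu> a (cis x) * \<kappa> x - u x = e x + (h x * \<kappa> x - u x)" for x
    by (simp add: h_eq e_def r_fun_def algebra_simps)
  show ?thesis
    unfolding split l2n_pythagoras[OF E(1) sq_integrable_diff[OF sq] orth] E(2) r_fun_def ..
qed

text \<open>
  The convergence is uniform, since \<open>b\<close> is absolutely summable and \<open>|\<kappa>| \<le> \<mu>\<^sup>n\<close>.
\<close>
lemma partial_sums_kernel:
  assumes fin: "finite_measure N" and sets: "sets N = sets borel"
  shows "L2_tendsto N (\<lambda>m x. \<Sum>k<m. b k * (cis (x * of_int (int k)) * \<kappa> x)) (\<lambda>x. A_fun n \<mu> a (cis x) * \<kappa> x)"
proof (rule L2_tendsto_uniform[OF fin])
  show "sq_integrable N (\<lambda>x. \<Sum>k<m. b k * (cis (x * of_int (int k)) * \<kappa> x))" for m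
    by (intro sq_integrable_sum sq_integrable_cmult sq_integrable_bounded_kernel[OF fin sets, where C = 1]) auto
  show "sq_integrable N (\<lambda>x. A_fun n \<mu> a (cis x) * \<kappa> x)" by (rule A_kernel_sq[OF fin sets])
  show "cmod ((\<Sum>k<m. b k * (cis (x * of_int (int k)) * \<kappa> x)) - A_fun n \<mu> a (cis x) * \<kappa> x)
      \<le> (\<Sum>k. cmod (b (k + m))) * real \<mu> ^ n" for m x
  proof -
    have eq: "(\<Sum>k<m. b k * (cis (x * of_int (int k)) * \<kappa> x)) - A_fun n \<mu> a (cis x) * \<kappa> x
       = ((\<Sum>k<m. b k * cis x ^ k) - power_series b (cis x)) * \<kappa> x"
      by (simp add: A_fun_def cis_power sum_distrib_left algebra_simps)
    have "cmod ((\<Sum>k<m. b k * cis x ^ k) - power_series b (cis x)) \<le> (\<Sum>k. cmod (b (k + m)))"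
      by (rule power_series_tail[OF abs_b]) simp
    then show ?thesis
      unfolding eq norm_mult by (rule mult_mono'[OF _ increment_kernel_bound]) simp_all
  qed
  have "(\<lambda>m. (\<Sum>k. cmod (b (k + m))) * real \<mu> ^ n) \<longlonglongrightarrow> 0 * real \<mu> ^ n"
    by (intro tendsto_intros suminf_exist_split2 abs_b)
  then show "(\<lambda>m. (\<Sum>k. cmod (b (k + m))) * real \<mu> ^ n) \<longlonglongrightarrow> 0" by simp
qed

end

theorem theorem3p2:
  fixes M :: "'w measure" and \<xi> :: "int \<Rightarrow> 'w \<Rightarrow> complex" and n \<mu> :: nat
    and F f :: "real \<Rightarrow> real" and Z :: "real set \<Rightarrow> 'w \<Rightarrow> complex"
    and \<phi> a :: "nat \<Rightarrow> complex"
  assumes "prob_space M" and "n \<ge> 1" and "\<mu> > 0"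
    and "stationary_increments M n \<xi>"
    and "\<And>m \<nu>. (LINT \<omega>|M. increment n \<xi> m \<nu> \<omega>) = 0"
    and "spectral_representation M n \<xi> F Z"
    and "spectral_density F f"
    and "canonical_factorization f \<phi>"
    and "\<And>k. summable (\<lambda>j. D_mat n \<mu> k j * a j)"
    and "summable (\<lambda>k. cmod (D_op n \<mu> a k))"
    and "summable (\<lambda>k. real (k + 1) * (cmod (D_op n \<mu> a k))\<^sup>2)"
  shows
    "let A\<xi> = A_functional M n \<mu> a \<xi>;
         h = h_opt n \<mu> a \<phi>;
         A_hat = (\<lambda>\<omega>. - (\<Sum>k = - (int \<mu> * int n)..-1. v_coeff n \<mu> a k * \<xi> k \<omega>)
                      + stoch_integral M F Z (\<lambda>x. h x * increment_kernel n \<mu> x) \<omega>)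
     in L2_tendsto M (B_partial n \<mu> a \<xi>) (B_functional M n \<mu> a \<xi>)
      \<and> optimal_linear_estimate M n \<mu> a \<xi> F Z f h A_hat
      \<and> (\<forall>h' Y. optimal_linear_estimate M n \<mu> a \<xi> F Z f h' Y \<longrightarrow> (AE \<omega> in M. Y \<omega> = A_hat \<omega>))
      \<and> sq_integrable M (\<lambda>\<omega>. A\<xi> \<omega> - A_hat \<omega>)
      \<and> set_integrable lborel {-pi..pi} (\<lambda>x. (cmod (r_fun n \<mu> a \<phi> (cis x)))\<^sup>2)
      \<and> (LINT \<omega>|M. (cmod (A\<xi> \<omega> - A_hat \<omega>))\<^sup>2)
          = 1 / (2 * pi) * (LINT x:{-pi..pi}|lborel. (cmod (r_fun n \<mu> a \<phi> (cis x)))\<^sup>2)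
      \<and> (\<lambda>k. (cmod (D_op n \<mu> (A_op a (phi_mu n \<mu> \<phi>)) k))\<^sup>2)
          sums (LINT \<omega>|M. (cmod (A\<xi> \<omega> - A_hat \<omega>))\<^sup>2)"
proof -
  have F: "spectral_function F" and Z: "orthogonal_stochastic_measure M F Z"
    and rep: "\<And>m. has_stoch_integral M F Z (\<lambda>x. cis (x * of_int m) * increment_kernel n \<mu> x) (increment n \<xi> m (int \<mu>))"
    using assms(3,6) by (auto simp: spectral_representation_def)
  interpret summable_functional n \<mu> f \<phi> a
    by unfold_locales (use assms in \<open>auto simp: spectral_density_def\<close>)
  note basic = spectral_measure_basic[OF F assms(7) nonneg]
  interpret prob_space M by fact
  interpret Z: orthogonal_measure M F Z 
    by (intro orthogonal_measure.intro orthogonal_measure_axioms.intro assms(1) Z basic)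
  note to_N = L2_density_space_spectral[OF F assms(7) nonneg]
  define A\<kappa> where "A\<kappa> x = A_fun n \<mu> a (cis x) * \<kappa> x" for x
  define r where "r x = r_fun n \<mu> a \<phi> (cis x)" for x
  define I where "I = stoch_integral M F Z (\<lambda>x. h x * \<kappa> x)"
  define B where "B = B_functional M n \<mu> a \<xi>"
  define V where "V = V_functional n \<mu> a \<xi>"
  define A_hat where "A_hat \<omega> = - V \<omega> + I \<omega>" for \<omega>
  have A\<kappa>K: "sq_integrable K A\<kappa>"
    unfolding A\<kappa>_def[abs_def] by (rule A_kernel_sq[OF finite_K]) simp

  have B_part: "has_stoch_integral M F Z (\<lambda>x. \<Sum>k<m. b k * (cis (x * of_int (int k)) * \<kappa> x)) (B_partial n \<mu> a \<xi> m)" for m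
    unfolding B_partial_def[abs_def] by (rule Z.has_stoch_integral_sum) (rule rep)
  have A_lim: "L2_tendsto Z.N (\<lambda>m x. \<Sum>k<m. b k * (cis (x * of_int (int k)) * \<kappa> x)) A\<kappa>"
    unfolding A\<kappa>_def[abs_def] by (rule partial_sums_kernel[OF basic(1)]) simp
  note lims = Z.L2_limit_stoch_integrals[OF B_part A_lim]
  have B_lim: "L2_tendsto M (B_partial n \<mu> a \<xi>) B"
    unfolding B_def B_functional_def L2_lim_def using someI_ex[OF lims(1)] .
  have B_sq: "sq_integrable M B" using B_lim by (simp add: L2_tendsto_def)

  have error: "sq_integrable M (\<lambda>\<omega>. B \<omega> - Y \<omega>)"
      "(l2n M (\<lambda>\<omega>. B \<omega> - Y \<omega>))\<^sup>2 = (l2n circ r)\<^sup>2 + (l2n K (\<lambda>x. h x * \<kappa> x - u x))\<^sup>2 / (2 * pi)"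
    if u: "u \<in> L2_past n \<mu> f" and Y: "has_stoch_integral M F Z u Y" for u Y
  proof -
    show "sq_integrable M (\<lambda>\<omega>. B \<omega> - Y \<omega>)"
      by (intro sq_integrable_diff B_sq Z.has_stoch_integral_sq[OF Y])
    have "(l2n M (\<lambda>\<omega>. B \<omega> - Y \<omega>))\<^sup>2 = (l2n Z.N (\<lambda>x. A\<kappa> x - u x))\<^sup>2"
      by (simp only: lims(2)[OF B_lim Y])
    also have "\<dots> = (l2n K (\<lambda>x. A\<kappa> x - u x))\<^sup>2 / (2 * pi)"
      by (rule to_N(2)[OF sq_integrable_diff[OF A\<kappa>K past_sq[OF u]]])
    also have "(l2n K (\<lambda>x. A\<kappa> x - u x))\<^sup>2 = 2 * pi * (l2n circ r)\<^sup>2 + (l2n K (\<lambda>x. h x * \<kappa> x - u x))\<^sup>2"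
      using residual_pythagoras[OF u] by (simp add: A\<kappa>_def r_def[abs_def])
    finally show "(l2n M (\<lambda>\<omega>. B \<omega> - Y \<omega>))\<^sup>2 = (l2n circ r)\<^sup>2 + (l2n K (\<lambda>x. h x * \<kappa> x - u x))\<^sup>2 / (2 * pi)"
      by (simp add: add_divide_distrib)
  qed

  have I: "has_stoch_integral M F Z (\<lambda>x. h x * \<kappa> x) I"
    unfolding I_def by (rule Z.has_stoch_integral_stoch_integral[OF to_N(1)[OF past_sq[OF h_past]]])
  have diff: "A_functional M n \<mu> a \<xi> \<omega> - (- V \<omega> + Y \<omega>) = B \<omega> - Y \<omega>" for Y \<omega>
    by (simp add: A_functional_def B_def V_def)
  have mse: "mean_square_error M n \<mu> a \<xi> (\<lambda>\<omega>. - V \<omega> + Y \<omega>) = (l2n M (\<lambda>\<omega>. B \<omega> - Y \<omega>))\<^sup>2" for Y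
    by (simp only: mean_square_error_def diff l2n_sq)
  \<comment> \<open>Taking \<open>u = h \<kappa>\<close> in the error formula leaves the first term only.\<close>
  have err_hat: "(l2n M (\<lambda>\<omega>. B \<omega> - I \<omega>))\<^sup>2 = (l2n circ r)\<^sup>2"
    using error(2)[OF h_past I] by (simp add: l2n_def)
  have est_hat: "linear_estimate M n \<mu> a \<xi> F Z f h A_hat"
    unfolding linear_estimate_def A_hat_def[abs_def] V_def using h_past I by blast

  have optimal: "optimal_linear_estimate M n \<mu> a \<xi> F Z f h A_hat"
    unfolding optimal_linear_estimate_def
  proof (intro conjI allI impI est_hat)
    fix h' Y' assume "linear_estimate M n \<mu> a \<xi> F Z f h' Y'"
    then obtain I' where h': "(\<lambda>x. h' x * \<kappa> x) \<in> L2_past n \<mu> f"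
      and I': "has_stoch_integral M F Z (\<lambda>x. h' x * \<kappa> x) I'" and Y': "Y' = (\<lambda>\<omega>. - V \<omega> + I' \<omega>)"
      unfolding linear_estimate_def V_def by blast
    show "mean_square_error M n \<mu> a \<xi> A_hat \<le> mean_square_error M n \<mu> a \<xi> Y'"
      unfolding Y' A_hat_def[abs_def] mse err_hat error(2)[OF h' I'] by simp
  qed

  have unique: "AE \<omega> in M. Y \<omega> = A_hat \<omega>" if opt: "optimal_linear_estimate M n \<mu> a \<xi> F Z f h' Y" for h' Y
  proof -
    from opt obtain I' where h': "(\<lambda>x. h' x * \<kappa> x) \<in> L2_past n \<mu> f"
      and I': "has_stoch_integral M F Z (\<lambda>x. h' x * \<kappa> x) I'" and Y': "Y = (\<lambda>\<omega>. - V \<omega> + I' \<omega>)"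
      unfolding optimal_linear_estimate_def linear_estimate_def V_def by blast
    have "mean_square_error M n \<mu> a \<xi> Y \<le> mean_square_error M n \<mu> a \<xi> A_hat"
      using opt est_hat unfolding optimal_linear_estimate_def by blast
    then have "(l2n K (\<lambda>x. h x * \<kappa> x - h' x * \<kappa> x))\<^sup>2 / (2 * pi) \<le> 0"
      unfolding Y' A_hat_def[abs_def] mse err_hat error(2)[OF h' I'] by simp
    then have "(l2n K (\<lambda>x. h x * \<kappa> x - h' x * \<kappa> x))\<^sup>2 \<le> 0"
      by (subst (asm) pos_divide_le_eq) auto
    then have zero: "(l2n K (\<lambda>x. h x * \<kappa> x - h' x * \<kappa> x))\<^sup>2 = 0"
      by (rule antisym) simp
    have sqd: "sq_integrable K (\<lambda>x. h x * \<kappa> x - h' x * \<kappa> x)"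
      by (intro sq_integrable_diff past_sq h_past h')
    have "(l2n M (\<lambda>\<omega>. I \<omega> - I' \<omega>))\<^sup>2 = 0"
      using Z.has_stoch_integral_isometry[OF Z.has_stoch_integral_diff[OF I I']] to_N(2)[OF sqd] zero by simp
    then have "AE \<omega> in M. I \<omega> - I' \<omega> = 0"
      using l2n_eq_0_iff[OF Z.has_stoch_integral_sq(2)[OF Z.has_stoch_integral_diff[OF I I']]] by simp
    then show ?thesis by eventually_elim (simp add: Y' A_hat_def)
  qed

  have r_sq: "sq_integrable circ r"
    unfolding r_def[abs_def] r_fun_def using sq_integrable_power_series[OF abs_c, of 1] by simp
  have rm: "(\<lambda>x. (cmod (r x))\<^sup>2) \<in> borel_measurable borel" unfolding r_def by measurable
  have r_int: "set_integrable lborel {-pi..pi} (\<lambda>x. (cmod (r x))\<^sup>2)"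
    using sq_integrable_integrable[OF r_sq] unfolding circ_integral(2)[OF rm] .
  have r_norm: "(l2n circ r)\<^sup>2 = 1 / (2 * pi) * (LINT x:{-pi..pi}|lborel. (cmod (r x))\<^sup>2)"
    unfolding l2n_sq circ_integral(1)[OF rm] by simp
  have parseval: "(\<lambda>k. (cmod (c k))\<^sup>2) sums (l2n circ r)\<^sup>2"
    unfolding r_def[abs_def] r_fun_def by (rule parseval_power_series[OF abs_c])
  have err: "(LINT \<omega>|M. (cmod (A_functional M n \<mu> a \<xi> \<omega> - A_hat \<omega>))\<^sup>2) = (l2n circ r)\<^sup>2"
    unfolding A_hat_def diff l2n_sq[symmetric] by (rule err_hat)
  have sq: "sq_integrable M (\<lambda>\<omega>. A_functional M n \<mu> a \<xi> \<omega> - A_hat \<omega>)"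
    unfolding A_hat_def diff by (rule error(1)[OF h_past I])
  have A_hat: "- (\<Sum>k = - (int \<mu> * int n)..-1. v_coeff n \<mu> a k * \<xi> k \<omega>)
      + stoch_integral M F Z (\<lambda>x. h x * increment_kernel n \<mu> x) \<omega> = A_hat \<omega>" for \<omega>
    by (simp add: A_hat_def V_def V_functional_def I_def)
  show ?thesis
    unfolding Let_def A_hat
    using B_lim optimal unique sq r_int r_norm parseval err
    unfolding B_def r_def by (intro conjI allI impI) simp_all
qed

end
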